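(* Let $N$ be a knot manifold and let $\mathsf{X}$ be an irreducible algebraic component of the $\mathrm{SL}_2(\mathbb{C})$-character variety $\mathsf{X}(N)$. Let $\mathsf{X}^\circ$ be the union of the irreducible components $\mathsf{X}'$ of $\mathsf{X}(N)$ such that (1) $\mathsf{X}'$ detects a closed essential surface if and only if $\mathsf{X}$ does, and (2) for each slope $\alpha$, $\mathsf{X}'$ detects a surface with boundary slope $\alpha$ if and only if $\mathsf{X}$ does. Then $\mathsf{X}^\circ$ is defined over $\mathbb{Q}$.
   Context: A knot manifold is a connected, compact, irreducible, orientable 3-manifold $N$ whose boundary is an incompressible torus. Put $\Gamma=\pi_1(N)$. $\mathsf{X}(N)$ is the set of characters $\chi_\rho=\mathrm{Tr}\circ\rho$ of representations $\rho\colon\Gamma\to\mathrm{SL}_2(\mathbb{C})$; it is an affine algebraic set. For $\gamma\in\Gamma$, $I_\gamma(\chi)=\chi(\gamma)$. If $\gamma_1,\dots,\gamma_n$ generate $\Gamma$, the functions $I_V$, $V=\gamma_{j_1}\cdots\gamma_{j_k}$ with $1\le j_1<\dots<j_k\le n$, $1\le k\le n$, embed $\mathsf{X}(N)$ as an algebraic subset of $\mathbb{C}^{2^n-1}$ cut out by polynomials with integer coefficients; "defined over $\mathbb{Q}$" means being the zero set, in such coordinates, of polynomials with rational coefficients. A slope is the unoriented isotopy class of an essential simple closed curve in $\partial N$; for a slope $\alpha$, $I_\alpha:=I_\gamma$ where $\gamma$ is any peripheral element representing $\alpha$. Ideal points: for an irreducible affine curve $C$ over $\mathbb{C}$ with normalization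 $\xi\colon C^\xi\to C$, let $\widetilde{C}\supseteq C^\xi$ be the smooth projective model; the ideal points of $C$ are the points of $\widetilde{C}-C^\xi$. Regular functions on $C$ are viewed as rational functions on $\widetilde{C}$ via $\xi$. Detection (Culler–Shalen): an ideal point $\hat{x}$ of an irreducible affine curve $C\subseteq\mathsf{X}(N)$ determines a valuation on the function field of $C$; extending it to the function field of a curve in the representation variety of $\Gamma$ mapping dominantly to $C$ gives an action of $\Gamma$ on the corresponding Bass–Serre tree of $\mathrm{SL}_2$, and there are non-empty essential surfaces in $N$ dual to this action, said to be associated to $\hat{x}$. Either ($i$) $I_\gamma$ is regular at $\hat{x}$ for every peripheral $\gamma\in\Gamma$, and this is exactly the case in which the associated surface may be chosen closed; or ($ii$) there is a unique slope $\alpha$ with $I_\alpha$ regular at $\hat{x}$, and every boundary component of the associated surfaces represents $\alpha$. An algebraic subset $\mathsf{Z}\subseteq\mathsf{X}(N)$ detects a closed essential surface if some ideal point of some irreducible affine curve $C\subseteq\mathsf{Z}$ is of type ($i$). $\mathsf{Z}$ detects a surface with boundary slope $\alpha$ (detects $\alpha$) if some ideal point (of either type) of some irreducible affine curve $C\subseteq\mathsf{Z}$ has an associated essential surface with non-empty boundary whose boundary components represent $\alpha$. *)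

theory Defs
  imports "HOL-Analysis.Analysis" "HOL-Algebra.Ring" "HOL-Algebra.Generated_Groups"
    "HOL-Homology.Homology"
begin

section \<open>Manifolds and surfaces\<close>

definition half_space :: "(real ^ 'n::{finite,one}) set" where
  "half_space = {x. 0 \<le> x $ 1}"

definition manifold_chart ::
  "'a::topological_space set \<Rightarrow> 'a set \<Rightarrow> ('a \<Rightarrow> real ^ 'n::{finite,one}) \<Rightarrow> bool" where
  "manifold_chart S U f \<longleftrightarrow>
     openin (top_of_set S) U \<and> openin (top_of_set half_space) (f ` U) \<and>
     (\<exists>g. homeomorphism U (f ` U) f g)"

text \<open>Second countability is not required: the definition is only applied to compact sets,
  for which it is automatic.\<close>

definition manifold_with_boundary ::
  "'n::{finite,one} itself \<Rightarrow> 'a::topological_space set \<Rightarrow> bool" where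
  "manifold_with_boundary _ S \<longleftrightarrow>
     (\<forall>x\<in>S. \<exists>U (f :: 'a \<Rightarrow> real ^ 'n::{finite,one}). x \<in> U \<and> manifold_chart S U f)"

definition manifold_boundary ::
  "'n::{finite,one} itself \<Rightarrow> 'a::topological_space set \<Rightarrow> 'a set" where
  "manifold_boundary _ S =
     {x \<in> S. \<exists>U (f :: 'a \<Rightarrow> real ^ 'n::{finite,one}). x \<in> U \<and> manifold_chart S U f \<and> f x $ 1 = 0}"

abbreviation bdry :: "'a::topological_space set \<Rightarrow> 'a set" where
  "bdry N \<equiv> manifold_boundary TYPE(3) N"

text \<open>Orientations are taken on the interior \<open>M\<close>: a choice of generators \<open>\<mu> x\<close> of the local
  homology groups \<open>H\<^sub>3(M, M - x)\<close> that is locally induced by a class in \<open>H\<^sub>3(M, M - U)\<close>.\<close>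

definition orientable_3_manifold :: "'a::topological_space set \<Rightarrow> bool" where
  "orientable_3_manifold N \<longleftrightarrow>
     (let M = N - bdry N; H = (\<lambda>A. relative_homology_group 3 (top_of_set M) (M - A)) in
      \<exists>\<mu>. (\<forall>x\<in>M. \<mu> x \<in> carrier (H {x}) \<and> generate (H {x}) {\<mu> x} = carrier (H {x})) \<and>
          (\<forall>x\<in>M. \<exists>U. openin (top_of_set M) U \<and> x \<in> U \<and>
             (\<exists>a\<in>carrier (H U). \<forall>y\<in>U.
                hom_induced 3 (top_of_set M) (M - U) (top_of_set M) (M - {y}) id a = \<mu> y)))"

definition bicollared :: "'a::topological_space set \<Rightarrow> 'a set \<Rightarrow> bool" where
  "bicollared N S \<longleftrightarrow>
     (\<exists>h k. homeomorphism (S \<times> {-1..1::real}) (h ` (S \<times> {-1..1})) h k \<and>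
        h ` (S \<times> {-1..1}) \<subseteq> N \<and> (\<forall>x\<in>S. h (x, 0) = x) \<and>
        openin (top_of_set N) (h ` (S \<times> {-1<..<1})) \<and>
        (\<forall>x\<in>S. \<forall>t\<in>{-1..1}. h (x, t) \<in> bdry N \<longleftrightarrow> x \<in> bdry N))"

text \<open>The spheres are required to be bicollared (locally flat): a wild sphere in a topological
  manifold need not bound a ball.\<close>

definition irreducible_3_manifold :: "'a::topological_space set \<Rightarrow> bool" where
  "irreducible_3_manifold N \<longleftrightarrow>
     (\<forall>S. S \<subseteq> N - bdry N \<and> S homeomorphic sphere (0 :: real^3) 1 \<and> bicollared N S \<longrightarrow>
        (\<exists>B h k. B \<subseteq> N \<and> homeomorphism (cball (0 :: real^3) 1) B h k \<and> h ` sphere 0 1 = S))"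

definition pi1_injective :: "'a::topological_space set \<Rightarrow> 'a set \<Rightarrow> bool" where
  "pi1_injective N A \<longleftrightarrow>
     (\<forall>p. path p \<and> path_image p \<subseteq> A \<and> pathfinish p = pathstart p \<and>
          homotopic_paths N p (\<lambda>_. pathstart p) \<longrightarrow> homotopic_paths A p (\<lambda>_. pathstart p))"

definition knot_manifold :: "'a::t2_space set \<Rightarrow> bool" where
  "knot_manifold N \<longleftrightarrow>
     connected N \<and> compact N \<and> manifold_with_boundary TYPE(3) N \<and>
     irreducible_3_manifold N \<and> orientable_3_manifold N \<and>
     bdry N homeomorphic (sphere (0 :: complex) 1 \<times> sphere (0 :: complex) 1) \<and>
     pi1_injective N (bdry N)"

definition properly_embedded_surface :: "'a::topological_space set \<Rightarrow> 'a set \<Rightarrow> bool" where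
  "properly_embedded_surface N S \<longleftrightarrow>
     S \<subseteq> N \<and> compact S \<and> manifold_with_boundary TYPE(2) S \<and>
     manifold_boundary TYPE(2) S = S \<inter> bdry N"

text \<open>\<open>F\<close> together with a subset of \<open>\<partial>N\<close> bounds a product region \<open>F \<times> [0,1]\<close>.\<close>

definition boundary_parallel :: "'a::topological_space set \<Rightarrow> 'a set \<Rightarrow> bool" where
  "boundary_parallel N F \<longleftrightarrow>
     (\<exists>h k. homeomorphism (F \<times> {0..1::real}) (h ` (F \<times> {0..1})) h k \<and>
        h ` (F \<times> {0..1}) \<subseteq> N \<and> (\<forall>x\<in>F. h (x, 0) = x) \<and>
        h ` (F \<times> {1} \<union> manifold_boundary TYPE(2) F \<times> {0..1}) \<subseteq> bdry N)"

definition essential_surface :: "'a::topological_space set \<Rightarrow> 'a set \<Rightarrow> bool" where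
  "essential_surface N S \<longleftrightarrow>
     S \<noteq> {} \<and> properly_embedded_surface N S \<and> bicollared N S \<and>
     (\<forall>F\<in>components S. pi1_injective N F \<and> \<not> F homeomorphic sphere (0 :: real^3) 1 \<and>
        \<not> boundary_parallel N F)"

section \<open>Slopes\<close>

definition essential_curve :: "'a::topological_space set \<Rightarrow> 'a set \<Rightarrow> bool" where
  "essential_curve B c \<longleftrightarrow>
     (\<exists>p. simple_path p \<and> pathfinish p = pathstart p \<and> path_image p = c \<and> c \<subseteq> B \<and>
        \<not> homotopic_paths B p (\<lambda>_. pathstart p))"

definition ambient_isotopic :: "'a::topological_space set \<Rightarrow> 'a set \<Rightarrow> 'a set \<Rightarrow> bool" where
  "ambient_isotopic B c c' \<longleftrightarrow>
     (\<exists>H :: real \<times> 'a \<Rightarrow> 'a. continuous_on ({0..1} \<times> B) H \<and>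
        (\<forall>t\<in>{0..1}. \<exists>k. homeomorphism B B (\<lambda>x. H (t, x)) k) \<and>
        (\<forall>x\<in>B. H (0, x) = x) \<and> (\<lambda>x. H (1, x)) ` c = c')"

definition slopes :: "'a::topological_space set \<Rightarrow> 'a set set set" where
  "slopes N = {{c'. ambient_isotopic (bdry N) c c'} |c. essential_curve (bdry N) c}"

section \<open>The fundamental group and the universal cover\<close>

definition path_class :: "'a::topological_space set \<Rightarrow> (real \<Rightarrow> 'a) \<Rightarrow> (real \<Rightarrow> 'a) set" where
  "path_class N p = {q. homotopic_paths N p q}"

definition class_join ::
  "'a::topological_space set \<Rightarrow> (real \<Rightarrow> 'a) set \<Rightarrow> (real \<Rightarrow> 'a) set \<Rightarrow> (real \<Rightarrow> 'a) set" where
  "class_join N P Q = (\<Union>p\<in>P. \<Union>q\<in>Q. path_class N (p +++ q))"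

definition fundamental_group ::
  "'a::topological_space set \<Rightarrow> 'a \<Rightarrow> (real \<Rightarrow> 'a) set monoid" where
  "fundamental_group N x0 =
     \<lparr>carrier = path_class N `
        {p. path p \<and> path_image p \<subseteq> N \<and> pathstart p = x0 \<and> pathfinish p = x0},
      mult = class_join N, one = path_class N (\<lambda>_. x0)\<rparr>"

text \<open>The conjugates of the image of \<open>\<pi>\<^sub>1(\<partial>N)\<close>, i.e. the classes of loops that are freely homotopic
  into \<open>\<partial>N\<close>.\<close>

definition peripheral :: "'a::topological_space set \<Rightarrow> 'a \<Rightarrow> (real \<Rightarrow> 'a) set set" where
  "peripheral N x0 =
     {\<gamma> \<in> carrier (fundamental_group N x0).
        \<exists>p\<in>\<gamma>. \<exists>q. path_image q \<subseteq> bdry N \<and> homotopic_loops N p q}"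

text \<open>The universal cover consists of the homotopy classes of paths starting at the base point; the
  fundamental group acts on it by \<open>class_join\<close>.\<close>

definition universal_cover :: "'a::topological_space set \<Rightarrow> 'a \<Rightarrow> (real \<Rightarrow> 'a) set set" where
  "universal_cover N x0 = path_class N ` {p. path p \<and> path_image p \<subseteq> N \<and> pathstart p = x0}"

definition universal_cover_topology ::
  "'a::topological_space set \<Rightarrow> 'a \<Rightarrow> (real \<Rightarrow> 'a) set topology" where
  "universal_cover_topology N x0 = topology_generated_by
     {{path_class N (p +++ q) |q.
         path q \<and> path_image q \<subseteq> V \<and> pathstart q = pathfinish p} |p V.
      path p \<and> path_image p \<subseteq> N \<and> pathstart p = x0 \<and>
      openin (top_of_set N) V \<and> pathfinish p \<in> V}"

definition cover_projection :: "(real \<Rightarrow> 'a::topological_space) set \<Rightarrow> 'a" where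
  "cover_projection P = pathfinish (SOME p. p \<in> P)"

section \<open>Affine algebraic sets\<close>

text \<open>An affine algebraic set is presented by its set \<open>X\<close> of points and a set \<open>\<Phi>\<close> of coordinate
  functions on it.  The set \<open>\<Phi>\<close> may be infinite, as long as finitely many of its elements
  generate the same algebra \<open>polyfuns UNIV \<Phi>\<close> of regular functions.\<close>

inductive_set polyfuns :: "complex set \<Rightarrow> ('p \<Rightarrow> complex) set \<Rightarrow> ('p \<Rightarrow> complex) set"
  for K :: "complex set" and \<Phi> :: "('p \<Rightarrow> complex) set" where
  const: "c \<in> K \<Longrightarrow> (\<lambda>_. c) \<in> polyfuns K \<Phi>"
| coord: "\<phi> \<in> \<Phi> \<Longrightarrow> \<phi> \<in> polyfuns K \<Phi>"
| add: "f \<in> polyfuns K \<Phi> \<Longrightarrow> g \<in> polyfuns K \<Phi> \<Longrightarrow> (\<lambda>x. f x + g x) \<in> polyfuns K \<Phi>"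
| mult: "f \<in> polyfuns K \<Phi> \<Longrightarrow> g \<in> polyfuns K \<Phi> \<Longrightarrow> (\<lambda>x. f x * g x) \<in> polyfuns K \<Phi>"

definition zero_set :: "'p set \<Rightarrow> ('p \<Rightarrow> complex) set \<Rightarrow> 'p set" where
  "zero_set X P = {x \<in> X. \<forall>p\<in>P. p x = 0}"

definition algebraic_subset :: "'p set \<Rightarrow> ('p \<Rightarrow> complex) set \<Rightarrow> 'p set \<Rightarrow> bool" where
  "algebraic_subset X \<Phi> Z \<longleftrightarrow> (\<exists>P \<subseteq> polyfuns UNIV \<Phi>. Z = zero_set X P)"

definition irreducible_subset :: "'p set \<Rightarrow> ('p \<Rightarrow> complex) set \<Rightarrow> 'p set \<Rightarrow> bool" where
  "irreducible_subset X \<Phi> Z \<longleftrightarrow>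
     algebraic_subset X \<Phi> Z \<and> Z \<noteq> {} \<and>
     (\<forall>A B. algebraic_subset X \<Phi> A \<and> algebraic_subset X \<Phi> B \<and> Z = A \<union> B \<longrightarrow> Z = A \<or> Z = B)"

definition irreducible_components :: "'p set \<Rightarrow> ('p \<Rightarrow> complex) set \<Rightarrow> 'p set set" where
  "irreducible_components X \<Phi> =
     {Z. irreducible_subset X \<Phi> Z \<and> (\<forall>Y. irreducible_subset X \<Phi> Y \<and> Z \<subseteq> Y \<longrightarrow> Y = Z)}"

text \<open>Irreducible algebraic subsets of Krull dimension one.\<close>

definition irreducible_curve :: "'p set \<Rightarrow> ('p \<Rightarrow> complex) set \<Rightarrow> 'p set \<Rightarrow> bool" where
  "irreducible_curve X \<Phi> C \<longleftrightarrow>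
     irreducible_subset X \<Phi> C \<and> (\<nexists>x. C = {x}) \<and>
     (\<forall>Y. irreducible_subset X \<Phi> Y \<and> Y \<subset> C \<longrightarrow> (\<exists>x. Y = {x}))"

text \<open>\<open>fraction \<Phi> Z f g\<close> is the rational function \<open>f / g\<close> on the irreducible algebraic set \<open>Z\<close>,
  as an equivalence class of pairs of regular functions.\<close>

definition fraction ::
  "('p \<Rightarrow> complex) set \<Rightarrow> 'p set \<Rightarrow> ('p \<Rightarrow> complex) \<Rightarrow> ('p \<Rightarrow> complex)
     \<Rightarrow> (('p \<Rightarrow> complex) \<times> ('p \<Rightarrow> complex)) set" where
  "fraction \<Phi> Z f g =
     {(f', g'). f' \<in> polyfuns UNIV \<Phi> \<and> g' \<in> polyfuns UNIV \<Phi> \<and> (\<exists>z\<in>Z. g' z \<noteq> 0) \<and>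
        (\<forall>z\<in>Z. f z * g' z = f' z * g z)}"

definition function_field ::
  "('p \<Rightarrow> complex) set \<Rightarrow> 'p set \<Rightarrow> (('p \<Rightarrow> complex) \<times> ('p \<Rightarrow> complex)) set ring" where
  "function_field \<Phi> Z =
     \<lparr>carrier = {fraction \<Phi> Z f g |f g.
        f \<in> polyfuns UNIV \<Phi> \<and> g \<in> polyfuns UNIV \<Phi> \<and> (\<exists>z\<in>Z. g z \<noteq> 0)},
      mult = (\<lambda>P Q. \<Union>(f, g)\<in>P. \<Union>(h, k)\<in>Q.
        fraction \<Phi> Z (\<lambda>z. f z * h z) (\<lambda>z. g z * k z)),
      one = fraction \<Phi> Z (\<lambda>_. 1) (\<lambda>_. 1),
      zero = fraction \<Phi> Z (\<lambda>_. 0) (\<lambda>_. 1),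
      add = (\<lambda>P Q. \<Union>(f, g)\<in>P. \<Union>(h, k)\<in>Q.
        fraction \<Phi> Z (\<lambda>z. f z * k z + h z * g z) (\<lambda>z. g z * k z))\<rparr>"

section \<open>Valuations and ideal points\<close>

definition nonzero :: "('f, 'm) ring_scheme \<Rightarrow> 'f set" where
  "nonzero K = carrier K - {\<zero>\<^bsub>K\<^esub>}"

text \<open>Normalised discrete valuations.  They are functions on the non-zero elements only;
  \<open>extensional\<close> makes them determined by their values there.\<close>

definition discrete_valuation :: "('f, 'm) ring_scheme \<Rightarrow> ('f \<Rightarrow> int) \<Rightarrow> bool" where
  "discrete_valuation K v \<longleftrightarrow>
     v \<in> extensional (nonzero K) \<and> v ` nonzero K = UNIV \<and>
     (\<forall>a\<in>nonzero K. \<forall>b\<in>nonzero K. v (a \<otimes>\<^bsub>K\<^esub> b) = v a + v b) \<and>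
     (\<forall>a\<in>nonzero K. \<forall>b\<in>nonzero K.
        a \<oplus>\<^bsub>K\<^esub> b \<noteq> \<zero>\<^bsub>K\<^esub> \<longrightarrow> min (v a) (v b) \<le> v (a \<oplus>\<^bsub>K\<^esub> b))"

definition regular_at :: "('f, 'm) ring_scheme \<Rightarrow> ('f \<Rightarrow> int) \<Rightarrow> 'f \<Rightarrow> bool" where
  "regular_at K v a \<longleftrightarrow> a = \<zero>\<^bsub>K\<^esub> \<or> 0 \<le> v a"

text \<open>The points of the smooth projective model of an irreducible curve are the normalised discrete
  valuations (orders of vanishing) of its function field that are trivial on the constants.
  The points of the normalisation are those at which every regular function on the curve is
  regular; since valuation rings are integrally closed, it makes no difference whether this is
  asked of the coordinate ring or of its integral closure.\<close>

definition smooth_model ::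
  "('p \<Rightarrow> complex) set \<Rightarrow> 'p set \<Rightarrow> ((('p \<Rightarrow> complex) \<times> ('p \<Rightarrow> complex)) set \<Rightarrow> int) set" where
  "smooth_model \<Phi> C =
     {v. discrete_valuation (function_field \<Phi> C) v \<and>
         (\<forall>c. c \<noteq> 0 \<longrightarrow> v (fraction \<Phi> C (\<lambda>_. c) (\<lambda>_. 1)) = 0)}"

definition ideal_points ::
  "('p \<Rightarrow> complex) set \<Rightarrow> 'p set \<Rightarrow> ((('p \<Rightarrow> complex) \<times> ('p \<Rightarrow> complex)) set \<Rightarrow> int) set" where
  "ideal_points \<Phi> C =
     smooth_model \<Phi> C -
     {v. \<forall>f\<in>polyfuns UNIV \<Phi>. regular_at (function_field \<Phi> C) v (fraction \<Phi> C f (\<lambda>_. 1))}"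

section \<open>The Bass--Serre tree of \<open>SL\<^sub>2\<close> over a discretely valued field\<close>

definition vscale :: "('f, 'm) ring_scheme \<Rightarrow> 'f \<Rightarrow> 'f \<times> 'f \<Rightarrow> 'f \<times> 'f" where
  "vscale K c x = (c \<otimes>\<^bsub>K\<^esub> fst x, c \<otimes>\<^bsub>K\<^esub> snd x)"

definition vadd :: "('f, 'm) ring_scheme \<Rightarrow> 'f \<times> 'f \<Rightarrow> 'f \<times> 'f \<Rightarrow> 'f \<times> 'f" where
  "vadd K x y = (fst x \<oplus>\<^bsub>K\<^esub> fst y, snd x \<oplus>\<^bsub>K\<^esub> snd y)"

definition matrix_apply ::
  "('f, 'm) ring_scheme \<Rightarrow> (2 \<Rightarrow> 2 \<Rightarrow> 'f) \<Rightarrow> 'f \<times> 'f \<Rightarrow> 'f \<times> 'f" where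
  "matrix_apply K A x =
     (A 1 1 \<otimes>\<^bsub>K\<^esub> fst x \<oplus>\<^bsub>K\<^esub> A 1 2 \<otimes>\<^bsub>K\<^esub> snd x, A 2 1 \<otimes>\<^bsub>K\<^esub> fst x \<oplus>\<^bsub>K\<^esub> A 2 2 \<otimes>\<^bsub>K\<^esub> snd x)"

definition valuation_ring :: "('f, 'm) ring_scheme \<Rightarrow> ('f \<Rightarrow> int) \<Rightarrow> 'f set" where
  "valuation_ring K v = {a \<in> carrier K. regular_at K v a}"

definition lattices :: "('f, 'm) ring_scheme \<Rightarrow> ('f \<Rightarrow> int) \<Rightarrow> ('f \<times> 'f) set set" where
  "lattices K v =
     {{vadd K (vscale K a x) (vscale K b y) |a b.
         a \<in> valuation_ring K v \<and> b \<in> valuation_ring K v} |x y.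
      x \<in> carrier K \<times> carrier K \<and> y \<in> carrier K \<times> carrier K \<and>
      fst x \<otimes>\<^bsub>K\<^esub> snd y \<noteq> snd x \<otimes>\<^bsub>K\<^esub> fst y}"

definition homothety_class :: "('f, 'm) ring_scheme \<Rightarrow> ('f \<times> 'f) set \<Rightarrow> ('f \<times> 'f) set set" where
  "homothety_class K L = {vscale K c ` L |c. c \<in> nonzero K}"

definition tree_vertices ::
  "('f, 'm) ring_scheme \<Rightarrow> ('f \<Rightarrow> int) \<Rightarrow> ('f \<times> 'f) set set set" where
  "tree_vertices K v = homothety_class K ` lattices K v"

definition tree_adjacent ::
  "('f, 'm) ring_scheme \<Rightarrow> ('f \<Rightarrow> int) \<Rightarrow> ('f \<times> 'f) set set \<Rightarrow> ('f \<times> 'f) set set \<Rightarrow> bool" where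
  "tree_adjacent K v \<Lambda> \<Lambda>' \<longleftrightarrow>
     \<Lambda> \<in> tree_vertices K v \<and> \<Lambda>' \<in> tree_vertices K v \<and>
     (\<exists>L\<in>\<Lambda>. \<exists>L'\<in>\<Lambda>'. \<exists>c\<in>nonzero K. v c = 1 \<and> vscale K c ` L \<subset> L' \<and> L' \<subset> L)"

definition tree_action ::
  "('f, 'm) ring_scheme \<Rightarrow> (2 \<Rightarrow> 2 \<Rightarrow> 'f) \<Rightarrow> ('f \<times> 'f) set set \<Rightarrow> ('f \<times> 'f) set set" where
  "tree_action K A \<Lambda> = (\<lambda>L. matrix_apply K A ` L) ` \<Lambda>"

section \<open>Surfaces dual to an action on a tree\<close>

text \<open>The geometric realisation of a graph without isolated vertices, in barycentric coordinates.
  The topology of pointwise convergence of these coordinates is the usual metric topology, in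
  which every edge is an interval of length one.\<close>

definition realization :: "('v \<Rightarrow> 'v \<Rightarrow> bool) \<Rightarrow> ('v \<Rightarrow> real) topology" where
  "realization E = subtopology (powertop_real UNIV)
     {b. \<exists>u w. E u w \<and> (\<forall>x. x \<noteq> u \<and> x \<noteq> w \<longrightarrow> b x = 0) \<and> 0 \<le> b u \<and> 0 \<le> b w \<and> b u + b w = 1}"

text \<open>\<open>S\<close> is dual to the action \<open>act\<close> of \<open>\<pi>\<^sub>1(N)\<close> on the tree with vertex set \<open>V\<close> and adjacency
  relation \<open>E\<close> if its preimage in the universal cover is the preimage of the set of midpoints of
  edges under an equivariant map to the tree that is transverse to the midpoints.  Transversality
  at \<open>x\<close> means that near \<open>x\<close> the cover is a product \<open>(U \<inter> \<S>) \<times> (-\<epsilon>, \<epsilon>)\<close> on which the map is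
  the projection to the second factor followed by the inclusion of a neighbourhood of the midpoint
  into an edge \<open>{u, w}\<close>.\<close>

definition dual_surface ::
  "'a::topological_space set \<Rightarrow> 'a \<Rightarrow> 'v set \<Rightarrow> ('v \<Rightarrow> 'v \<Rightarrow> bool)
     \<Rightarrow> ((real \<Rightarrow> 'a) set \<Rightarrow> 'v \<Rightarrow> 'v) \<Rightarrow> 'a set \<Rightarrow> bool" where
  "dual_surface N x0 V E act S \<longleftrightarrow>
     (let T = universal_cover_topology N x0; \<S> = {x \<in> universal_cover N x0. cover_projection x \<in> S} in
      \<exists>f. continuous_map T (realization E) f \<and>
        (\<forall>\<gamma>\<in>carrier (fundamental_group N x0). \<forall>x\<in>universal_cover N x0. \<forall>u\<in>V.
           f (class_join N \<gamma> x) (act \<gamma> u) = f x u) \<and>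
        \<S> = {x \<in> universal_cover N x0. \<exists>u. f x u = 1/2} \<and>
        (\<forall>x\<in>\<S>. \<exists>U \<epsilon> h u w. openin T U \<and> x \<in> U \<and> 0 < \<epsilon> \<and> E u w \<and>
           homeomorphic_map (prod_topology (subtopology T (U \<inter> \<S>)) (top_of_set {-\<epsilon><..<\<epsilon>}))
             (subtopology T U) h \<and>
           (\<forall>y\<in>U \<inter> \<S>. h (y, 0) = y \<and>
              (\<forall>t\<in>{-\<epsilon><..<\<epsilon>}. f (h (y, t)) u = 1/2 + t \<and> f (h (y, t)) w = 1/2 - t))))"

section \<open>Representations and characters\<close>

definition SL2C :: "(complex ^ 2 ^ 2) monoid" where
  "SL2C = \<lparr>carrier = {A. det A = 1}, mult = (**), one = mat 1\<rparr>"

definition rep_variety ::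
  "'a::topological_space set \<Rightarrow> 'a \<Rightarrow> ((real \<Rightarrow> 'a) set \<Rightarrow> complex ^ 2 ^ 2) set" where
  "rep_variety N x0 =
     hom (fundamental_group N x0) SL2C \<inter> extensional (carrier (fundamental_group N x0))"

definition rep_coords ::
  "'a::topological_space set \<Rightarrow> 'a \<Rightarrow> (((real \<Rightarrow> 'a) set \<Rightarrow> complex ^ 2 ^ 2) \<Rightarrow> complex) set" where
  "rep_coords N x0 = {\<lambda>\<rho>. \<rho> \<gamma> $ i $ j |\<gamma> i j. \<gamma> \<in> carrier (fundamental_group N x0)}"

definition character ::
  "'a::topological_space set \<Rightarrow> 'a \<Rightarrow> ((real \<Rightarrow> 'a) set \<Rightarrow> complex ^ 2 ^ 2)
     \<Rightarrow> (real \<Rightarrow> 'a) set \<Rightarrow> complex" where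
  "character N x0 \<rho> = (\<lambda>\<gamma>\<in>carrier (fundamental_group N x0). trace (\<rho> \<gamma>))"

definition char_variety ::
  "'a::topological_space set \<Rightarrow> 'a \<Rightarrow> ((real \<Rightarrow> 'a) set \<Rightarrow> complex) set" where
  "char_variety N x0 = character N x0 ` rep_variety N x0"

definition trace_function :: "'g \<Rightarrow> ('g \<Rightarrow> complex) \<Rightarrow> complex" where
  "trace_function \<gamma> = (\<lambda>x. x \<gamma>)"

text \<open>The functions \<open>I\<^sub>\<gamma>\<close> for all \<open>\<gamma>\<close>.  For a generating tuple, they generate the same algebra as the
  finitely many functions \<open>trace_coords\<close> below.\<close>

definition char_coords ::
  "'a::topological_space set \<Rightarrow> 'a \<Rightarrow> (((real \<Rightarrow> 'a) set \<Rightarrow> complex) \<Rightarrow> complex) set" where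
  "char_coords N x0 = trace_function ` carrier (fundamental_group N x0)"

text \<open>Coordinates of the embedding \<open>\<chi> \<mapsto> (\<chi> (\<gamma>\<^bsub>j1\<^esub> \<dots> \<gamma>\<^bsub>jk\<^esub>))\<close>, \<open>j1 < \<dots> < jk\<close>, into
  \<open>\<complex>\<close>-space of dimension \<open>2\<^sup>n - 1\<close>; the coordinates are indexed by the non-empty sets
  \<open>J = {j1, \<dots>, jk}\<close> of positions in the list of generators.\<close>

definition coord_indices :: "nat \<Rightarrow> nat set set" where
  "coord_indices n = {J. J \<subseteq> {..<n} \<and> J \<noteq> {}}"

definition trace_coords ::
  "'g monoid \<Rightarrow> 'g list \<Rightarrow> ('g \<Rightarrow> complex) \<Rightarrow> nat set \<Rightarrow> complex" where
  "trace_coords G gs x =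
     (\<lambda>J\<in>coord_indices (length gs).
        x (foldr (mult G) (map ((!) gs) (sorted_list_of_set J)) (one G)))"

definition defined_over_Q ::
  "'a::topological_space set \<Rightarrow> 'a \<Rightarrow> ((real \<Rightarrow> 'a) set \<Rightarrow> complex) set \<Rightarrow> bool" where
  "defined_over_Q N x0 Z \<longleftrightarrow>
     (\<forall>gs. set gs \<subseteq> carrier (fundamental_group N x0) \<and>
        generate (fundamental_group N x0) (set gs) = carrier (fundamental_group N x0) \<longrightarrow>
        (\<exists>P \<subseteq> polyfuns \<rat> {\<lambda>z. z J |J. J \<in> coord_indices (length gs)}.
           trace_coords (fundamental_group N x0) gs ` Z =
             zero_set (coord_indices (length gs) \<rightarrow>\<^sub>E UNIV) P))"

section \<open>Detection\<close>

definition tautological_rep ::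
  "'a::topological_space set \<Rightarrow> 'a \<Rightarrow> ((real \<Rightarrow> 'a) set \<Rightarrow> complex ^ 2 ^ 2) set
     \<Rightarrow> (real \<Rightarrow> 'a) set \<Rightarrow> 2 \<Rightarrow> 2 \<Rightarrow>
     ((((real \<Rightarrow> 'a) set \<Rightarrow> complex ^ 2 ^ 2) \<Rightarrow> complex)
      \<times> (((real \<Rightarrow> 'a) set \<Rightarrow> complex ^ 2 ^ 2) \<Rightarrow> complex)) set" where
  "tautological_rep N x0 D \<gamma> i j = fraction (rep_coords N x0) D (\<lambda>\<rho>. \<rho> \<gamma> $ i $ j) (\<lambda>_. 1)"

definition maps_dominantly ::
  "'a::topological_space set \<Rightarrow> 'a \<Rightarrow> ((real \<Rightarrow> 'a) set \<Rightarrow> complex ^ 2 ^ 2) set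
     \<Rightarrow> ((real \<Rightarrow> 'a) set \<Rightarrow> complex) set \<Rightarrow> bool" where
  "maps_dominantly N x0 D C \<longleftrightarrow>
     character N x0 ` D \<subseteq> C \<and>
     (\<forall>Y. algebraic_subset (char_variety N x0) (char_coords N x0) Y \<and> character N x0 ` D \<subseteq> Y
        \<longrightarrow> C \<subseteq> Y)"

text \<open>\<open>w\<close> extends \<open>v\<close> along the inclusion of function fields given by a dominant map \<open>D \<rightarrow> C\<close>.  As
  both are normalised, this involves a ramification index \<open>e\<close>.\<close>

definition extends_valuation where
  "extends_valuation N x0 C v D w \<longleftrightarrow>
     (\<exists>e > 0. \<forall>f\<in>polyfuns UNIV (char_coords N x0). \<forall>g\<in>polyfuns UNIV (char_coords N x0).
        (\<exists>z\<in>C. f z \<noteq> 0) \<and> (\<exists>z\<in>C. g z \<noteq> 0) \<longrightarrow>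
        w (fraction (rep_coords N x0) D (f \<circ> character N x0) (g \<circ> character N x0)) =
          (e::int) * v (fraction (char_coords N x0) C f g))"

definition associated_surface where
  "associated_surface N x0 C v S \<longleftrightarrow>
     essential_surface N S \<and>
     (\<exists>D w. irreducible_curve (rep_variety N x0) (rep_coords N x0) D \<and>
        maps_dominantly N x0 D C \<and>
        w \<in> smooth_model (rep_coords N x0) D \<and> extends_valuation N x0 C v D w \<and>
        (let F = function_field (rep_coords N x0) D in
         dual_surface N x0 (tree_vertices F w) (tree_adjacent F w)
           (\<lambda>\<gamma>. tree_action F (tautological_rep N x0 D \<gamma>)) S))"

definition detects_closed_surface ::
  "'a::topological_space set \<Rightarrow> 'a \<Rightarrow> ((real \<Rightarrow> 'a) set \<Rightarrow> complex) set \<Rightarrow> bool" where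
  "detects_closed_surface N x0 Z \<longleftrightarrow>
     (\<exists>C v. irreducible_curve (char_variety N x0) (char_coords N x0) C \<and> C \<subseteq> Z \<and>
        v \<in> ideal_points (char_coords N x0) C \<and>
        (\<forall>\<gamma>\<in>peripheral N x0. regular_at (function_field (char_coords N x0) C) v
           (fraction (char_coords N x0) C (trace_function \<gamma>) (\<lambda>_. 1))))"

definition detects_slope ::
  "'a::topological_space set \<Rightarrow> 'a \<Rightarrow> ((real \<Rightarrow> 'a) set \<Rightarrow> complex) set \<Rightarrow> 'a set set \<Rightarrow> bool" where
  "detects_slope N x0 Z \<alpha> \<longleftrightarrow>
     (\<exists>C v S. irreducible_curve (char_variety N x0) (char_coords N x0) C \<and> C \<subseteq> Z \<and>
        v \<in> ideal_points (char_coords N x0) C \<and>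
        associated_surface N x0 C v S \<and> S \<inter> bdry N \<noteq> {} \<and> components (S \<inter> bdry N) \<subseteq> \<alpha>)"

definition same_detection_union ::
  "'a::topological_space set \<Rightarrow> 'a \<Rightarrow> ((real \<Rightarrow> 'a) set \<Rightarrow> complex) set
     \<Rightarrow> ((real \<Rightarrow> 'a) set \<Rightarrow> complex) set" where
  "same_detection_union N x0 X =
     \<Union> {X' \<in> irreducible_components (char_variety N x0) (char_coords N x0).
          (detects_closed_surface N x0 X' \<longleftrightarrow> detects_closed_surface N x0 X) \<and>
          (\<forall>\<alpha>\<in>slopes N. detects_slope N x0 X' \<alpha> \<longleftrightarrow> detects_slope N x0 X \<alpha>)}"

end

theory Submission
  imports Defs "HOL-Computational_Algebra.Fundamental_Theorem_Algebra"
begin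

text \<open>
  A field automorphism \<open>\<sigma>\<close> of \<open>\<complex>\<close> acts on characters by \<open>\<chi> \<mapsto> \<sigma> \<circ> \<chi>\<close>. It permutes the
  irreducible components of \<open>X(N)\<close>, the curves in them and their ideal points, and it carries the
  action on a Bass--Serre tree to an isomorphic one, so that the dual surfaces are literally the
  same. Hence \<open>X\<degree>\<close> is invariant under all \<open>\<sigma>\<close>. As only rational numbers are fixed by all
  automorphisms of \<open>\<complex>\<close>, an invariant algebraic set is cut out by rational polynomials. This is
  applied in the trace coordinates, in which \<open>X\<degree>\<close> is closed for two reasons: there are only finitely
  many components (Hilbert's basis theorem), and every function on the group that satisfies the
  polynomial identities valid for all characters is itself a character.
\<close>

text \<open>An automorphism \<sigma> is in general wildly discontinuous. This does no harm: it acts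
  on scalars only, while \<open>N\<close>, its universal cover, slopes, peripheral elements and
  candidate surfaces involve no complex numbers. What detection takes from \<complex> are function
  fields, discrete valuations and lattices, all built from the field operations. Invariance is
  therefore a parametricity statement, proved by transfer along the graph of \<sigma>.

  The obstacle is closedness. Algebraic subsets of \<open>char_variety\<close> are zero sets
  relative to the set of actual characters, whereas \<open>defined_over_Q\<close> asks for a zero
  set in the whole coordinate space, and no equations for the set of characters are given. They come
  from rebuilding a representation: in an eigenbasis of some \<rho> g with distinct eigenvalues, the
  diagonal entries and the products of an upper and a lower off-diagonal entry are functions of the
  traces and one eigenvalue, and these products suffice. Functions all of whose values are 2 or -2
  offer no such g and are treated apart.\<close>

hide_const (open) up_ring.coeff up_ring.monom UnivPoly.deg

section \<open>Automorphisms of the complex field\<close>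

text \<open>A partial isomorphism is represented by its graph, a subring of \<open>\<complex> \<times> \<complex>\<close>.\<close>

definition partial_iso :: "(complex \<times> complex) set \<Rightarrow> bool" where
  "partial_iso R \<longleftrightarrow> (1, 1) \<in> R \<and>
     (\<forall>a b c d. (a, b) \<in> R \<and> (c, d) \<in> R \<longrightarrow> (a - c, b - d) \<in> R \<and> (a * c, b * d) \<in> R) \<and>
     (\<forall>a b. (a, b) \<in> R \<longrightarrow> (a = 0 \<longleftrightarrow> b = 0))"

text \<open>The coefficientwise correspondence of polynomials. Keeping pairs avoids naming the
  function whose graph \<open>R\<close> is.\<close>

definition lift_poly :: "(complex \<times> complex) set \<Rightarrow> (complex poly \<times> complex poly) set" where
  "lift_poly R = {(p, q). \<forall>i. (coeff p i, coeff q i) \<in> R}"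

definition adjoin :: "(complex \<times> complex) set \<Rightarrow> complex \<Rightarrow> complex \<Rightarrow> (complex \<times> complex) set" where
  "adjoin R w w' = {(poly p w, poly q w') |p q. (p, q) \<in> lift_poly R}"

definition fractions :: "(complex \<times> complex) set \<Rightarrow> (complex \<times> complex) set" where
  "fractions R = {(a / c, b / d) |a b c d. (a, b) \<in> R \<and> (c, d) \<in> R \<and> c \<noteq> 0}"

text \<open>Closure under quotients is included: b x - a is a polynomial over \<open>S\<close>, so a
  / b is one of the roots that \<open>S\<close> contains.\<close>

definition alg_closed_subring :: "complex set \<Rightarrow> bool" where
  "alg_closed_subring S \<longleftrightarrow> 1 \<in> S \<and> (\<forall>a\<in>S. \<forall>b\<in>S. a - b \<in> S \<and> a * b \<in> S) \<and>
     (\<forall>p w. p \<noteq> 0 \<and> (\<forall>i. coeff p i \<in> S) \<and> poly p w = 0 \<longrightarrow> w \<in> S)"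

text \<open>An intersection instead of the set of algebraic elements: two closures are then compared
  through their generators, and no degrees of field extensions enter.\<close>

definition alg_closure_in :: "complex set \<Rightarrow> complex set" where
  "alg_closure_in A = \<Inter> {S. A \<subseteq> S \<and> alg_closed_subring S}"

definition field_aut :: "(complex \<Rightarrow> complex) \<Rightarrow> bool" where
  "field_aut \<sigma> \<longleftrightarrow> bij \<sigma> \<and> (\<forall>a b. \<sigma> (a + b) = \<sigma> a + \<sigma> b) \<and> (\<forall>a b. \<sigma> (a * b) = \<sigma> a * \<sigma> b)"

section \<open>Extending a partial isomorphism by one element and by fractions\<close>

context
  fixes R assumes R: "partial_iso R"
begin

lemma piso_one: "(1, 1) \<in> R" using R by (simp add: partial_iso_def)
lemma piso_diff: "(a, b) \<in> R \<Longrightarrow> (c, d) \<in> R \<Longrightarrow> (a - c, b - d) \<in> R"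
  using R by (simp add: partial_iso_def)
lemma piso_mult: "(a, b) \<in> R \<Longrightarrow> (c, d) \<in> R \<Longrightarrow> (a * c, b * d) \<in> R"
  using R by (simp add: partial_iso_def)
lemma piso_zero_iff: "(a, b) \<in> R \<Longrightarrow> a = 0 \<longleftrightarrow> b = 0"
  using R by (simp add: partial_iso_def)
lemma piso_zero: "(0, 0) \<in> R" using piso_diff[OF piso_one piso_one] by simp
lemma piso_add: "(a, b) \<in> R \<Longrightarrow> (c, d) \<in> R \<Longrightarrow> (a + c, b + d) \<in> R"
  using piso_diff[of a b "- c" "- d"] piso_diff[OF piso_zero, of c d] by simp
lemma piso_sum: "(\<And>i. i \<in> I \<Longrightarrow> (f i, g i) \<in> R) \<Longrightarrow> (sum f I, sum g I) \<in> R"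
  by (induction I rule: infinite_finite_induct) (auto simp: piso_zero piso_add)
lemma piso_unique: "(a, b) \<in> R \<Longrightarrow> (a, b') \<in> R \<Longrightarrow> b = b'"
  using piso_diff[of a b a b'] piso_zero_iff[of "a - a" "b - b'"] by auto
lemma piso_unique': "(a, b) \<in> R \<Longrightarrow> (a', b) \<in> R \<Longrightarrow> a = a'"
  using piso_diff[of a b a' b] piso_zero_iff[of "a - a'" "b - b"] by auto

lemma lift_diff: "(p, q) \<in> lift_poly R \<Longrightarrow> (p', q') \<in> lift_poly R \<Longrightarrow> (p - p', q - q') \<in> lift_poly R"
  by (auto simp: lift_poly_def piso_diff)
lemma lift_add: "(p, q) \<in> lift_poly R \<Longrightarrow> (p', q') \<in> lift_poly R \<Longrightarrow> (p + p', q + q') \<in> lift_poly R"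
  by (auto simp: lift_poly_def piso_add)
lemma lift_mult: "(p, q) \<in> lift_poly R \<Longrightarrow> (p', q') \<in> lift_poly R \<Longrightarrow> (p * p', q * q') \<in> lift_poly R"
  by (auto simp: lift_poly_def coeff_mult intro!: piso_sum piso_mult)
lemma lift_monom: "(a, b) \<in> R \<Longrightarrow> (monom a n, monom b n) \<in> lift_poly R"
  by (auto simp: lift_poly_def piso_zero)
lemma lift_zero: "(0, 0) \<in> lift_poly R" by (auto simp: lift_poly_def piso_zero)
lemma lift_zero_iff: "(p, q) \<in> lift_poly R \<Longrightarrow> p = 0 \<longleftrightarrow> q = 0"
  using piso_zero_iff unfolding lift_poly_def poly_eq_iff by fastforce
lemma lift_degree: assumes "(p, q) \<in> lift_poly R" shows "degree p = degree q"
proof -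
  have "coeff p i = 0 \<longleftrightarrow> coeff q i = 0" for i
    using assms piso_zero_iff by (auto simp: lift_poly_def)
  then show ?thesis by (simp add: Polynomial.degree_def)
qed

text \<open>The hypothesis says that evaluation at \<open>w\<close> and at \<open>w'\<close> have
  corresponding kernels, so that \<open>poly p w\<close> can be paired with
  \<open>poly q w'\<close>. It covers conjugate algebraic elements as well as a pair of
  transcendental ones.\<close>

lemma partial_iso_adjoin:
  assumes w: "\<And>p q. (p, q) \<in> lift_poly R \<Longrightarrow> poly p w = 0 \<longleftrightarrow> poly q w' = 0"
  shows "partial_iso (adjoin R w w')" "R \<subseteq> adjoin R w w'" "(w, w') \<in> adjoin R w w'"
proof -
  have m: "(poly p w, poly q w') \<in> adjoin R w w'" if "(p, q) \<in> lift_poly R" for p q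
    using that by (auto simp: adjoin_def)
  show sub: "R \<subseteq> adjoin R w w'"
  proof clarify
    fix a b assume "(a, b) \<in> R"
    from m[OF lift_monom[OF this, of 0]] show "(a, b) \<in> adjoin R w w'" by (simp add: poly_monom)
  qed
  show "(w, w') \<in> adjoin R w w'" using m[OF lift_monom[OF piso_one, of 1]] by (simp add: poly_monom)
  show "partial_iso (adjoin R w w')"
    unfolding partial_iso_def
  proof (intro conjI allI impI)
    show "(1, 1) \<in> adjoin R w w'" using sub piso_one by auto
  next
    fix a b c d assume *: "(a, b) \<in> adjoin R w w' \<and> (c, d) \<in> adjoin R w w'"
    then obtain p q p' q' where
      "(p, q) \<in> lift_poly R" "(p', q') \<in> lift_poly R" "a = poly p w" "b = poly q w'"
      "c = poly p' w" "d = poly q' w'" by (auto simp: adjoin_def)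
    then show "(a - c, b - d) \<in> adjoin R w w'" "(a * c, b * d) \<in> adjoin R w w'"
      using m[OF lift_diff, of p q p' q'] m[OF lift_mult, of p q p' q'] by auto
  qed (use w in \<open>auto simp: adjoin_def\<close>)
qed

lemma partial_iso_fractions:
  shows "partial_iso (fractions R)" "R \<subseteq> fractions R"
    "(a, b) \<in> fractions R \<Longrightarrow> a \<noteq> 0 \<Longrightarrow> (1 / a, 1 / b) \<in> fractions R"
proof -
  have m: "(a / c, b / d) \<in> fractions R" if "(a, b) \<in> R" "(c, d) \<in> R" "c \<noteq> 0" for a b c d
    using that by (auto simp: fractions_def)
  show "R \<subseteq> fractions R" using m[OF _ piso_one] by auto
  show "partial_iso (fractions R)"
    unfolding partial_iso_def
  proof (intro conjI allI impI)
    show "(1, 1) \<in> fractions R" using m[OF piso_one piso_one] by auto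
  next
    fix a b c d assume *: "(a, b) \<in> fractions R \<and> (c, d) \<in> fractions R"
    then obtain a1 a2 b1 b2 c1 c2 d1 d2 where e:
      "(a1, b1) \<in> R" "(a2, b2) \<in> R" "(c1, d1) \<in> R" "(c2, d2) \<in> R" "a2 \<noteq> 0" "c2 \<noteq> 0"
      "a = a1 / a2" "b = b1 / b2" "c = c1 / c2" "d = d1 / d2" by (auto simp: fractions_def)
    then have nz: "b2 \<noteq> 0" "d2 \<noteq> 0" using piso_zero_iff by auto
    show "(a - c, b - d) \<in> fractions R"
      using m[OF piso_diff[OF piso_mult[OF e(1,4)] piso_mult[OF e(3,2)]] piso_mult[OF e(2,4)]] nz e
      by (simp add: diff_frac_eq)
    show "(a * c, b * d) \<in> fractions R"
      using m[OF piso_mult[OF e(1,3)] piso_mult[OF e(2,4)]] nz e by simp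
  next
    fix a b assume "(a, b) \<in> fractions R"
    then obtain a1 a2 b1 b2 where e:
      "(a1, b1) \<in> R" "(a2, b2) \<in> R" "a2 \<noteq> 0" "a = a1 / a2" "b = b1 / b2"
      by (auto simp: fractions_def)
    then show "(a = 0) = (b = 0)" using piso_zero_iff[OF e(1)] piso_zero_iff[OF e(2)] by auto
  qed
  show "(1 / a, 1 / b) \<in> fractions R" if *: "(a, b) \<in> fractions R" and "a \<noteq> 0"
  proof -
    from * obtain a1 a2 b1 b2 where e:
      "(a1, b1) \<in> R" "(a2, b2) \<in> R" "a2 \<noteq> 0" "a = a1 / a2" "b = b1 / b2"
      by (auto simp: fractions_def)
    with \<open>a \<noteq> 0\<close> show ?thesis using m[OF e(2,1)] by auto
  qed
qed

context
  assumes inv: "\<And>a b. (a, b) \<in> R \<Longrightarrow> a \<noteq> 0 \<Longrightarrow> (1 / a, 1 / b) \<in> R"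
begin

text \<open>Division with remainder in both components in parallel: corresponding polynomials have
  equal degrees, and the assumption on inverses makes the quotients of their leading coefficients
  correspond again.\<close>

lemma lift_divide:
  assumes "(p, q) \<in> lift_poly R" "(p1, q1) \<in> lift_poly R" "p1 \<noteq> 0"
  obtains s s' r r' where "(s, s') \<in> lift_poly R" "(r, r') \<in> lift_poly R"
    "p = p1 * s + r" "q = q1 * s' + r'" "r = 0 \<or> degree r < degree p1"
proof -
  have "\<exists>s s' r r'. (s, s') \<in> lift_poly R \<and> (r, r') \<in> lift_poly R \<and>
    p = p1 * s + r \<and> q = q1 * s' + r' \<and> (r = 0 \<or> degree r < degree p1)"
    using assms(1)
  proof (induction "degree p" arbitrary: p q rule: less_induct)
    case less
    show ?case
    proof (cases "p = 0 \<or> degree p < degree p1")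
      case True
      with less.prems lift_zero show ?thesis by (intro exI[of _ 0] exI[of _ p] exI[of _ q]) auto
    next
      case False
      then have p: "p \<noteq> 0" "degree p1 \<le> degree p" by auto
      define k where "k = degree p - degree p1"
      define c where "c = lead_coeff p / lead_coeff p1"
      define d where "d = lead_coeff q / lead_coeff q1"
      have dg: "degree q = degree p" "degree q1 = degree p1"
        using lift_degree less.prems assms(2) by auto
      have q1: "q1 \<noteq> 0" "q \<noteq> 0" using lift_zero_iff assms(2,3) p less.prems by auto
      have "(lead_coeff p, lead_coeff q) \<in> R" "(lead_coeff p1, lead_coeff q1) \<in> R"
        using less.prems assms(2) dg by (auto simp: lift_poly_def)
      then have cd: "(c, d) \<in> R" using piso_mult[OF _ inv] assms(3) by (fastforce simp: c_def d_def)
      have c0: "c \<noteq> 0" "d \<noteq> 0" using p assms(3) q1 by (auto simp: c_def d_def)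
      let ?p = "p - p1 * monom c k" let ?q = "q - q1 * monom d k"
      have l: "(?p, ?q) \<in> lift_poly R"
        by (intro lift_diff lift_mult lift_monom less.prems assms cd)
      have deg: "?p = 0 \<or> degree ?p < degree p"
      proof (cases "?p = 0")
        case False
        have "degree (p1 * monom c k) = degree p"
          using assms(3) c0 p by (simp add: degree_mult_eq degree_monom_eq k_def)
        moreover have "coeff (p1 * monom c k) (degree p) = lead_coeff p"
          using p assms(3) coeff_mult_degree_sum[of p1 "monom c k"] c0
          by (simp add: degree_monom_eq k_def c_def)
        ultimately have "degree ?p \<le> degree p" "coeff ?p (degree p) = 0"
          by (auto intro: order.trans[OF degree_diff_le_max])
        then show ?thesis using False by (metis le_neq_implies_less leading_coeff_0_iff)
      qed auto
      have "\<exists>s s' r r'. (s, s') \<in> lift_poly R \<and> (r, r') \<in> lift_poly R \<and>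
        ?p = p1 * s + r \<and> ?q = q1 * s' + r' \<and> (r = 0 \<or> degree r < degree p1)"
      proof (cases "?p = 0")
        case True
        then have "?q = 0" using lift_zero_iff[OF l] by auto
        then show ?thesis using True lift_zero by (intro exI[of _ 0]) auto
      next
        case False
        then show ?thesis using deg less.hyps[OF _ l] by auto
      qed
      then obtain s s' r r' where h: "(s, s') \<in> lift_poly R" "(r, r') \<in> lift_poly R"
        "?p = p1 * s + r" "?q = q1 * s' + r'" "r = 0 \<or> degree r < degree p1" by blast
      have "p = p1 * (s + monom c k) + r" "q = q1 * (s' + monom d k) + r'"
        using h(3,4) by (auto simp: algebra_simps)
      with h(1,2,5) cd show ?thesis using lift_add[OF h(1) lift_monom[OF cd]] by blast
    qed
  qed
  then show thesis using that by blast
qed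

text \<open>Minimality of \<open>p\<close> gives the forward direction by division. For the
  converse, a pair \<open>(p2, q2)\<close> of least degree at \<open>w'\<close> is used:
  \<open>q2\<close> divides \<open>q\<close>, and \<open>p2\<close> divides \<open>p\<close>
  accordingly. If \<open>p2\<close> did not vanish at \<open>w\<close>, the cofactor would, and
  minimality of \<open>p\<close> would make \<open>p2\<close> constant. This replaces an argument
  with irreducible polynomials.\<close>

lemma conjugate_root:
  assumes p: "(p, q) \<in> lift_poly R" "p \<noteq> 0" "poly p w = 0" "poly q w' = 0"
    and min: "\<And>f g. (f, g) \<in> lift_poly R \<Longrightarrow> f \<noteq> 0 \<Longrightarrow> poly f w = 0 \<Longrightarrow> degree p \<le> degree f"
    and fg: "(f, g) \<in> lift_poly R"
  shows "poly f w = 0 \<longleftrightarrow> poly g w' = 0"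
proof
  assume f: "poly f w = 0"
  obtain s s' r r' where h: "(s, s') \<in> lift_poly R" "(r, r') \<in> lift_poly R"
    "f = p * s + r" "g = q * s' + r'" "r = 0 \<or> degree r < degree p"
    using lift_divide[OF fg p(1,2)] by metis
  have "poly r w = 0" using f h(3) p(3) by simp
  then have "r = 0" using min[OF h(2)] h(5) by force
  then have "r' = 0" using lift_zero_iff[OF h(2)] by simp
  then show "poly g w' = 0" using h(4) p(4) by simp
next
  assume g: "poly g w' = 0"
  let ?P = "\<lambda>n. \<exists>p2 q2. (p2, q2) \<in> lift_poly R \<and> q2 \<noteq> 0 \<and> poly q2 w' = 0 \<and> degree q2 = n"
  have "?P (degree q)" using p lift_zero_iff by blast
  then have "?P (LEAST n. ?P n)" by (rule LeastI)
  then obtain n p2 q2 where n: "n = (LEAST n. ?P n)"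
    and p2: "(p2, q2) \<in> lift_poly R" "q2 \<noteq> 0" "poly q2 w' = 0" "degree q2 = n" by blast
  have nmin: "\<not> ?P m" if "m < n" for m using not_less_Least[of m ?P] that n by blast
  have p20: "p2 \<noteq> 0" using lift_zero_iff p2 by auto
  have div: "\<exists>s s'. (s, s') \<in> lift_poly R \<and> a = p2 * s" if ab: "(a, b) \<in> lift_poly R" "poly b w' = 0" for a b
  proof -
    obtain s s' r r' where h: "(s, s') \<in> lift_poly R" "(r, r') \<in> lift_poly R"
      "a = p2 * s + r" "b = q2 * s' + r'" "r = 0 \<or> degree r < degree p2"
      using lift_divide[OF ab(1) p2(1) p20] by metis
    have "poly r' w' = 0" using ab h(4) p2 by simp
    then have "r' = 0" using nmin[of "degree r'"] h(2,5) p2 lift_degree[OF h(2)] lift_degree[OF p2(1)]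
      lift_zero_iff[OF h(2)] by auto
    then have "r = 0" using lift_zero_iff[OF h(2)] by simp
    then show ?thesis using h by auto
  qed
  obtain s s' where s: "(s, s') \<in> lift_poly R" "p = p2 * s" using div[OF p(1,4)] by blast
  have "poly p2 w = 0"
  proof (rule ccontr)
    assume "poly p2 w \<noteq> 0"
    then have "poly s w = 0" "s \<noteq> 0" using p s by auto
    then have "degree p \<le> degree s" using min s by blast
    then have "degree p2 = 0" using s(2) p20 \<open>s \<noteq> 0\<close> by (simp add: degree_mult_eq)
    then have "degree q2 = 0" using lift_degree p2 by simp
    then obtain c where "q2 = [:c:]" by (meson degree_eq_zeroE)
    then show False using p2 by simp
  qed
  then show "poly f w = 0" using div[OF fg g] by auto
qed

lemma minimal_annihilator:
  assumes "(p, q) \<in> lift_poly R" "p \<noteq> 0" "poly p w = 0"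
  obtains p q where "(p, q) \<in> lift_poly R" "p \<noteq> 0" "poly p w = 0"
    "\<And>f g. (f, g) \<in> lift_poly R \<Longrightarrow> f \<noteq> 0 \<Longrightarrow> poly f w = 0 \<Longrightarrow> degree p \<le> degree f"
proof -
  let ?P = "\<lambda>n. \<exists>p q. (p, q) \<in> lift_poly R \<and> p \<noteq> 0 \<and> poly p w = 0 \<and> degree p = n"
  have "?P (degree p)" using assms by blast
  then have "?P (LEAST n. ?P n)" by (rule LeastI)
  then obtain p q where pq: "(p, q) \<in> lift_poly R" "p \<noteq> 0" "poly p w = 0" "degree p = (LEAST n. ?P n)"
    by blast
  have "degree p \<le> degree f" if "(f, g) \<in> lift_poly R" "f \<noteq> 0" "poly f w = 0" for f g
    unfolding pq(4) by (rule Least_le) (use that in blast)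
  with pq(1-3) show thesis by (rule that)
qed

text \<open>Any root of the polynomial corresponding to a minimal annihilator of \<open>w\<close>
  serves; its degree is positive, so \<complex> contains one.\<close>

lemma algebraic_extension:
  assumes p: "(p, q) \<in> lift_poly R" "p \<noteq> 0" "poly p w = 0"
  obtains w' where "\<And>f g. (f, g) \<in> lift_poly R \<Longrightarrow> poly f w = 0 \<longleftrightarrow> poly g w' = 0"
proof -
  obtain p q where p: "(p, q) \<in> lift_poly R" "p \<noteq> 0" "poly p w = 0"
    and min: "\<And>f g. (f, g) \<in> lift_poly R \<Longrightarrow> f \<noteq> 0 \<Longrightarrow> poly f w = 0 \<Longrightarrow> degree p \<le> degree f"
    using minimal_annihilator[OF p] by blast
  have "degree p \<noteq> 0"
  proof
    assume "degree p = 0"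
    then obtain c where "p = [:c:]" by (meson degree_eq_zeroE)
    then show False using p by simp
  qed
  then have "\<not> constant (poly q)" using lift_degree[OF p(1)] constant_degree[of q] by simp
  then obtain w' where "poly q w' = 0" using fundamental_theorem_of_algebra by blast
  then show thesis using that conjugate_root[OF p(1-3)] min by blast
qed

end

end

section \<open>Relative algebraic closure inside \<complex>\<close>

lemma alg_closure_in_subset: "A \<subseteq> alg_closure_in A"
  by (auto simp: alg_closure_in_def)

lemma alg_closure_in_minimal: "A \<subseteq> S \<Longrightarrow> alg_closed_subring S \<Longrightarrow> alg_closure_in A \<subseteq> S"
  by (auto simp: alg_closure_in_def)

lemma alg_closed_subring_alg_closure_in: "alg_closed_subring (alg_closure_in A)"
  unfolding alg_closed_subring_def
proof (intro conjI ballI allI impI)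
  let ?C = "{S. A \<subseteq> S \<and> alg_closed_subring S}"
  show "1 \<in> alg_closure_in A" by (simp add: alg_closure_in_def alg_closed_subring_def)
  fix a b assume "a \<in> alg_closure_in A" "b \<in> alg_closure_in A"
  then have "a - b \<in> S \<and> a * b \<in> S" if "S \<in> ?C" for S
    using that by (simp add: alg_closure_in_def alg_closed_subring_def)
  then show "a - b \<in> alg_closure_in A" "a * b \<in> alg_closure_in A"
    unfolding alg_closure_in_def by blast+
next
  fix p w assume *: "p \<noteq> 0 \<and> (\<forall>i. coeff p i \<in> alg_closure_in A) \<and> poly p w = 0"
  show "w \<in> alg_closure_in A"
    unfolding alg_closure_in_def
  proof
    fix S assume S: "S \<in> {S. A \<subseteq> S \<and> alg_closed_subring S}"
    then have "\<forall>i. coeff p i \<in> S" using * by (simp add: alg_closure_in_def)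
    then show "w \<in> S" using S * unfolding alg_closed_subring_def by blast
  qed
qed

lemma alg_closure_in_mono: "A \<subseteq> alg_closure_in B \<Longrightarrow> alg_closure_in A \<subseteq> alg_closure_in B"
  by (rule alg_closure_in_minimal[OF _ alg_closed_subring_alg_closure_in])

lemma alg_closed_subring_poly:
  assumes "alg_closed_subring S" "\<And>i. coeff p i \<in> S" "w \<in> S"
  shows "poly p w \<in> S"
proof -
  have 0: "0 \<in> S" using assms(1) unfolding alg_closed_subring_def by (metis diff_self)
  have add: "a + b \<in> S" if "a \<in> S" "b \<in> S" for a b
    using assms(1) 0 that unfolding alg_closed_subring_def
    by (metis diff_0 diff_minus_eq_add)
  show ?thesis using assms(2)
  proof (induction p)
    case (pCons a p)
    have "a \<in> S" using pCons.prems[of 0] by simp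
    moreover have "coeff p i \<in> S" for i using pCons.prems[of "Suc i"] by simp
    ultimately show ?case using pCons.IH assms(1,3) add by (simp add: alg_closed_subring_def)
  qed (simp add: 0)
qed

lemma alg_closed_subring_root:
  "alg_closed_subring S \<Longrightarrow> p \<noteq> 0 \<Longrightarrow> (\<And>i. coeff p i \<in> S) \<Longrightarrow> poly p w = 0 \<Longrightarrow> w \<in> S"
  unfolding alg_closed_subring_def by blast

lemma alg_closed_subring_divide:
  assumes "alg_closed_subring S" "a \<in> S" "b \<in> S"
  shows "a / b \<in> S"
proof (cases "b = 0")
  case True
  then show ?thesis using assms unfolding alg_closed_subring_def by (metis diff_self div_by_0)
next
  case False
  have 0: "0 \<in> S" using assms(1) unfolding alg_closed_subring_def by (metis diff_self)
  have ma: "- a \<in> S" using assms 0 unfolding alg_closed_subring_def by (metis diff_0)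
  show ?thesis
    by (rule alg_closed_subring_root[OF assms(1), of "[:- a, b:]"])
      (use False assms(3) 0 ma in \<open>simp_all add: coeff_pCons split: nat.split\<close>)
qed

text \<open>A maximal partial isomorphism need not be defined everywhere or onto, as \<open>\<complex>\<close> is isomorphic to
  proper subfields of itself. Among the balanced ones, a maximal one has equal domain and range:
  both are algebraically closed in \<open>\<complex>\<close>.\<close>

definition balanced :: "(complex \<times> complex) set \<Rightarrow> bool" where
  "balanced R \<longleftrightarrow> alg_closure_in (fst ` R) = alg_closure_in (snd ` R)"

lemma lift_poly_coeffs:
  assumes "(p, q) \<in> lift_poly R"
  shows "coeff p i \<in> fst ` R" "coeff q i \<in> snd ` R"
proof -
  have "(coeff p i, coeff q i) \<in> R" using assms by (simp add: lift_poly_def)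
  then show "coeff p i \<in> fst ` R" "coeff q i \<in> snd ` R" by (metis fst_conv snd_conv imageI)+
qed

text \<open>Over 0 lies only 0, so the chosen partners of the coefficients vanish beyond the degree
  of \<open>p\<close> and form a polynomial.\<close>

lemma lift_poly_fst:
  assumes "\<And>i. coeff p i \<in> fst ` R" "partial_iso R"
  obtains q where "(p, q) \<in> lift_poly R"
proof -
  have "\<forall>i. \<exists>b. (coeff p i, b) \<in> R" using assms(1) by force
  then obtain b where b: "\<And>i. (coeff p i, b i) \<in> R" by metis
  have "b i = 0" if "i > degree p" for i
    using b[of i] that piso_zero_iff[OF assms(2)] by (auto simp: coeff_eq_0)
  then have "\<forall>\<^sub>\<infinity>i. b i = 0" by (auto simp: MOST_nat)
  then have "coeff (Abs_poly b) = b" by (simp add: Abs_poly_inverse)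
  then show thesis using that[of "Abs_poly b"] b by (simp add: lift_poly_def)
qed

text \<open>The converse relation exchanges domain and range; facts about the range are obtained in
  this way from facts about the domain.\<close>

lemma partial_iso_converse: "partial_iso R \<Longrightarrow> partial_iso (R\<inverse>)"
  by (auto simp: partial_iso_def)

lemma balanced_converse: "balanced R \<Longrightarrow> balanced (R\<inverse>)"
proof -
  have "fst ` (R\<inverse>) = snd ` R" "snd ` (R\<inverse>) = fst ` R" by force+
  then show "balanced R \<Longrightarrow> balanced (R\<inverse>)" by (simp add: balanced_def)
qed

lemma lift_poly_converse: "lift_poly (R\<inverse>) = (lift_poly R)\<inverse>"
  by (auto simp: lift_poly_def)

lemma alg_closure_fst_adjoin:
  assumes "w \<in> alg_closure_in (fst ` R)" "R \<subseteq> adjoin R w w'"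
  shows "alg_closure_in (fst ` adjoin R w w') = alg_closure_in (fst ` R)"
proof (rule antisym; rule alg_closure_in_mono)
  show "fst ` R \<subseteq> alg_closure_in (fst ` adjoin R w w')"
    by (rule order.trans[OF image_mono[OF assms(2)] alg_closure_in_subset])
  show "fst ` adjoin R w w' \<subseteq> alg_closure_in (fst ` R)"
  proof
    fix x assume "x \<in> fst ` adjoin R w w'"
    then obtain p q where pq: "(p, q) \<in> lift_poly R" "x = poly p w" by (auto simp: adjoin_def)
    have "coeff p i \<in> alg_closure_in (fst ` R)" for i
      using lift_poly_coeffs(1)[OF pq(1)] alg_closure_in_subset by (rule rev_subsetD)
    then show "x \<in> alg_closure_in (fst ` R)"
      unfolding pq(2) using assms(1) by (intro alg_closed_subring_poly alg_closed_subring_alg_closure_in)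
  qed
qed

lemma balanced_adjoin_algebraic:
  assumes R: "partial_iso R" "balanced R"
    and w: "w \<in> alg_closure_in (fst ` R)" "w' \<in> alg_closure_in (snd ` R)"
    and R': "R \<subseteq> adjoin R w w'"
  shows "balanced (adjoin R w w')"
proof -
  have c: "adjoin (R\<inverse>) w' w = (adjoin R w w')\<inverse>"
    unfolding adjoin_def lift_poly_converse by auto
  have fs: "fst ` (S\<inverse>) = snd ` S" for S :: "(complex \<times> complex) set" by force
  have "alg_closure_in (snd ` adjoin R w w') = alg_closure_in (snd ` R)"
    using alg_closure_fst_adjoin[of w' "R\<inverse>" w] w(2) R' unfolding c fs by blast
  then show ?thesis using alg_closure_fst_adjoin[OF w(1) R'] R(2) by (simp add: balanced_def)
qed

lemma alg_closure_fractions: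
  assumes R: "partial_iso R" and f: "f = fst \<or> f = snd"
  shows "alg_closure_in (f ` fractions R) = alg_closure_in (f ` R)"
proof (rule antisym; rule alg_closure_in_mono)
  show "f ` R \<subseteq> alg_closure_in (f ` fractions R)"
    by (rule order.trans[OF image_mono[OF partial_iso_fractions(2)[OF R]] alg_closure_in_subset])
  show "f ` fractions R \<subseteq> alg_closure_in (f ` R)"
  proof
    fix x assume "x \<in> f ` fractions R"
    then obtain u v where uv: "u \<in> R" "v \<in> R" "x = f u / f v" using f by (force simp: fractions_def)
    have "f u \<in> alg_closure_in (f ` R)" "f v \<in> alg_closure_in (f ` R)"
      using uv alg_closure_in_subset by blast+
    then show "x \<in> alg_closure_in (f ` R)"
      unfolding uv(3) by (intro alg_closed_subring_divide alg_closed_subring_alg_closure_in)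
  qed
qed

lemma balanced_fractions: "partial_iso R \<Longrightarrow> balanced R \<Longrightarrow> balanced (fractions R)"
  by (simp add: balanced_def alg_closure_fractions)

section \<open>Maximal balanced partial isomorphisms\<close>

lemma partial_iso_Union_chain:
  assumes "C \<noteq> {}" "\<And>R S. R \<in> C \<Longrightarrow> S \<in> C \<Longrightarrow> R \<subseteq> S \<or> S \<subseteq> R" "\<And>R. R \<in> C \<Longrightarrow> partial_iso R"
  shows "partial_iso (\<Union> C)"
  unfolding partial_iso_def
proof (intro conjI allI impI)
  show "(1, 1) \<in> \<Union> C" using assms piso_one by blast
  fix a b c d assume "(a, b) \<in> \<Union> C \<and> (c, d) \<in> \<Union> C"
  then obtain R where R: "R \<in> C" "(a, b) \<in> R" "(c, d) \<in> R" using assms(2) by blast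
  show "(a - c, b - d) \<in> \<Union> C" "(a * c, b * d) \<in> \<Union> C"
    using piso_diff[OF assms(3)] piso_mult[OF assms(3)] R by blast+
next
  fix a b assume "(a, b) \<in> \<Union> C"
  then show "(a = 0) = (b = 0)" using piso_zero_iff[OF assms(3)] by blast
qed

lemma balanced_Union:
  assumes "\<And>R. R \<in> C \<Longrightarrow> balanced R"
  shows "balanced (\<Union> C)"
proof -
  have "alg_closure_in (f ` \<Union> C) \<subseteq> alg_closure_in (g ` \<Union> C)"
    if fg: "\<And>R. R \<in> C \<Longrightarrow> alg_closure_in (f ` R) = alg_closure_in (g ` R)"
    for f g :: "complex \<times> complex \<Rightarrow> complex"
  proof (rule alg_closure_in_mono, rule subsetI)
    fix x assume "x \<in> f ` \<Union> C"
    then obtain R where R: "R \<in> C" "x \<in> f ` R" by blast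
    have "x \<in> alg_closure_in (f ` R)" by (rule subsetD[OF alg_closure_in_subset R(2)])
    then have "x \<in> alg_closure_in (g ` R)" using fg[OF R(1)] by simp
    moreover have "alg_closure_in (g ` R) \<subseteq> alg_closure_in (g ` \<Union> C)"
      by (rule alg_closure_in_mono, rule order.trans[OF _ alg_closure_in_subset]) (use R in auto)
    ultimately show "x \<in> alg_closure_in (g ` \<Union> C)" by blast
  qed
  then show ?thesis using assms unfolding balanced_def by (intro antisym) auto
qed

text \<open>Maximality forces \<open>fractions R = R\<close>, which makes division with remainder
  available. A root \<open>w\<close> of a polynomial over the domain can be sent to a conjugate
  \<open>w'\<close>. Both already lie in the closures of domain and range, so these do not change,
  balance survives, and maximality puts \<open>w\<close> into the domain.\<close>

lemma fst_alg_closed_if_maximal: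
  assumes R: "partial_iso R" "balanced R"
    and max: "\<And>S. partial_iso S \<Longrightarrow> balanced S \<Longrightarrow> R \<subseteq> S \<Longrightarrow> S = R"
  shows "alg_closed_subring (fst ` R)"
proof -
  have "fractions R = R"
    using max partial_iso_fractions[OF R(1)] balanced_fractions[OF R] by blast
  then have inv: "(1 / a, 1 / b) \<in> R" if "(a, b) \<in> R" "a \<noteq> 0" for a b
    using partial_iso_fractions(3)[OF R(1)] that by auto
  show ?thesis
    unfolding alg_closed_subring_def
  proof (intro conjI ballI allI impI)
    show "1 \<in> fst ` R" using piso_one[OF R(1)] by force
    fix a b assume "a \<in> fst ` R" "b \<in> fst ` R"
    then show "a - b \<in> fst ` R" "a * b \<in> fst ` R"
      using piso_diff[OF R(1)] piso_mult[OF R(1)] by force+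
  next
    fix p w assume "p \<noteq> 0 \<and> (\<forall>i. coeff p i \<in> fst ` R) \<and> poly p w = 0"
    then have p: "p \<noteq> 0" "\<And>i. coeff p i \<in> fst ` R" "poly p w = 0" by auto
    obtain q where q: "(p, q) \<in> lift_poly R" using lift_poly_fst[OF p(2) R(1)] by blast
    obtain w' where w': "\<And>f g. (f, g) \<in> lift_poly R \<Longrightarrow> poly f w = 0 \<longleftrightarrow> poly g w' = 0"
      using algebraic_extension[OF R(1) inv q p(1,3)] by blast
    have q': "poly q w' = 0" "q \<noteq> 0" using w'[OF q] p(1,3) lift_zero_iff[OF R(1) q] by auto
    note adj = partial_iso_adjoin[OF R(1) w']
    have "w \<in> alg_closure_in (fst ` R)"
      by (rule alg_closed_subring_root[OF alg_closed_subring_alg_closure_in p(1) _ p(3)])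
        (use p(2) alg_closure_in_subset in blast)
    moreover have "w' \<in> alg_closure_in (snd ` R)"
      by (rule alg_closed_subring_root[OF alg_closed_subring_alg_closure_in q'(2) _ q'(1)])
        (use lift_poly_coeffs(2)[OF q] alg_closure_in_subset in blast)
    ultimately have "balanced (adjoin R w w')"
      using balanced_adjoin_algebraic[OF R] adj(2) by blast
    then have "adjoin R w w' = R" using max adj by blast
    then show "w \<in> fst ` R" using adj(3) by force
  qed
qed

text \<open>Zorn's lemma gives a maximal balanced extension. Its domain and range are algebraically
  closed in \<complex>, so balance makes them the same subring F. An element \<open>w\<close>
  outside F would be transcendental over F and could be sent to itself, with the ring F[w] on both
  sides; hence F is all of \<complex>.\<close>

lemma partial_iso_extends_to_aut:
  assumes R0: "partial_iso R0" "balanced R0"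
  obtains \<sigma> where "field_aut \<sigma>" "\<And>a b. (a, b) \<in> R0 \<Longrightarrow> \<sigma> a = b"
proof -
  let ?G = "{R. partial_iso R \<and> balanced R \<and> R0 \<subseteq> R}"
  have "\<exists>M\<in>?G. \<forall>X\<in>?G. M \<subseteq> X \<longrightarrow> X = M"
  proof (rule subset_Zorn_nonempty)
    show "?G \<noteq> {}" using R0 by auto
    fix C assume C: "C \<noteq> {}" "subset.chain ?G C"
    have C': "partial_iso R" "balanced R" "R0 \<subseteq> R" if "R \<in> C" for R
      using C(2) that by (auto simp: subset_chain_def)
    have "R \<subseteq> S \<or> S \<subseteq> R" if "R \<in> C" "S \<in> C" for R S
      using C(2) that by (auto simp: subset_chain_def)
    then have "partial_iso (\<Union> C)" "balanced (\<Union> C)"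
      using partial_iso_Union_chain[OF C(1)] balanced_Union C' by blast+
    moreover have "R0 \<subseteq> \<Union> C" using C(1) C'(3) by blast
    ultimately have "partial_iso (\<Union> C)" "balanced (\<Union> C)" "R0 \<subseteq> \<Union> C" by auto
    then show "\<Union> C \<in> ?G" by blast
  qed
  then obtain R where R: "partial_iso R" "balanced R" "R0 \<subseteq> R"
    and max: "\<And>S. partial_iso S \<Longrightarrow> balanced S \<Longrightarrow> R \<subseteq> S \<Longrightarrow> S = R" by auto
  \<comment> \<open>The converse of a maximal relation is maximal, which yields closedness of the
    range.\<close>
  have maxc: "S = R\<inverse>" if "partial_iso S" "balanced S" "R\<inverse> \<subseteq> S" for S
  proof -
    have "S\<inverse> = R"
      using that by (intro max partial_iso_converse balanced_converse) auto
    then show ?thesis by (metis converse_converse)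
  qed
  have "alg_closed_subring (fst ` R)" by (rule fst_alg_closed_if_maximal[OF R(1,2) max])
  moreover have "alg_closed_subring (fst ` (R\<inverse>))"
    by (rule fst_alg_closed_if_maximal[OF partial_iso_converse[OF R(1)] balanced_converse[OF R(2)] maxc])
  moreover have "fst ` (R\<inverse>) = snd ` R" by force
  ultimately have acl: "alg_closed_subring (fst ` R)" "alg_closed_subring (snd ` R)" by auto
  have "alg_closure_in (fst ` R) = fst ` R"
    by (rule antisym[OF alg_closure_in_minimal[OF order.refl acl(1)] alg_closure_in_subset])
  moreover have "alg_closure_in (snd ` R) = snd ` R"
    by (rule antisym[OF alg_closure_in_minimal[OF order.refl acl(2)] alg_closure_in_subset])
  ultimately   have eq: "fst ` R = snd ` R" using R(2) by (simp add: balanced_def)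
  have all: "w \<in> fst ` R" for w
  proof (rule ccontr)
    assume w: "w \<notin> fst ` R"
    have nz: "poly p w \<noteq> 0" if "p \<noteq> 0" "\<And>i. coeff p i \<in> fst ` R" for p
      using alg_closed_subring_root[OF acl(1) that] w by metis
    have *: "poly f w = 0 \<longleftrightarrow> poly g w = 0" if fg: "(f, g) \<in> lift_poly R" for f g
    proof (cases "f = 0")
      case True then show ?thesis using lift_zero_iff[OF R(1) fg] by simp
    next
      case False
      then have "g \<noteq> 0" using lift_zero_iff[OF R(1) fg] by simp
      then show ?thesis using nz[OF False] nz[of g] lift_poly_coeffs[OF fg] eq by auto
    qed
    note adj = partial_iso_adjoin[OF R(1) *]
    have "fst ` adjoin R w w = {poly p w |p. \<forall>i. coeff p i \<in> fst ` R}"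
    proof (intro equalityI subsetI)
      fix x assume "x \<in> {poly p w |p. \<forall>i. coeff p i \<in> fst ` R}"
      then obtain p where "x = poly p w" "\<And>i. coeff p i \<in> fst ` R" by blast
      then obtain q where "(p, q) \<in> lift_poly R" using lift_poly_fst[OF _ R(1), of p] by metis
      then show "x \<in> fst ` adjoin R w w" using \<open>x = poly p w\<close> by (force simp: adjoin_def)
    qed (use lift_poly_coeffs(1) in \<open>force simp: adjoin_def\<close>)
    moreover have "snd ` adjoin R w w = {poly p w |p. \<forall>i. coeff p i \<in> snd ` R}"
    proof (intro equalityI subsetI)
      fix x assume "x \<in> {poly p w |p. \<forall>i. coeff p i \<in> snd ` R}"
      then obtain p where p: "x = poly p w" "\<And>i. coeff p i \<in> snd ` R" by blast
      have "fst ` (R\<inverse>) = snd ` R" by force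
      then obtain q where "(p, q) \<in> lift_poly (R\<inverse>)"
        using lift_poly_fst[OF _ partial_iso_converse[OF R(1)], of p] p(2) by metis
      then have "(q, p) \<in> lift_poly R" by (auto simp: lift_poly_def)
      then show "x \<in> snd ` adjoin R w w" using p by (force simp: adjoin_def)
    qed (use lift_poly_coeffs(2) in \<open>force simp: adjoin_def\<close>)
    ultimately have "balanced (adjoin R w w)" by (simp add: balanced_def eq)
    then have "adjoin R w w = R" using max adj by blast
    then show False using adj(3) w by force
  qed
  define \<sigma> where "\<sigma> a = (THE b. (a, b) \<in> R)" for a
  have ex: "\<exists>!b. (a, b) \<in> R" for a
  proof -
    obtain b where "(a, b) \<in> R" using all[of a] by auto
    then show ?thesis using piso_unique[OF R(1)] by metis
  qed
  have \<sigma>: "(a, \<sigma> a) \<in> R" for a unfolding \<sigma>_def by (rule theI'[OF ex])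
  have \<sigma>_eq: "\<sigma> a = b" if "(a, b) \<in> R" for a b using piso_unique[OF R(1)] that \<sigma> by blast
  have "bij \<sigma>"
    unfolding bij_def
  proof
    show "inj \<sigma>" by (rule injI) (metis \<sigma> piso_unique'[OF R(1)])
    show "surj \<sigma>"
      unfolding surj_def
    proof
      fix b
      have "b \<in> snd ` R" using all eq by blast
      then obtain a where "(a, b) \<in> R" by auto
      then show "\<exists>a. b = \<sigma> a" using \<sigma>_eq by metis
    qed
  qed
  moreover have "\<sigma> (a + b) = \<sigma> a + \<sigma> b" "\<sigma> (a * b) = \<sigma> a * \<sigma> b" for a b
    by (rule \<sigma>_eq[OF piso_add[OF R(1) \<sigma> \<sigma>]], rule \<sigma>_eq[OF piso_mult[OF R(1) \<sigma> \<sigma>]])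
  ultimately have "field_aut \<sigma>" by (simp add: field_aut_def)
  then show thesis by (rule that) (use \<sigma>_eq R(3) in blast)
qed

section \<open>Moving an irrational number\<close>

lemma rational_root_if_linear:
  fixes p :: "complex poly"
  assumes "\<And>i. coeff p i \<in> \<rat>" "degree p = 1" "poly p z = 0"
  shows "z \<in> \<rat>"
proof -
  obtain a b where p: "p = [:a, b:]" "b \<noteq> 0"
    using assms(2) by (metis degree1_coeffs)
  then have "a \<in> \<rat>" "b \<in> \<rat>" using assms(1)[of 0] assms(1)[of 1] by auto
  moreover have "z = - a / b" using assms(3) p by (simp add: field_simps eq_neg_iff_add_eq_0)
  ultimately show ?thesis by simp
qed

text \<open>An irrational algebraic number has another conjugate; a transcendental one can be moved
  to \<open>z + 1\<close>. The shift leaves the ring of rational polynomials in \<open>z\<close>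
  unchanged, so that balance is immediate.\<close>

theorem field_aut_moving:
  assumes z: "z \<notin> \<rat>"
  obtains \<sigma> where "field_aut \<sigma>" "\<sigma> z \<noteq> z"
proof -
  let ?Q = "{(a, a) |a :: complex. a \<in> \<rat>}"
  have Q: "partial_iso ?Q" by (auto simp: partial_iso_def)
  have fQ: "fst ` ?Q = \<rat>" "snd ` ?Q = \<rat>" by force+
  then have bQ: "balanced ?Q" by (simp add: balanced_def)
  have lQ: "(p, q) \<in> lift_poly ?Q \<longleftrightarrow> p = q \<and> (\<forall>i. coeff p i \<in> \<rat>)" for p q
    by (auto simp: lift_poly_def poly_eq_iff)
  have invQ: "(1 / a, 1 / b) \<in> ?Q" if "(a, b) \<in> ?Q" for a b using that by auto
  show thesis
  proof (cases "\<exists>p. p \<noteq> 0 \<and> (\<forall>i. coeff p i \<in> \<rat>) \<and> poly p z = 0")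
    case True
    then obtain p0 where p0: "p0 \<noteq> 0" "\<forall>i. coeff p0 i \<in> \<rat>" "poly p0 z = 0" by blast
    obtain p q where p: "(p, q) \<in> lift_poly ?Q" "p \<noteq> 0" "poly p z = 0"
      and min: "\<And>f g. (f, g) \<in> lift_poly ?Q \<Longrightarrow> f \<noteq> 0 \<Longrightarrow> poly f z = 0 \<Longrightarrow> degree p \<le> degree f"
      using minimal_annihilator[of ?Q p0 p0 z] Q invQ p0 lQ by blast
    have pQ: "q = p" "\<And>i. coeff p i \<in> \<rat>" using p(1) lQ by auto
    have d0: "degree p \<noteq> 0"
    proof
      assume "degree p = 0"
      then obtain c where "p = [:c:]" by (meson degree_eq_zeroE)
      then show False using p by simp
    qed
    have d1: "degree p \<noteq> 1" using rational_root_if_linear[OF pQ(2) _ p(3)] z by blast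
    \<comment> \<open>Separability: the derivative has smaller degree than the minimal annihilator,
      so it does not vanish at \<open>z\<close>. Hence \<open>z\<close> is a simple root, and every
      root of the cofactor \<open>f\<close> differs from \<open>z\<close>.\<close>
    have dp: "(pderiv p, pderiv p) \<in> lift_poly ?Q" using pQ(2) by (auto simp: lQ coeff_pderiv)
    have "pderiv p \<noteq> 0" using d0 by (simp add: pderiv_eq_0_iff)
    then have dz: "poly (pderiv p) z \<noteq> 0" using min[OF dp] d0 by (force simp: degree_pderiv)
    obtain f where f: "p = [:- z, 1:] * f" using p(3) by (metis poly_eq_0_iff_dvd dvdE)
    have f0: "f \<noteq> 0" using f p(2) by auto
    have "degree p = 1 + degree f" unfolding f using f0 by (subst degree_mult_eq) auto
    then have "degree f \<noteq> 0" using d1 by simp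
    then have "\<not> constant (poly f)" using constant_degree[of f] by simp
    then obtain z' where z': "poly f z' = 0" using fundamental_theorem_of_algebra by blast
    have "z' \<noteq> z"
    proof
      assume "z' = z"
      have "poly (pderiv p) z = poly f z" unfolding f pderiv_mult by (simp add: pderiv_pCons)
      then show False using dz z' \<open>z' = z\<close> by simp
    qed
    have pz': "poly p z' = 0" using f z' by simp
    have root: "poly f z = 0 \<longleftrightarrow> poly g z' = 0" if "(f, g) \<in> lift_poly ?Q" for f g
      by (rule conjugate_root[OF Q _ p(1,2,3) _ min that]) (use invQ pz' pQ in blast)+
    note adj = partial_iso_adjoin[OF Q root]
    have "y \<in> alg_closure_in \<rat>" if "poly p y = 0" for y
      by (rule alg_closed_subring_root[OF alg_closed_subring_alg_closure_in p(2) _ that])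
        (use pQ alg_closure_in_subset in blast)
    then have "balanced (adjoin ?Q z z')"
      using balanced_adjoin_algebraic[OF Q bQ _ _ adj(2)] fQ p(3) pz' by simp
    then obtain \<sigma> where "field_aut \<sigma>" "\<And>a b. (a, b) \<in> adjoin ?Q z z' \<Longrightarrow> \<sigma> a = b"
      using partial_iso_extends_to_aut[OF adj(1)] by blast
    then show thesis using that[of \<sigma>] adj(3) \<open>z' \<noteq> z\<close> by blast
  next
    case False
    have tr: "poly p z = 0 \<longleftrightarrow> p = 0" if "\<And>i. coeff p i \<in> \<rat>" for p
      using False that by auto
    have shiftQ: "\<forall>i. coeff (pcompose p [:c, 1:]) i \<in> \<rat>" if "\<And>i. coeff p i \<in> \<rat>" "c \<in> \<rat>" for p and c :: complex
      using that(1)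
    proof (induction p)
      case (pCons a p)
      have a: "a \<in> \<rat>" using pCons.prems[of 0] by simp
      have "\<And>i. coeff p i \<in> \<rat>" using pCons.prems[of "Suc _"] by simp
      then show ?case using pCons.IH a that(2)
        by (auto simp: pcompose_pCons coeff_pCons split: nat.split intro!: Rats_add Rats_mult)
    qed auto
    have root: "poly f z = 0 \<longleftrightarrow> poly g (z + 1) = 0" if "(f, g) \<in> lift_poly ?Q" for f g
    proof -
      have fg: "g = f" "\<And>i. coeff f i \<in> \<rat>" using that lQ by auto
      have "poly g (z + 1) = poly (pcompose f [:1, 1:]) z" by (simp add: poly_pcompose fg add.commute)
      also have "\<dots> = 0 \<longleftrightarrow> pcompose f [:1, 1:] = 0" using shiftQ[OF fg(2), of 1] by (intro tr) auto
      also have "\<dots> \<longleftrightarrow> f = 0" by (simp add: pcompose_eq_0_iff)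
      finally show ?thesis using tr[OF fg(2)] by simp
    qed
    note adj = partial_iso_adjoin[OF Q root]
    have "fst ` adjoin ?Q z (z + 1) = {poly p z |p. \<forall>i. coeff p i \<in> \<rat>}"
      by (force simp: adjoin_def lQ)
    moreover have "snd ` adjoin ?Q z (z + 1) = {poly p (z + 1) |p. \<forall>i. coeff p i \<in> \<rat>}"
      by (force simp: adjoin_def lQ)
    moreover have "{poly p z |p. \<forall>i. coeff p i \<in> \<rat>} = {poly p (z + 1) |p. \<forall>i. coeff p i \<in> \<rat>}"
    proof (intro equalityI subsetI)
      fix x assume "x \<in> {poly p z |p. \<forall>i. coeff p i \<in> \<rat>}"
      then obtain p where p: "x = poly p z" "\<forall>i. coeff p i \<in> \<rat>" by blast
      then have "x = poly (pcompose p [:- 1, 1:]) (z + 1)" by (simp add: poly_pcompose)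
      then show "x \<in> {poly p (z + 1) |p. \<forall>i. coeff p i \<in> \<rat>}" using shiftQ[of p "- 1"] p by auto
    next
      fix x assume "x \<in> {poly p (z + 1) |p. \<forall>i. coeff p i \<in> \<rat>}"
      then obtain p where p: "x = poly p (z + 1)" "\<forall>i. coeff p i \<in> \<rat>" by blast
      then have "x = poly (pcompose p [:1, 1:]) z" by (simp add: poly_pcompose add.commute)
      then show "x \<in> {poly p z |p. \<forall>i. coeff p i \<in> \<rat>}" using shiftQ[of p 1] p by auto
    qed
    ultimately have "balanced (adjoin ?Q z (z + 1))" by (simp add: balanced_def)
    then obtain \<sigma> where "field_aut \<sigma>" "\<And>a b. (a, b) \<in> adjoin ?Q z (z + 1) \<Longrightarrow> \<sigma> a = b"
      using partial_iso_extends_to_aut[OF adj(1)] by blast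
    then show thesis using that[of \<sigma>] adj(3) by fastforce
  qed
qed

section \<open>Elementary properties of field automorphisms\<close>

lemma field_aut_add: "field_aut \<sigma> \<Longrightarrow> \<sigma> (a + b) = \<sigma> a + \<sigma> b"
  and field_aut_mult: "field_aut \<sigma> \<Longrightarrow> \<sigma> (a * b) = \<sigma> a * \<sigma> b"
  and field_aut_bij: "field_aut \<sigma> \<Longrightarrow> bij \<sigma>"
  by (auto simp: field_aut_def)

lemma field_aut_inj: "field_aut \<sigma> \<Longrightarrow> \<sigma> a = \<sigma> b \<longleftrightarrow> a = b"
  using field_aut_bij bij_is_inj inj_eq by metis

lemma field_aut_0: "field_aut \<sigma> \<Longrightarrow> \<sigma> 0 = 0"
  using field_aut_add[of \<sigma> 0 0] by simp

lemma field_aut_1: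
  assumes "field_aut \<sigma>" shows "\<sigma> 1 = 1"
proof -
  have "\<sigma> 1 \<noteq> 0" using field_aut_inj[OF assms, of 1 0] field_aut_0[OF assms] by simp
  then show ?thesis using field_aut_mult[OF assms, of 1 1] by simp
qed

lemma field_aut_minus: "field_aut \<sigma> \<Longrightarrow> \<sigma> (- a) = - \<sigma> a"
  using field_aut_add[of \<sigma> a "- a"] field_aut_0[of \<sigma>] by (simp add: eq_neg_iff_add_eq_0 add.commute)

lemma field_aut_diff: "field_aut \<sigma> \<Longrightarrow> \<sigma> (a - b) = \<sigma> a - \<sigma> b"
  using field_aut_add[of \<sigma> a "- b"] field_aut_minus[of \<sigma> b] by simp

lemma field_aut_sum: "field_aut \<sigma> \<Longrightarrow> \<sigma> (sum f A) = (\<Sum>i\<in>A. \<sigma> (f i))"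
  by (induction A rule: infinite_finite_induct) (auto simp: field_aut_0 field_aut_add)

lemma field_aut_of_nat: "field_aut \<sigma> \<Longrightarrow> \<sigma> (of_nat n) = of_nat n"
  by (induction n) (auto simp: field_aut_0 field_aut_1 field_aut_add)

lemma field_aut_of_int: "field_aut \<sigma> \<Longrightarrow> \<sigma> (of_int n) = of_int n"
  by (cases n) (auto simp: field_aut_of_nat field_aut_minus field_aut_diff field_aut_1)

lemma field_aut_Rats:
  assumes \<sigma>: "field_aut \<sigma>" and "q \<in> \<rat>" shows "\<sigma> q = q"
proof -
  obtain a b where ab: "b > 0" "q = of_int a / of_int b" using Rats_cases'[OF \<open>q \<in> \<rat>\<close>] by metis
  then have "q * of_int b = of_int a" by simp
  then have "\<sigma> q * of_int b = of_int a"
    using field_aut_mult[OF \<sigma>, of q "of_int b"] field_aut_of_int[OF \<sigma>] by metis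
  then have "\<sigma> q * of_int b = q * of_int b" using \<open>q * of_int b = of_int a\<close> by simp
  then show ?thesis using ab(1) by simp
qed

section \<open>Polynomial functions\<close>

lemma polyfuns_mono:
  assumes "f \<in> polyfuns K \<Phi>" "K \<subseteq> K'" "\<Phi> \<subseteq> polyfuns K' \<Phi>'"
  shows "f \<in> polyfuns K' \<Phi>'"
  using assms(1) by induction (use assms(2,3) in \<open>auto intro: polyfuns.intros\<close>)

lemma polyfuns_diff:
  assumes "- 1 \<in> K" "f \<in> polyfuns K \<Phi>" "g \<in> polyfuns K \<Phi>"
  shows "(\<lambda>x. f x - g x) \<in> polyfuns K \<Phi>"
  using polyfuns.add[OF assms(2) polyfuns.mult[OF polyfuns.const[OF assms(1)] assms(3)]] by simp

lemma polyfuns_sum: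
  assumes "0 \<in> K" "\<And>i. i \<in> I \<Longrightarrow> f i \<in> polyfuns K \<Phi>"
  shows "(\<lambda>x. \<Sum>i\<in>I. f i x) \<in> polyfuns K \<Phi>"
  using assms(2)
  by (induction I rule: infinite_finite_induct) (auto intro: polyfuns.intros assms(1))

text \<open>With \<open>s\<close> the identity this rewrites functions on \<open>X\<close> in other
  coordinates; with \<open>t\<close> the identity it pulls them back along \<open>s\<close>. Only
  the generators have to be checked.\<close>

lemma polyfuns_pullback:
  assumes "f \<in> polyfuns K \<Phi>" "\<And>\<phi>. \<phi> \<in> \<Phi> \<Longrightarrow> \<exists>\<psi>\<in>polyfuns K \<Psi>. \<forall>x\<in>X. \<phi> (s x) = \<psi> (t x)"
  shows "\<exists>g\<in>polyfuns K \<Psi>. \<forall>x\<in>X. f (s x) = g (t x)"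
  using assms(1)
proof induction
  case (const c)
  then show ?case by (intro bexI[of _ "\<lambda>_. c"]) (auto intro: polyfuns.const)
next
  case (add f g)
  then obtain f' g' where "f' \<in> polyfuns K \<Psi>" "g' \<in> polyfuns K \<Psi>"
    "\<forall>x\<in>X. f (s x) = f' (t x)" "\<forall>x\<in>X. g (s x) = g' (t x)" by blast
  then show ?case by (intro bexI[of _ "\<lambda>x. f' x + g' x"]) (auto intro: polyfuns.add)
next
  case (mult f g)
  then obtain f' g' where "f' \<in> polyfuns K \<Psi>" "g' \<in> polyfuns K \<Psi>"
    "\<forall>x\<in>X. f (s x) = f' (t x)" "\<forall>x\<in>X. g (s x) = g' (t x)" by blast
  then show ?case by (intro bexI[of _ "\<lambda>x. f' x * g' x"]) (auto intro: polyfuns.mult)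
qed (use assms(2) in blast)

lemma polyfuns_equivariant:
  assumes "m \<in> polyfuns \<rat> \<Phi>" "field_aut \<sigma>" "\<And>\<phi>. \<phi> \<in> \<Phi> \<Longrightarrow> \<phi> y = \<sigma> (\<phi> x)"
  shows "m y = \<sigma> (m x)"
  using assms(1) by induction
    (use assms(2,3) in \<open>auto simp: field_aut_Rats field_aut_add field_aut_mult\<close>)

text \<open>Extension of scalars in concrete form: complex coefficients are split off from functions
  over the rationals. The \<open>m i\<close> commute with every automorphism as soon as the
  coordinates do.\<close>

lemma polyfuns_rational_combination:
  assumes "f \<in> polyfuns UNIV \<Phi>"
  obtains n :: nat and c m where "\<And>i. i < n \<Longrightarrow> m i \<in> polyfuns \<rat> \<Phi>"
    "f = (\<lambda>x. \<Sum>i<n. c i * m i x)"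
proof -
  define ev :: "(complex \<times> ('a \<Rightarrow> complex)) list \<Rightarrow> 'a \<Rightarrow> complex"
    where "ev l x = (\<Sum>(c, m)\<leftarrow>l. c * m x)" for l x
  have ev: "ev [] x = 0" "ev ((c, m) # l) x = c * m x + ev l x" "ev (l @ l') x = ev l x + ev l' x"
    for c m l l' x by (simp_all add: ev_def)
  have "\<exists>l. snd ` set l \<subseteq> polyfuns \<rat> \<Phi> \<and> f = ev l"
    using assms
  proof induction
    case (const c)
    show ?case by (rule exI[of _ "[(c, \<lambda>_. 1)]"]) (auto simp: ev fun_eq_iff intro: polyfuns.const)
  next
    case (coord \<phi>)
    then show ?case by (intro exI[of _ "[(1, \<phi>)]"]) (auto simp: ev fun_eq_iff intro: polyfuns.coord)
  next
    case (add f g)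
    then obtain l l' where "snd ` set l \<subseteq> polyfuns \<rat> \<Phi>" "f = ev l" "snd ` set l' \<subseteq> polyfuns \<rat> \<Phi>" "g = ev l'"
      by blast
    then show ?case by (intro exI[of _ "l @ l'"]) (auto simp: ev fun_eq_iff)
  next
    case (mult f g)
    then obtain l l' where l: "snd ` set l \<subseteq> polyfuns \<rat> \<Phi>" "f = ev l"
      and l': "snd ` set l' \<subseteq> polyfuns \<rat> \<Phi>" "g = ev l'" by blast
    from l(1) have "\<exists>k. snd ` set k \<subseteq> polyfuns \<rat> \<Phi> \<and> (\<forall>x. ev l x * ev l' x = ev k x)"
    proof (induction l)
      case Nil
      then show ?case by (intro exI[of _ "[]"]) (auto simp: ev)
    next
      case (Cons a l)
      obtain c m where a: "a = (c, m)" by force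
      obtain k where k: "snd ` set k \<subseteq> polyfuns \<rat> \<Phi>" "\<forall>x. ev l x * ev l' x = ev k x"
        using Cons by auto
      have "ev (map (\<lambda>(d, n). (c * d, \<lambda>x. m x * n x)) l') x = c * m x * ev l' x" for x
        by (induction l') (auto simp: ev algebra_simps)
      moreover have "snd ` set (map (\<lambda>(d, n). (c * d, \<lambda>x. m x * n x)) l') \<subseteq> polyfuns \<rat> \<Phi>"
        using Cons.prems l'(1) a by (force intro: polyfuns.mult)
      ultimately show ?case using k
        by (intro exI[of _ "map (\<lambda>(d, n). (c * d, \<lambda>x. m x * n x)) l' @ k"])
          (auto simp: ev a algebra_simps)
    qed
    then obtain k where k: "snd ` set k \<subseteq> polyfuns \<rat> \<Phi>" "\<forall>x. ev l x * ev l' x = ev k x" by blast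
    have "(\<lambda>x. f x * g x) = ev k" using k(2) l(2) l'(2) by (simp add: fun_eq_iff)
    then show ?case using k(1) by blast
  qed
  then obtain l where l: "snd ` set l \<subseteq> polyfuns \<rat> \<Phi>" "f = ev l" by blast
  show thesis
  proof (rule that[of "length l" "\<lambda>i. snd (l ! i)" "\<lambda>i. fst (l ! i)"])
    show "snd (l ! i) \<in> polyfuns \<rat> \<Phi>" if "i < length l" for i
      using l(1) nth_mem[OF that] by blast
    show "f = (\<lambda>x. \<Sum>i<length l. fst (l ! i) * snd (l ! i) x)"
      unfolding l(2)
    proof
      fix x
      have "ev l x = (\<Sum>i<length l. map (\<lambda>(c, m). c * m x) l ! i)"
        unfolding ev_def by (subst sum_list_sum_nth) (simp add: atLeast0LessThan)
      also have "\<dots> = (\<Sum>i<length l. fst (l ! i) * snd (l ! i) x)"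
        by (rule sum.cong) (auto simp: case_prod_beta)
      finally show "ev l x = (\<Sum>i<length l. fst (l ! i) * snd (l ! i) x)" .
    qed
  qed
qed

section \<open>Descent to the rationals\<close>

text \<open>By induction on the number of terms: scale a coefficient to 1; an automorphism moving another
  coefficient yields a relation \<open>\<sigma> c - c\<close> with fewer terms, which either does not vanish at \<open>z\<close> or can
  be used to eliminate a term from \<open>c\<close>.\<close>

lemma rational_combination_descent:
  fixes m :: "nat \<Rightarrow> 'p \<Rightarrow> complex"
  assumes Z: "\<And>\<sigma>. field_aut \<sigma> \<Longrightarrow> Z \<subseteq> s \<sigma> ` Z"
    and m: "\<And>\<sigma> i x. field_aut \<sigma> \<Longrightarrow> i \<in> I \<Longrightarrow> x \<in> Z \<Longrightarrow> m i (s \<sigma> x) = \<sigma> (m i x)"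
    and "finite I" "\<And>x. x \<in> Z \<Longrightarrow> (\<Sum>i\<in>I. c i * m i x) = 0" "(\<Sum>i\<in>I. c i * m i z) \<noteq> 0"
  shows "\<exists>q. (\<forall>i. q i \<in> \<rat>) \<and> (\<forall>x\<in>Z. (\<Sum>i\<in>I. q i * m i x) = 0) \<and> (\<Sum>i\<in>I. q i * m i z) \<noteq> 0"
  using assms(2-)
proof (induction "card I" arbitrary: I c rule: less_induct)
  case less
  note m = less.prems(1) and fin = less.prems(2) and van = less.prems(3) and nz = less.prems(4)
  have smaller: ?case
    if j: "j \<in> I" "d j = 0" and d: "\<And>x. x \<in> Z \<Longrightarrow> (\<Sum>i\<in>I. d i * m i x) = 0"
      "(\<Sum>i\<in>I. d i * m i z) \<noteq> 0" for j and d :: "nat \<Rightarrow> complex"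
  proof -
    have eq: "(\<Sum>i\<in>I. e i * m i x) = (\<Sum>i\<in>I - {j}. e i * m i x)" if "e j = 0" for e x
      using that j(1) fin by (simp add: sum.remove)
    have "\<exists>q. (\<forall>i. q i \<in> \<rat>) \<and> (\<forall>x\<in>Z. (\<Sum>i\<in>I - {j}. q i * m i x) = 0) \<and> (\<Sum>i\<in>I - {j}. q i * m i z) \<noteq> 0"
    proof (rule less.hyps[of "I - {j}" d])
      show "card (I - {j}) < card I" using j(1) fin by (metis card_Diff1_less)
    qed (use m fin d eq[of d] j in auto)
    then obtain q where q: "\<And>i. q i \<in> \<rat>" "\<And>x. x \<in> Z \<Longrightarrow> (\<Sum>i\<in>I - {j}. q i * m i x) = 0"
      "(\<Sum>i\<in>I - {j}. q i * m i z) \<noteq> 0" by blast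
    let ?q = "q(j := 0)"
    have "(\<Sum>i\<in>I. ?q i * m i x) = (\<Sum>i\<in>I - {j}. q i * m i x)" for x
      by (subst eq) (auto intro!: sum.cong)
    then show ?thesis using q by (intro exI[of _ ?q]) auto
  qed
  have "\<exists>i\<in>I. c i \<noteq> 0"
  proof (rule ccontr)
    assume "\<not> (\<exists>i\<in>I. c i \<noteq> 0)"
    then have "(\<Sum>i\<in>I. c i * m i z) = 0" by (intro sum.neutral) auto
    then show False using nz by simp
  qed
  then obtain i0 where i0: "i0 \<in> I" "c i0 \<noteq> 0" by blast
  define c' where "c' i = c i / c i0" for i
  have c'_sum: "(\<Sum>i\<in>I. c' i * m i x) = (\<Sum>i\<in>I. c i * m i x) / c i0" for x
    by (simp add: c'_def sum_divide_distrib)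
  have van': "(\<Sum>i\<in>I. c' i * m i x) = 0" if "x \<in> Z" for x using c'_sum van[OF that] by simp
  have nz': "(\<Sum>i\<in>I. c' i * m i z) \<noteq> 0" using c'_sum[of z] nz i0 by simp
  show ?case
  proof (cases "\<forall>i\<in>I. c' i \<in> \<rat>")
    case True
    let ?q = "\<lambda>i. if i \<in> I then c' i else 0"
    have "(\<Sum>i\<in>I. ?q i * m i x) = (\<Sum>i\<in>I. c' i * m i x)" for x by (rule sum.cong) auto
    then show ?thesis using True van' nz' by (intro exI[of _ ?q]) auto
  next
    case False
    then obtain i1 where i1: "i1 \<in> I" "c' i1 \<notin> \<rat>" by blast
    obtain \<sigma> where \<sigma>: "field_aut \<sigma>" "\<sigma> (c' i1) \<noteq> c' i1" using field_aut_moving[OF i1(2)] by blast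
    define h where "h i = \<sigma> (c' i) - c' i" for i
    have h0: "h i0 = 0" using i0 field_aut_1[OF \<sigma>(1)] by (simp add: h_def c'_def)
    have h1: "h i1 \<noteq> 0" using \<sigma>(2) by (simp add: h_def)
    have h_van: "(\<Sum>i\<in>I. h i * m i x) = 0" if x: "x \<in> Z" for x
    proof -
      \<comment> \<open>The relation \<open>c'\<close> is used at a preimage \<open>y\<close> of
        \<open>x\<close>, which lies in \<open>Z\<close> as well, and \<sigma> carries it over to
        \<open>x\<close>. So the coefficients \<open>\<sigma> (c' i)\<close> give a relation on all
        of \<open>Z\<close> again.\<close>
      obtain y where y: "y \<in> Z" "x = s \<sigma> y" using Z[OF \<sigma>(1)] x by blast
      have "(\<Sum>i\<in>I. \<sigma> (c' i) * m i x) = (\<Sum>i\<in>I. \<sigma> (c' i * m i y))"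
        using m[OF \<sigma>(1) _ y(1)] y(2) by (intro sum.cong) (auto simp: field_aut_mult[OF \<sigma>(1)])
      also have "\<dots> = 0"
        using van'[OF y(1)] field_aut_0[OF \<sigma>(1)] by (simp flip: field_aut_sum[OF \<sigma>(1)])
      finally show ?thesis using van'[OF x] by (simp add: h_def left_diff_distrib sum_subtractf)
    qed
    show ?thesis
    proof (cases "(\<Sum>i\<in>I. h i * m i z) = 0")
      case False
      then show ?thesis using smaller[where j = i0 and d = h] i0(1) h0 h_van by metis
    next
      case True
      \<comment> \<open>The multiple of \<open>h\<close> is chosen to cancel the coefficient at
        \<open>i1\<close>; as the combination with coefficients \<open>h\<close> vanishes at
        \<open>z\<close>, the value at \<open>z\<close> stays nonzero.\<close>
      define d where "d i = c' i - c' i1 / h i1 * h i" for i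
      have d: "(\<Sum>i\<in>I. d i * m i x) = (\<Sum>i\<in>I. c' i * m i x) - c' i1 / h i1 * (\<Sum>i\<in>I. h i * m i x)" for x
        by (simp add: d_def left_diff_distrib sum_subtractf sum_distrib_left mult.assoc)
      have "d i1 = 0" using h1 by (simp add: d_def)
      moreover have "(\<Sum>i\<in>I. d i * m i x) = 0" if "x \<in> Z" for x
        using h_van[OF that] van'[OF that] by (simp add: d)
      moreover have "(\<Sum>i\<in>I. d i * m i z) \<noteq> 0" using nz' True by (simp add: d)
      ultimately show ?thesis using smaller[where j = i1 and d = d] i1(1) by metis
    qed
  qed
qed

text \<open>Descent in the form that suits zero sets: they call for the separation of single points
  from an invariant set, not for generators of its vanishing ideal.\<close>

lemma rational_polyfun_separating:
  assumes Z: "\<And>\<sigma>. field_aut \<sigma> \<Longrightarrow> Z \<subseteq> s \<sigma> ` Z"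
    and s: "\<And>\<sigma> \<phi> x. field_aut \<sigma> \<Longrightarrow> \<phi> \<in> \<Phi> \<Longrightarrow> x \<in> Z \<Longrightarrow> \<phi> (s \<sigma> x) = \<sigma> (\<phi> x)"
    and f: "f \<in> polyfuns UNIV \<Phi>" "\<And>x. x \<in> Z \<Longrightarrow> f x = 0" "f z \<noteq> 0"
  obtains q where "q \<in> polyfuns \<rat> \<Phi>" "\<And>x. x \<in> Z \<Longrightarrow> q x = 0" "q z \<noteq> 0"
proof -
  obtain n :: nat and c m where m: "\<And>i. i < n \<Longrightarrow> m i \<in> polyfuns \<rat> \<Phi>"
    and fm: "f = (\<lambda>x. \<Sum>i<n. c i * m i x)"
    using polyfuns_rational_combination[OF f(1)] by blast
  have "\<exists>q. (\<forall>i. q i \<in> \<rat>) \<and> (\<forall>x\<in>Z. (\<Sum>i<n. q i * m i x) = 0) \<and> (\<Sum>i<n. q i * m i z) \<noteq> 0"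
  proof (rule rational_combination_descent[OF Z])
    show "m i (s \<sigma> x) = \<sigma> (m i x)" if "field_aut \<sigma>" "i \<in> {..<n}" "x \<in> Z" for \<sigma> i x
      using polyfuns_equivariant[OF m, of i \<sigma>] s that by auto
  qed (use f fm in auto)
  then obtain q where q: "\<And>i. q i \<in> \<rat>" "\<And>x. x \<in> Z \<Longrightarrow> (\<Sum>i<n. q i * m i x) = 0" "(\<Sum>i<n. q i * m i z) \<noteq> 0"
    by blast
  show thesis
    by (rule that[of "\<lambda>x. \<Sum>i<n. q i * m i x"])
      (use q m in \<open>auto intro!: polyfuns_sum polyfuns.mult polyfuns.const\<close>)
qed

section \<open>Finiteness of the set of irreducible components\<close>

text \<open>Membership in the ideal generated by the first \<open>n\<close> members of
  \<open>g\<close>; for \<open>n = 0\<close> only the zero function qualifies.\<close>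

definition combination ::
  "('p \<Rightarrow> complex) set \<Rightarrow> (nat \<Rightarrow> 'p \<Rightarrow> complex) \<Rightarrow> nat \<Rightarrow> ('p \<Rightarrow> complex) \<Rightarrow> bool" where
  "combination A g n f \<longleftrightarrow> (\<exists>r. (\<forall>i<n. r i \<in> A) \<and> f = (\<lambda>x. \<Sum>i<n. r i x * g i x))"

text \<open>The ascending chain condition on ideals in sequence form: no sequence enlarges the ideal
  of its predecessors at every step.\<close>

definition noetherian_funs :: "('p \<Rightarrow> complex) set \<Rightarrow> bool" where
  "noetherian_funs A \<longleftrightarrow> (\<forall>g. range g \<subseteq> A \<longrightarrow> (\<exists>n. combination A g n (g n)))"

text \<open>Polynomials in \<phi> of degree less than \<open>d\<close> over \<open>A\<close>. As
  \<phi> is a function and no indeterminate, the representation is not unique; the least possible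
  \<open>d\<close> takes the role of the degree plus one, with 0 for the zero function.\<close>

primrec deg_below :: "('p \<Rightarrow> complex) set \<Rightarrow> ('p \<Rightarrow> complex) \<Rightarrow> nat \<Rightarrow> ('p \<Rightarrow> complex) set" where
  "deg_below A \<phi> 0 = {\<lambda>_. 0}"
| "deg_below A \<phi> (Suc d) = {\<lambda>x. a x * \<phi> x ^ d + f x |a f. a \<in> A \<and> f \<in> deg_below A \<phi> d}"

lemma combination_add:
  assumes "combination (polyfuns UNIV \<Phi>) g n f" "combination (polyfuns UNIV \<Phi>) g n f'"
  shows "combination (polyfuns UNIV \<Phi>) g n (\<lambda>x. f x + f' x)"
proof -
  obtain r r' where "\<forall>i<n. r i \<in> polyfuns UNIV \<Phi>" "f = (\<lambda>x. \<Sum>i<n. r i x * g i x)"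
    "\<forall>i<n. r' i \<in> polyfuns UNIV \<Phi>" "f' = (\<lambda>x. \<Sum>i<n. r' i x * g i x)"
    using assms by (auto simp: combination_def)
  then show ?thesis unfolding combination_def
    by (intro exI[of _ "\<lambda>i x. r i x + r' i x"])
      (auto simp: distrib_right sum.distrib intro: polyfuns.add)
qed

lemma combination_mult:
  assumes "combination (polyfuns UNIV \<Phi>) g n f" "a \<in> polyfuns UNIV \<Phi>"
  shows "combination (polyfuns UNIV \<Phi>) g n (\<lambda>x. a x * f x)"
proof -
  obtain r where "\<forall>i<n. r i \<in> polyfuns UNIV \<Phi>" "f = (\<lambda>x. \<Sum>i<n. r i x * g i x)"
    using assms by (auto simp: combination_def)
  then show ?thesis unfolding combination_def using assms(2)
    by (intro exI[of _ "\<lambda>i x. a x * r i x"])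
      (auto simp: sum_distrib_left mult.assoc intro: polyfuns.mult)
qed

lemma combination_zero: "combination (polyfuns UNIV \<Phi>) g n (\<lambda>_. 0)"
  unfolding combination_def by (rule exI[of _ "\<lambda>_ _. 0"]) (auto intro: polyfuns.const)

lemma combination_self:
  assumes "i < n" shows "combination (polyfuns UNIV \<Phi>) g n (g i)"
  unfolding combination_def
proof (intro exI conjI)
  show "\<forall>j<n. (\<lambda>_. if j = i then 1 else 0) \<in> polyfuns UNIV \<Phi>" by (auto intro: polyfuns.const)
  show "g i = (\<lambda>x. \<Sum>j<n. (if j = i then 1 else 0) * g j x)"
    using assms by (auto simp: if_distrib[of "\<lambda>a. a * _"] cong: if_cong)
qed

lemma combination_sum:
  assumes "\<And>i. i \<in> I \<Longrightarrow> combination (polyfuns UNIV \<Phi>) g n (f i)"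
  shows "combination (polyfuns UNIV \<Phi>) g n (\<lambda>x. \<Sum>i\<in>I. f i x)"
  using assms
  by (induction I rule: infinite_finite_induct) (auto intro: combination_zero combination_add)

lemma combination_trans:
  assumes "combination (polyfuns UNIV \<Phi>) g n f" "\<And>i. i < n \<Longrightarrow> combination (polyfuns UNIV \<Phi>) h m (g i)"
  shows "combination (polyfuns UNIV \<Phi>) h m f"
proof -
  obtain r where r: "\<forall>i<n. r i \<in> polyfuns UNIV \<Phi>" "f = (\<lambda>x. \<Sum>i<n. r i x * g i x)"
    using assms(1) by (auto simp: combination_def)
  show ?thesis unfolding r(2) using r(1) assms(2) by (intro combination_sum combination_mult) auto
qed

lemma combination_mono:
  assumes "combination (polyfuns UNIV \<Phi>) g n f" "n \<le> m"
  shows "combination (polyfuns UNIV \<Phi>) g m f"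
  using combination_trans[OF assms(1), of g m] combination_self assms(2) by (meson order_less_le_trans)

lemma deg_below_SucI:
  "a \<in> A \<Longrightarrow> f \<in> deg_below A \<phi> d \<Longrightarrow> (\<lambda>x. a x * \<phi> x ^ d + f x) \<in> deg_below A \<phi> (Suc d)"
  by auto

lemma deg_below_SucE:
  assumes "f \<in> deg_below A \<phi> (Suc d)"
  obtains a h where "a \<in> A" "h \<in> deg_below A \<phi> d" "f = (\<lambda>x. a x * \<phi> x ^ d + h x)"
  using assms by auto

lemma deg_below_zero: "(\<lambda>_. 0) \<in> deg_below (polyfuns UNIV \<Phi>) \<phi> d"
proof (induction d)
  case (Suc d)
  then show ?case
    by (auto intro!: exI[of _ "\<lambda>_. 0"] polyfuns.const)
qed simp

lemma deg_below_add:
  "f \<in> deg_below (polyfuns UNIV \<Phi>) \<phi> d \<Longrightarrow> g \<in> deg_below (polyfuns UNIV \<Phi>) \<phi> d \<Longrightarrow>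
   (\<lambda>x. f x + g x) \<in> deg_below (polyfuns UNIV \<Phi>) \<phi> d"
proof (induction d arbitrary: f g)
  case (Suc d)
  then obtain a f' b g' where *: "a \<in> polyfuns UNIV \<Phi>" "f' \<in> deg_below (polyfuns UNIV \<Phi>) \<phi> d"
    "b \<in> polyfuns UNIV \<Phi>" "g' \<in> deg_below (polyfuns UNIV \<Phi>) \<phi> d"
    "f = (\<lambda>x. a x * \<phi> x ^ d + f' x)" "g = (\<lambda>x. b x * \<phi> x ^ d + g' x)" by auto
  have "(\<lambda>x. f x + g x) = (\<lambda>x. (a x + b x) * \<phi> x ^ d + (f' x + g' x))"
    by (simp add: * algebra_simps)
  moreover have "(\<lambda>x. a x + b x) \<in> polyfuns UNIV \<Phi>" using * polyfuns.add by blast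
  ultimately show ?case using Suc.IH[OF *(2,4)] by (auto intro!: exI)
qed simp

lemma deg_below_mult:
  "f \<in> deg_below (polyfuns UNIV \<Phi>) \<phi> d \<Longrightarrow> a \<in> polyfuns UNIV \<Phi> \<Longrightarrow>
   (\<lambda>x. a x * f x) \<in> deg_below (polyfuns UNIV \<Phi>) \<phi> d"
proof (induction d arbitrary: f)
  case (Suc d)
  then obtain b f' where *: "b \<in> polyfuns UNIV \<Phi>" "f' \<in> deg_below (polyfuns UNIV \<Phi>) \<phi> d"
    "f = (\<lambda>x. b x * \<phi> x ^ d + f' x)" by auto
  have "(\<lambda>x. a x * f x) = (\<lambda>x. (a x * b x) * \<phi> x ^ d + a x * f' x)"
    by (simp add: * algebra_simps)
  moreover have "(\<lambda>x. a x * b x) \<in> polyfuns UNIV \<Phi>" using * Suc.prems polyfuns.mult by blast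
  ultimately show ?case using Suc.IH[OF *(2) Suc.prems(2)] by (auto intro!: exI)
qed simp

lemma deg_below_shift:
  "f \<in> deg_below (polyfuns UNIV \<Phi>) \<phi> d \<Longrightarrow> (\<lambda>x. \<phi> x * f x) \<in> deg_below (polyfuns UNIV \<Phi>) \<phi> (Suc d)"
proof (induction d arbitrary: f)
  case 0
  then show ?case by (auto intro!: exI[of _ "\<lambda>_. 0"] polyfuns.const)
next
  case (Suc d)
  then obtain b f' where *: "b \<in> polyfuns UNIV \<Phi>" "f' \<in> deg_below (polyfuns UNIV \<Phi>) \<phi> d"
    "f = (\<lambda>x. b x * \<phi> x ^ d + f' x)" by auto
  have "(\<lambda>x. \<phi> x * f x) = (\<lambda>x. b x * \<phi> x ^ Suc d + \<phi> x * f' x)"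
    by (simp add: * algebra_simps)
  then show ?case using deg_below_SucI[OF *(1) Suc.IH[OF *(2)]] by (simp del: deg_below.simps)
qed

lemma deg_below_shift_power:
  "f \<in> deg_below (polyfuns UNIV \<Phi>) \<phi> d \<Longrightarrow> (\<lambda>x. \<phi> x ^ k * f x) \<in> deg_below (polyfuns UNIV \<Phi>) \<phi> (d + k)"
proof (induction k)
  case (Suc k)
  have "(\<lambda>x. \<phi> x ^ Suc k * f x) = (\<lambda>x. \<phi> x * (\<phi> x ^ k * f x))" by (simp add: mult.assoc)
  then show ?case using deg_below_shift[OF Suc.IH[OF Suc.prems]] by simp
qed simp

lemma deg_below_mono:
  assumes "f \<in> deg_below (polyfuns UNIV \<Phi>) \<phi> d" "d \<le> e"
  shows "f \<in> deg_below (polyfuns UNIV \<Phi>) \<phi> e"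
  using assms(2,1)
proof (induction e rule: dec_induct)
  case (step e)
  show ?case
    using deg_below_SucI[of "\<lambda>_. 0" _ f \<phi> e, OF polyfuns.const[OF UNIV_I] step.IH[OF step.prems]]
    by (simp del: deg_below.simps)
qed

lemma deg_below_sum:
  assumes "\<And>i. i \<in> I \<Longrightarrow> f i \<in> deg_below (polyfuns UNIV \<Phi>) \<phi> d"
  shows "(\<lambda>x. \<Sum>i\<in>I. f i x) \<in> deg_below (polyfuns UNIV \<Phi>) \<phi> d"
  using assms
  by (induction I rule: infinite_finite_induct) (auto intro: deg_below_zero deg_below_add)

lemma deg_below_product:
  assumes "f \<in> deg_below (polyfuns UNIV \<Phi>) \<phi> d" "g \<in> deg_below (polyfuns UNIV \<Phi>) \<phi> e"
  shows "(\<lambda>x. f x * g x) \<in> deg_below (polyfuns UNIV \<Phi>) \<phi> (d + e)"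
  using assms(1)
proof (induction d arbitrary: f)
  case (Suc d)
  then obtain b f' where *: "b \<in> polyfuns UNIV \<Phi>" "f' \<in> deg_below (polyfuns UNIV \<Phi>) \<phi> d"
    "f = (\<lambda>x. b x * \<phi> x ^ d + f' x)" by auto
  have "(\<lambda>x. \<phi> x ^ d * (b x * g x)) \<in> deg_below (polyfuns UNIV \<Phi>) \<phi> (Suc d + e)"
    by (rule deg_below_mono[OF deg_below_shift_power[OF deg_below_mult[OF assms(2) *(1)]]]) simp
  moreover have "(\<lambda>x. f' x * g x) \<in> deg_below (polyfuns UNIV \<Phi>) \<phi> (Suc d + e)"
    by (rule deg_below_mono[OF Suc.IH[OF *(2)]]) simp
  ultimately have "(\<lambda>x. \<phi> x ^ d * (b x * g x) + f' x * g x) \<in> deg_below (polyfuns UNIV \<Phi>) \<phi> (Suc d + e)"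
    by (rule deg_below_add)
  also have "(\<lambda>x. \<phi> x ^ d * (b x * g x) + f' x * g x) = (\<lambda>x. f x * g x)"
    by (simp add: * algebra_simps)
  finally show ?case .
qed (use deg_below_zero in auto)

lemma polyfuns_insert_deg_below:
  assumes "f \<in> polyfuns UNIV (insert \<phi> \<Phi>)"
  shows "\<exists>d. f \<in> deg_below (polyfuns UNIV \<Phi>) \<phi> d"
proof -
  have 1: "a \<in> deg_below (polyfuns UNIV \<Phi>) \<phi> 1" if "a \<in> polyfuns UNIV \<Phi>" for a
    using that by simp
  show ?thesis using assms
  proof induction
    case (const c)
    then show ?case using 1 polyfuns.const by blast
  next
    case (coord \<psi>)
    have "(\<lambda>_. 1) \<in> deg_below (polyfuns UNIV \<Phi>) \<phi> 1" using 1 polyfuns.const by blast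
    from deg_below_shift[OF this] have "\<phi> \<in> deg_below (polyfuns UNIV \<Phi>) \<phi> 2"
      by (simp add: numeral_2_eq_2 del: deg_below.simps)
    then show ?case using coord 1 polyfuns.coord by blast
  next
    case (add f g)
    then obtain d e where "f \<in> deg_below (polyfuns UNIV \<Phi>) \<phi> d" "g \<in> deg_below (polyfuns UNIV \<Phi>) \<phi> e"
      by blast
    then have "f \<in> deg_below (polyfuns UNIV \<Phi>) \<phi> (max d e)" "g \<in> deg_below (polyfuns UNIV \<Phi>) \<phi> (max d e)"
      by (auto intro: deg_below_mono)
    then show ?case by (blast intro: deg_below_add)
  next
    case (mult f g)
    then show ?case by (blast intro: deg_below_product)
  qed
qed

text \<open>Hilbert's basis theorem, in terms of sequences in which no element is a combination of its
  predecessors.\<close>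

lemma combination_bad_sequence:
  assumes bad: "\<And>n. \<not> combination (polyfuns UNIV \<Phi>) F n (F n)"
    and g: "\<And>i. i < n \<Longrightarrow> \<exists>k. combination (polyfuns UNIV \<Phi>) F k (g i)"
  obtains k f where "combination (polyfuns UNIV \<Phi>) F k f" "\<not> combination (polyfuns UNIV \<Phi>) g n f"
proof -
  have "\<exists>k. \<forall>i. i < n \<longrightarrow> combination (polyfuns UNIV \<Phi>) F (k i) (g i)" using g by meson
  then obtain k where k: "\<And>i. i < n \<Longrightarrow> combination (polyfuns UNIV \<Phi>) F (k i) (g i)" by blast
  define M where "M = Max (insert 0 (k ` {..<n}))"
  have M: "k i \<le> M" if "i < n" for i unfolding M_def using that by (intro Max_ge) auto
  have kM: "combination (polyfuns UNIV \<Phi>) F M (g i)" if "i < n" for i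
    using combination_mono[OF k[OF that] M[OF that]] .
  have "\<not> combination (polyfuns UNIV \<Phi>) g n (F M)"
  proof
    assume "combination (polyfuns UNIV \<Phi>) g n (F M)"
    from combination_trans[OF this kM] bad show False by blast
  qed
  moreover have "combination (polyfuns UNIV \<Phi>) F (Suc M) (F M)" by (rule combination_self) simp
  ultimately show thesis using that by blast
qed

text \<open>Hilbert's argument. In the ideal \<open>I\<close> generated by a bad sequence
  \<open>F\<close>, each \<open>g n\<close> is an element of least degree outside the ideal of its
  predecessors. The leading coefficients \<open>a n\<close> lie in the smaller ring, so one of them
  is a combination of earlier ones. Subtracting the matching combination of the earlier
  \<open>g i\<close> gives an element of lower degree that is still outside that ideal.\<close>

lemma noetherian_polyfuns_insert:
  fixes \<phi> :: "'p \<Rightarrow> complex"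
  assumes noeth: "noetherian_funs (polyfuns UNIV \<Phi>)"
  shows "noetherian_funs (polyfuns UNIV (insert \<phi> \<Phi>))"
proof (rule ccontr)
  let ?A = "polyfuns UNIV \<Phi>" and ?B = "polyfuns UNIV (insert \<phi> \<Phi>)"
  assume "\<not> ?thesis"
  then obtain F :: "nat \<Rightarrow> 'p \<Rightarrow> complex" where F: "\<And>n. F n \<in> ?B" "\<And>n. \<not> combination ?B F n (F n)"
    by (auto simp: noetherian_funs_def)
  define I where "I = {f. \<exists>k. combination ?B F k f}"
  have AB: "a \<in> ?B" if "a \<in> ?A" for a
    using that by (rule polyfuns_mono) (auto intro: polyfuns.coord)
  have IB: "f \<in> ?B" if "f \<in> I" for f
    using that F(1) by (auto simp: I_def combination_def intro!: polyfuns_sum polyfuns.mult)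
  have I_add: "(\<lambda>x. f x + g x) \<in> I" if fg: "f \<in> I" "g \<in> I" for f g
  proof -
    obtain k l where kl: "combination ?B F k f" "combination ?B F l g" using fg by (auto simp: I_def)
    have "combination ?B F (max k l) f" "combination ?B F (max k l) g"
      by (rule combination_mono[OF kl(1)], simp) (rule combination_mono[OF kl(2)], simp)
    then show ?thesis using combination_add unfolding I_def by blast
  qed
  have I_mult: "(\<lambda>x. a x * f x) \<in> I" if "f \<in> I" "a \<in> ?B" for f a
    using combination_mult[OF _ that(2)] that(1) unfolding I_def by blast
  have I_sum: "(\<lambda>x. \<Sum>i\<in>J. f i x) \<in> I" if "\<And>i. i \<in> J \<Longrightarrow> f i \<in> I" for J :: "nat set" and f
    using that
    by (induction J rule: infinite_finite_induct)
      (auto simp: I_def intro: I_add[unfolded I_def, simplified] combination_zero)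
  define deg where "deg f = (LEAST d. f \<in> deg_below ?A \<phi> d)" for f
  have deg: "f \<in> deg_below ?A \<phi> (deg f)" if "f \<in> ?B" for f
    unfolding deg_def using LeastI_ex[OF polyfuns_insert_deg_below[OF that]] .
  have deg_le: "deg f \<le> d" if "f \<in> deg_below ?A \<phi> d" for f d
    unfolding deg_def using that by (rule Least_le)
  define P where "P g n f \<longleftrightarrow> f \<in> I \<and> \<not> combination ?B g n f \<and>
    (\<forall>f'\<in>I. \<not> combination ?B g n f' \<longrightarrow> deg f \<le> deg f')" for g :: "nat \<Rightarrow> 'p \<Rightarrow> complex" and n f
  \<comment> \<open>Dependent choice: the condition on \<open>g n\<close> involves all earlier
    values of \<open>g\<close>, and only these.\<close>
  have "\<exists>g. \<forall>n. P g n (g n)"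
  proof (rule dependent_wf_choice[of less_than])
    fix n :: nat and g g' :: "nat \<Rightarrow> 'p \<Rightarrow> complex" and f
    assume "\<And>i. (i, n) \<in> less_than \<Longrightarrow> g i = g' i"
    then have "(\<lambda>x. \<Sum>i<n. r i x * g i x) = (\<lambda>x. \<Sum>i<n. r i x * g' i x)" for r :: "nat \<Rightarrow> 'p \<Rightarrow> complex"
      by (intro ext sum.cong) auto
    then have "combination ?B g n = combination ?B g' n" by (simp add: combination_def fun_eq_iff[of "combination _ _ _"])
    then show "P g n f = P g' n f" by (simp add: P_def)
  next
    fix n :: nat and g :: "nat \<Rightarrow> 'p \<Rightarrow> complex"
    assume "\<And>i. (i, n) \<in> less_than \<Longrightarrow> P g i (g i)"
    then have gI: "\<exists>k. combination ?B F k (g i)" if "i < n" for i using that by (auto simp: P_def I_def)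
    let ?R = "\<lambda>f. f \<in> I \<and> \<not> combination ?B g n f"
    obtain k f where "combination ?B F k f" "\<not> combination ?B g n f"
      by (rule combination_bad_sequence[OF F(2) gI])
    then have "?R f" unfolding I_def by blast
    then have "?R (arg_min deg ?R)" "\<And>f'. ?R f' \<Longrightarrow> deg (arg_min deg ?R) \<le> deg f'"
      using arg_min_nat_lemma[of ?R f deg] by blast+
    then show "\<exists>f. P g n f" unfolding P_def by blast
  qed simp
  then obtain g where g: "\<And>n. P g n (g n)" by blast
  have gI: "g n \<in> I" "\<not> combination ?B g n (g n)" for n using g[of n] by (auto simp: P_def)
  have dpos: "deg (g n) \<noteq> 0" for n
  proof
    assume "deg (g n) = 0"
    then have "g n = (\<lambda>_. 0)" using deg[OF IB[OF gI(1)[of n]]] by simp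
    then show False using gI(2)[of n] combination_zero[of "insert \<phi> \<Phi>" g n] by metis
  qed
  \<comment> \<open>\<open>deg\<close> is a strict bound, so the exponent of the leading power is
    one less.\<close>
  define e where "e n = deg (g n) - 1" for n
  have de: "deg (g n) = Suc (e n)" for n using dpos[of n] by (simp add: e_def)
  let ?ok = "\<lambda>n p. fst p \<in> ?A \<and> snd p \<in> deg_below ?A \<phi> (e n) \<and> g n = (\<lambda>x. fst p x * \<phi> x ^ e n + snd p x)"
  have "\<exists>p. ?ok n p" for n
  proof -
    have "g n \<in> deg_below ?A \<phi> (Suc (e n))" using deg[OF IB[OF gI(1)[of n]]] unfolding de .
    then obtain a h where ah: "a \<in> ?A" "h \<in> deg_below ?A \<phi> (e n)" "g n = (\<lambda>x. a x * \<phi> x ^ e n + h x)"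
      by (rule deg_below_SucE)
    have "?ok n (a, h)" unfolding fst_conv snd_conv using ah by (intro conjI)
    then show ?thesis ..
  qed
  then have "\<forall>n. \<exists>p. ?ok n p" ..
  then have "\<exists>p. \<forall>n. ?ok n (p n)" by (rule choice)
  then obtain p where p: "\<forall>n. ?ok n (p n)" ..
  define a h where "a n = fst (p n)" and "h n = snd (p n)" for n
  have ah: "\<And>n. a n \<in> ?A" "\<And>n. h n \<in> deg_below ?A \<phi> (e n)"
    "\<And>n. g n = (\<lambda>x. a n x * \<phi> x ^ e n + h n x)"
    using p by (simp_all add: a_def h_def)
  have "range a \<subseteq> ?A" using ah(1) by auto
  then obtain n r where r: "\<And>i. i < n \<Longrightarrow> r i \<in> ?A" "a n = (\<lambda>x. \<Sum>i<n. r i x * a i x)"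
    using noeth unfolding noetherian_funs_def combination_def by blast
  have e_le: "e i \<le> e n" if i: "i < n" for i
  proof -
    have "\<not> combination ?B g i (g n)"
    proof
      assume "combination ?B g i (g n)"
      from combination_mono[OF this, of n] i gI(2) show False by simp
    qed
    then have "deg (g i) \<le> deg (g n)" using g[of i] gI(1) by (auto simp: P_def)
    then show ?thesis by (simp add: de)
  qed
  \<comment> \<open>The power of \<phi> lifts the leading term of \<open>g i\<close> to the exponent
    \<open>e n\<close>. Since \<open>e i\<close> is at most \<open>e n\<close>, the subtraction in
    the exponent is not truncated.\<close>
  define q where "q i x = r i x * \<phi> x ^ (e n - e i)" for i x
  have phiB: "(\<lambda>x. \<phi> x ^ d) \<in> ?B" for d
    by (induction d) (auto intro: polyfuns.intros)
  have qB: "q i \<in> ?B" if "i < n" for i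
    unfolding q_def using AB[OF r(1)[OF that]] phiB by (intro polyfuns.mult)
  define f where "f x = g n x + (- 1) * (\<Sum>i<n. q i x * g i x)" for x
  have qg: "(\<lambda>x. \<Sum>i<n. q i x * g i x) \<in> I" using I_mult[OF gI(1) qB] by (intro I_sum) auto
  have neg: "(\<lambda>_. - 1) \<in> ?B" by (rule polyfuns.const) simp
  have fI: "f \<in> I" unfolding f_def by (rule I_add[OF gI(1) I_mult[OF qg neg]])
  have fnc: "\<not> combination ?B g n f"
  proof
    assume f: "combination ?B g n f"
    have "combination ?B g n (\<lambda>x. f x + (\<Sum>i<n. q i x * g i x))"
      using qB by (intro combination_add[OF f] combination_sum combination_mult combination_self) auto
    then show False using gI(2)[of n] by (simp add: f_def)
  qed
  have f_eq: "f = (\<lambda>x. h n x + (- 1) * (\<Sum>i<n. r i x * (\<phi> x ^ (e n - e i) * h i x)))"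
  proof
    fix x
    have "(\<Sum>i<n. q i x * g i x) = (\<Sum>i<n. r i x * a i x * \<phi> x ^ e n + r i x * (\<phi> x ^ (e n - e i) * h i x))"
    proof (rule sum.cong[OF refl])
      fix i assume "i \<in> {..<n}"
      then have "\<phi> x ^ e n = \<phi> x ^ (e n - e i) * \<phi> x ^ e i" using e_le by (simp flip: power_add)
      then show "q i x * g i x = r i x * a i x * \<phi> x ^ e n + r i x * (\<phi> x ^ (e n - e i) * h i x)"
        by (simp add: q_def ah(3) algebra_simps)
    qed
    also have "\<dots> = a n x * \<phi> x ^ e n + (\<Sum>i<n. r i x * (\<phi> x ^ (e n - e i) * h i x))"
      by (simp add: sum.distrib r(2) sum_distrib_right)
    finally show "f x = h n x + (- 1) * (\<Sum>i<n. r i x * (\<phi> x ^ (e n - e i) * h i x))"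
      by (simp add: f_def ah(3))
  qed
  have "(\<lambda>x. h n x + (- 1) * (\<Sum>i<n. r i x * (\<phi> x ^ (e n - e i) * h i x))) \<in> deg_below ?A \<phi> (e n)"
  proof (intro deg_below_add ah deg_below_mult[where a = "\<lambda>_. - 1"] deg_below_sum)
    fix i assume i: "i \<in> {..<n}"
    have "(\<lambda>x. \<phi> x ^ (e n - e i) * h i x) \<in> deg_below ?A \<phi> (e n)"
      using deg_below_shift_power[OF ah(2)[of i], of "e n - e i"] e_le i by simp
    then show "(\<lambda>x. r i x * (\<phi> x ^ (e n - e i) * h i x)) \<in> deg_below ?A \<phi> (e n)"
      by (rule deg_below_mult) (use r(1) i in auto)
  qed (auto intro: polyfuns.const)
  then have "f \<in> deg_below ?A \<phi> (e n)" using f_eq by simp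
  then have "deg f \<le> e n" by (rule deg_le)
  moreover have "deg (g n) \<le> deg f" using g[of n] fI fnc by (auto simp: P_def)
  ultimately show False by (simp add: de)
qed

lemma noetherian_polyfuns:
  assumes "finite \<Phi>"
  shows "noetherian_funs (polyfuns UNIV \<Phi>)"
  using assms
proof induction
  case empty
  have const: "\<exists>c. f = (\<lambda>_. c)" if "f \<in> polyfuns UNIV {}" for f :: "'a \<Rightarrow> complex"
    using that by induction (auto simp: fun_eq_iff)
  show ?case unfolding noetherian_funs_def
  proof (intro allI impI)
    fix g :: "nat \<Rightarrow> 'a \<Rightarrow> complex" assume "range g \<subseteq> polyfuns UNIV {}"
    then obtain c d where cd: "g 0 = (\<lambda>_. c)" "g 1 = (\<lambda>_. d)" using const by (meson range_subsetD)
    show "\<exists>n. combination (polyfuns UNIV {}) g n (g n)"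
    proof (cases "c = 0")
      case True
      then show ?thesis using cd combination_zero by metis
    next
      case False
      have "combination (polyfuns UNIV {}) g 1 (\<lambda>x. (\<lambda>_. d / c) x * g 0 x)"
        by (intro combination_mult combination_self polyfuns.const) auto
      then show ?thesis using False cd by (intro exI[of _ 1]) simp
    qed
  qed
qed (rule noetherian_polyfuns_insert)

section \<open>Algebraic subsets, descending chains and irreducible pieces\<close>

lemma algebraic_subset_empty: "algebraic_subset X \<Phi> {}"
  unfolding algebraic_subset_def zero_set_def
  by (rule exI[of _ "{\<lambda>_. 1}"]) (auto intro: polyfuns.const)

lemma algebraic_subset_Un:
  assumes "algebraic_subset X \<Phi> A" "algebraic_subset X \<Phi> B"
  shows "algebraic_subset X \<Phi> (A \<union> B)"
proof -
  obtain P Q where P: "P \<subseteq> polyfuns UNIV \<Phi>" "A = zero_set X P"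
    and Q: "Q \<subseteq> polyfuns UNIV \<Phi>" "B = zero_set X Q"
    using assms by (auto simp: algebraic_subset_def)
  have "A \<union> B = zero_set X {\<lambda>x. p x * q x |p q. p \<in> P \<and> q \<in> Q}"
    unfolding P(2) Q(2) zero_set_def
  proof (intro equalityI subsetI)
    fix x assume x: "x \<in> {x \<in> X. \<forall>f\<in>{\<lambda>x. p x * q x |p q. p \<in> P \<and> q \<in> Q}. f x = 0}"
    have "p x * q x = 0" if "p \<in> P" "q \<in> Q" for p q
    proof -
      have "(\<lambda>x. p x * q x) \<in> {\<lambda>x. p x * q x |p q. p \<in> P \<and> q \<in> Q}" using that by blast
      then show ?thesis using x by fast
    qed
    then have "(\<forall>p\<in>P. p x = 0) \<or> (\<forall>q\<in>Q. q x = 0)" by auto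
    then show "x \<in> {x \<in> X. \<forall>p\<in>P. p x = 0} \<union> {x \<in> X. \<forall>p\<in>Q. p x = 0}" using x by blast
  qed auto
  moreover have "{\<lambda>x. p x * q x |p q. p \<in> P \<and> q \<in> Q} \<subseteq> polyfuns UNIV \<Phi>"
    using P(1) Q(1) by (auto intro: polyfuns.mult)
  ultimately show ?thesis unfolding algebraic_subset_def by blast
qed

lemma algebraic_subset_Int:
  assumes "algebraic_subset X \<Phi> A" "algebraic_subset X \<Phi> B"
  shows "algebraic_subset X \<Phi> (A \<inter> B)"
proof -
  obtain P Q where P: "P \<subseteq> polyfuns UNIV \<Phi>" "A = zero_set X P"
    and Q: "Q \<subseteq> polyfuns UNIV \<Phi>" "B = zero_set X Q"
    using assms by (auto simp: algebraic_subset_def)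
  then have "A \<inter> B = zero_set X (P \<union> Q)" by (auto simp: zero_set_def)
  then show ?thesis unfolding algebraic_subset_def using P(1) Q(1) by (metis Un_least)
qed

lemma algebraic_subset_Union:
  "finite \<C> \<Longrightarrow> (\<And>Z. Z \<in> \<C> \<Longrightarrow> algebraic_subset X \<Phi> Z) \<Longrightarrow> algebraic_subset X \<Phi> (\<Union> \<C>)"
  by (induction \<C> rule: finite_induct) (auto intro: algebraic_subset_empty algebraic_subset_Un)

lemma irreducible_subset_Union:
  assumes Z: "irreducible_subset X \<Phi> Z"
    and "finite \<C>" "\<And>A. A \<in> \<C> \<Longrightarrow> algebraic_subset X \<Phi> A" "Z \<subseteq> \<Union> \<C>"
  shows "\<exists>A\<in>\<C>. Z \<subseteq> A"
  using assms(2-)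
proof (induction \<C> rule: finite_induct)
  case empty
  then show ?case using Z by (auto simp: irreducible_subset_def)
next
  case (insert A \<C>)
  have "algebraic_subset X \<Phi> (Z \<inter> A)" "algebraic_subset X \<Phi> (Z \<inter> \<Union> \<C>)"
    using Z insert algebraic_subset_Union[of \<C>]
    by (auto simp: irreducible_subset_def intro!: algebraic_subset_Int)
  moreover have "Z = (Z \<inter> A) \<union> (Z \<inter> \<Union> \<C>)" using insert.prems(2) by auto
  ultimately have "Z = Z \<inter> A \<or> Z = Z \<inter> \<Union> \<C>" using Z unfolding irreducible_subset_def by blast
  then show ?case using insert.IH insert.prems(1) by auto
qed

text \<open>Along a strictly descending chain there are functions \<open>f i\<close> that vanish on
  the next set but not on the present one. Some \<open>f n\<close> is a combination of earlier ones,
  all of which vanish on \<open>Z n\<close>: a contradiction.\<close>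

lemma algebraic_subset_wf:
  assumes "noetherian_funs (polyfuns UNIV \<Phi>)"
  shows "wf {(Y, Z). algebraic_subset X \<Phi> Y \<and> algebraic_subset X \<Phi> Z \<and> Y \<subset> Z}"
  unfolding wf_iff_no_infinite_down_chain
proof
  assume "\<exists>Z. \<forall>i. (Z (Suc i), Z i) \<in> {(Y, Z). algebraic_subset X \<Phi> Y \<and> algebraic_subset X \<Phi> Z \<and> Y \<subset> Z}"
  then obtain Z where "\<forall>i. (Z (Suc i), Z i) \<in> {(Y, Z). algebraic_subset X \<Phi> Y \<and> algebraic_subset X \<Phi> Z \<and> Y \<subset> Z}" ..
  then have Z: "\<And>i. algebraic_subset X \<Phi> (Z i)" "\<And>i. Z (Suc i) \<subset> Z i" by simp_all
  have "\<exists>f\<in>polyfuns UNIV \<Phi>. (\<forall>x\<in>Z (Suc i). f x = 0) \<and> (\<exists>x\<in>Z i. f x \<noteq> 0)" for i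
  proof -
    obtain P where P: "P \<subseteq> polyfuns UNIV \<Phi>" "Z (Suc i) = zero_set X P"
      using Z(1)[of "Suc i"] by (auto simp: algebraic_subset_def)
    obtain x where x: "x \<in> Z i" "x \<notin> Z (Suc i)" using Z(2)[of i] by blast
    have "x \<in> X" using Z(1)[of i] x by (auto simp: algebraic_subset_def zero_set_def)
    then obtain p where "p \<in> P" "p x \<noteq> 0" using x P by (auto simp: zero_set_def)
    then show ?thesis using P x by (intro bexI[of _ p]) (auto simp: zero_set_def)
  qed
  then have "\<exists>f. \<forall>i. f i \<in> polyfuns UNIV \<Phi> \<and> (\<forall>x\<in>Z (Suc i). f i x = 0) \<and> (\<exists>x\<in>Z i. f i x \<noteq> 0)"
    by (intro choice allI) blast
  then obtain f where f: "\<And>i. f i \<in> polyfuns UNIV \<Phi>" "\<And>i x. x \<in> Z (Suc i) \<Longrightarrow> f i x = 0"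
    "\<And>i. \<exists>x\<in>Z i. f i x \<noteq> 0" by blast
  obtain n r where "f n = (\<lambda>x. \<Sum>i<n. r i x * f i x)"
    using assms f(1) unfolding noetherian_funs_def combination_def by (metis image_subsetI)
  moreover have "Z n \<subseteq> Z (Suc i)" if "i < n" for i
    using lift_Suc_antimono_le[of Z "Suc i" n] Z(2) that by (simp add: psubset_imp_subset)
  ultimately have "f n x = 0" if "x \<in> Z n" for x
  proof -
    have "f i x = 0" if "i < n" for i using \<open>\<And>i. i < n \<Longrightarrow> Z n \<subseteq> Z (Suc i)\<close>[OF that] \<open>x \<in> Z n\<close> f(2) by blast
    then have "(\<Sum>i<n. r i x * f i x) = 0" by (intro sum.neutral) simp
    then show ?thesis using fun_cong[OF \<open>f n = (\<lambda>x. \<Sum>i<n. r i x * f i x)\<close>, of x] by simp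
  qed
  then show False using f(3)[of n] by auto
qed

lemma irreducible_decomposition:
  assumes "noetherian_funs (polyfuns UNIV \<Phi>)" "algebraic_subset X \<Phi> Z"
  shows "\<exists>\<C>. finite \<C> \<and> (\<forall>A\<in>\<C>. irreducible_subset X \<Phi> A) \<and> Z = \<Union> \<C>"
  using algebraic_subset_wf[OF assms(1), of X] assms(2)
proof (induction Z rule: wf_induct_rule)
  case (less Z)
  show ?case
  proof (cases "Z = {} \<or> irreducible_subset X \<Phi> Z")
    case True
    then show ?thesis
    proof
      assume "Z = {}" then show ?thesis by (intro exI[of _ "{}"]) auto
    next
      assume "irreducible_subset X \<Phi> Z" then show ?thesis by (intro exI[of _ "{Z}"]) auto
    qed
  next
    case False
    then obtain A B where AB: "algebraic_subset X \<Phi> A" "algebraic_subset X \<Phi> B" "Z = A \<union> B" "Z \<noteq> A" "Z \<noteq> B"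
      using less.prems unfolding irreducible_subset_def by blast
    then obtain \<C> \<D> where "finite \<C>" "\<forall>A\<in>\<C>. irreducible_subset X \<Phi> A" "A = \<Union> \<C>"
      "finite \<D>" "\<forall>A\<in>\<D>. irreducible_subset X \<Phi> A" "B = \<Union> \<D>"
      using less.IH[of A] less.IH[of B] less.prems by auto
    then show ?thesis using AB(3) by (intro exI[of _ "\<C> \<union> \<D>"]) auto
  qed
qed

text \<open>A component lies in one of the finitely many irreducible pieces of the whole space and
  equals it by maximality.\<close>

lemma finite_irreducible_components:
  assumes "noetherian_funs (polyfuns UNIV \<Phi>)"
  shows "finite (irreducible_components X \<Phi>)"
proof -
  have X: "algebraic_subset X \<Phi> X"
    unfolding algebraic_subset_def by (rule exI[of _ "{}"]) (auto simp: zero_set_def)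
  obtain \<C> where C: "finite \<C>" "\<forall>A\<in>\<C>. irreducible_subset X \<Phi> A" "X = \<Union> \<C>"
    using irreducible_decomposition[OF assms X] by metis
  have "irreducible_components X \<Phi> \<subseteq> \<C>"
  proof
    fix Z assume Z: "Z \<in> irreducible_components X \<Phi>"
    then have irr: "irreducible_subset X \<Phi> Z" by (simp add: irreducible_components_def)
    then have "Z \<subseteq> \<Union> \<C>" using C(3) by (auto simp: irreducible_subset_def algebraic_subset_def zero_set_def)
    then obtain A where "A \<in> \<C>" "Z \<subseteq> A"
      using irreducible_subset_Union[OF irr C(1)] C(2) by (auto simp: irreducible_subset_def)
    then show "Z \<in> \<C>" using Z C(2) by (auto simp: irreducible_components_def)
  qed
  then show ?thesis using C(1) finite_subset by blast
qed

lemma polyfuns_eq_cong: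
  assumes "\<And>f. f \<in> polyfuns UNIV \<Phi> \<Longrightarrow> \<exists>g\<in>polyfuns UNIV \<Psi>. \<forall>x\<in>X. f x = g x"
  shows "algebraic_subset X \<Phi> Z \<Longrightarrow> algebraic_subset X \<Psi> Z"
proof -
  assume "algebraic_subset X \<Phi> Z"
  then obtain P where P: "P \<subseteq> polyfuns UNIV \<Phi>" "Z = zero_set X P" by (auto simp: algebraic_subset_def)
  then obtain g where g: "\<And>f. f \<in> P \<Longrightarrow> g f \<in> polyfuns UNIV \<Psi>" "\<And>f x. f \<in> P \<Longrightarrow> x \<in> X \<Longrightarrow> f x = g f x"
    using assms by (metis subsetD)
  have "Z = zero_set X (g ` P)" using g(2) by (auto simp: P(2) zero_set_def)
  then show ?thesis using g(1) unfolding algebraic_subset_def by blast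
qed

section \<open>The fundamental group\<close>

lemma path_class_eqI: "homotopic_paths N p q \<Longrightarrow> path_class N p = path_class N q"
  unfolding path_class_def by (auto intro: homotopic_paths_trans homotopic_paths_sym)

text \<open>\<open>class_join\<close> is a union over all representatives; it is a single homotopy
  class because every pair of representatives contributes the same one.\<close>

lemma class_join_path_class:
  assumes p: "path p" "path_image p \<subseteq> N" and q: "path q" "path_image q \<subseteq> N"
    and pq: "pathfinish p = pathstart q"
  shows "class_join N (path_class N p) (path_class N q) = path_class N (p +++ q)"
proof -
  have "path_class N (p' +++ q') = path_class N (p +++ q)"
    if "p' \<in> path_class N p" "q' \<in> path_class N q" for p' q'
    using that pq by (intro path_class_eqI[symmetric] homotopic_paths_join) (auto simp: path_class_def)
  moreover have "p \<in> path_class N p" "q \<in> path_class N q" using p q by (auto simp: path_class_def)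
  ultimately show ?thesis unfolding class_join_def by blast
qed

lemma group_fundamental_group:
  assumes x0: "x0 \<in> N"
  shows "group (fundamental_group N x0)" (is "group ?G")
proof -
  define L where "L = {p. path p \<and> path_image p \<subseteq> N \<and> pathstart p = x0 \<and> pathfinish p = x0}"
  have carr: "carrier ?G = path_class N ` L" by (simp add: fundamental_group_def L_def)
  have join: "path_class N p \<otimes>\<^bsub>?G\<^esub> path_class N q = path_class N (p +++ q)" if "p \<in> L" "q \<in> L" for p q
    using that class_join_path_class[of p N q] by (simp add: fundamental_group_def L_def)
  have L_join: "p +++ q \<in> L" if "p \<in> L" "q \<in> L" for p q
    using that by (simp add: L_def subset_path_image_join)
  have const: "(\<lambda>_. x0) \<in> L"
    using x0 by (auto simp: L_def path_def path_image_def pathstart_def pathfinish_def)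
  have one: "\<one>\<^bsub>?G\<^esub> = path_class N (\<lambda>_. x0)" by (simp add: fundamental_group_def)
  have L_rev: "reversepath p \<in> L" if "p \<in> L" for p using that by (simp add: L_def)
  have lid: "path_class N ((\<lambda>_. x0) +++ p) = path_class N p" if p: "p \<in> L" for p
  proof (rule path_class_eqI[symmetric])
    have p': "path p" "path_image p \<subseteq> N" "p 0 = x0" using p by (auto simp: L_def pathstart_def)
    \<comment> \<open>Prefixing the constant loop is a reparametrisation that waits at the base
      point during the first half.\<close>
    have "continuous_on {0..1::real} (\<lambda>t. max 0 (2 * t - 1))" by (intro continuous_intros)
    moreover have "((\<lambda>_. x0) +++ p) t = p (max 0 (2 * t - 1))" for t
      by (cases "t \<le> 1 / 2") (auto simp: joinpaths_def p')
    ultimately show "homotopic_paths N p ((\<lambda>_. x0) +++ p)"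
      using p' by (intro homotopic_paths_reparametrize[where f = "\<lambda>t. max 0 (2 * t - 1)"]) auto
  qed
  have linv: "path_class N (reversepath p +++ p) = path_class N (\<lambda>_. x0)" if p: "p \<in> L" for p
  proof (rule path_class_eqI[symmetric])
    have p': "continuous_on {0..1} p" "p ` {0..1} \<subseteq> N" "p 0 = x0" "p 1 = x0"
      using p by (auto simp: L_def path_def path_image_def pathstart_def pathfinish_def)
    \<comment> \<open>At stage s the loop runs back along \<open>p\<close> from its end to the
      parameter 1 - s and returns: constant for s = 0, the reversed path followed by
      \<open>p\<close> for s = 1.\<close>
    define h where "h y = p (1 - fst y * (1 - \<bar>2 * snd y - 1\<bar>))" for y :: "real \<times> real"
    have r: "1 - s * (1 - \<bar>2 * t - 1\<bar>) \<in> {0..1}" if "s \<in> {0..1}" "t \<in> {0..1}" for s t :: real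
    proof -
      have "0 \<le> 1 - \<bar>2 * t - 1\<bar>" "1 - \<bar>2 * t - 1\<bar> \<le> 1" using that(2) by auto
      then have "0 \<le> s * (1 - \<bar>2 * t - 1\<bar>)" "s * (1 - \<bar>2 * t - 1\<bar>) \<le> 1"
        using that(1) by (auto intro: mult_le_one)
      then show ?thesis by auto
    qed
    have cont: "continuous_on ({0..1} \<times> {0..1}) h"
      unfolding h_def by (rule continuous_on_compose2[OF p'(1)]) (auto intro!: continuous_intros r[simplified])
    have im: "h \<in> {0..1} \<times> {0..1} \<rightarrow> N"
      using p'(2) r unfolding h_def by fastforce
    show "homotopic_paths N (\<lambda>_. x0) (reversepath p +++ p)"
      unfolding homotopic_paths
    proof (intro exI[of _ h] conjI)
      show "continuous_on ({0..1} \<times> {0..1}) h" "h \<in> {0..1} \<times> {0..1} \<rightarrow> N" by fact+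
    qed (auto simp: h_def p' pathstart_def pathfinish_def joinpaths_def reversepath_def abs_if algebra_simps)
  qed
  show ?thesis
  proof (rule groupI)
    fix x y assume "x \<in> carrier ?G" "y \<in> carrier ?G"
    then show "x \<otimes>\<^bsub>?G\<^esub> y \<in> carrier ?G" using join L_join by (auto simp: carr)
  next
    show "\<one>\<^bsub>?G\<^esub> \<in> carrier ?G" using const by (auto simp: carr one)
  next
    fix x y z assume "x \<in> carrier ?G" "y \<in> carrier ?G" "z \<in> carrier ?G"
    then obtain p q r where pqr: "p \<in> L" "q \<in> L" "r \<in> L"
      "x = path_class N p" "y = path_class N q" "z = path_class N r" by (auto simp: carr)
    have "homotopic_paths N (p +++ (q +++ r)) ((p +++ q) +++ r)"
      using pqr by (intro homotopic_paths_assoc) (auto simp: L_def)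
    then show "x \<otimes>\<^bsub>?G\<^esub> y \<otimes>\<^bsub>?G\<^esub> z = x \<otimes>\<^bsub>?G\<^esub> (y \<otimes>\<^bsub>?G\<^esub> z)"
      using pqr by (simp add: join L_join path_class_eqI)
  next
    fix x assume "x \<in> carrier ?G"
    then obtain p where p: "p \<in> L" "x = path_class N p" by (auto simp: carr)
    show "\<one>\<^bsub>?G\<^esub> \<otimes>\<^bsub>?G\<^esub> x = x" using p by (simp add: one join const lid)
    show "\<exists>y\<in>carrier ?G. y \<otimes>\<^bsub>?G\<^esub> x = \<one>\<^bsub>?G\<^esub>"
      using p L_rev by (intro bexI[of _ "path_class N (reversepath p)"]) (auto simp: carr one join linv)
  qed
qed

section \<open>Traces of matrices of determinant one\<close>

lemma trace_2: "trace (A :: complex ^ 2 ^ 2) = A $ 1 $ 1 + A $ 2 $ 2"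
  by (simp add: trace_def sum_2)

lemma matrix_mult_2: "((A :: complex ^ 2 ^ 2) ** B) $ i $ j = A $ i $ 1 * B $ 1 $ j + A $ i $ 2 * B $ 2 $ j"
  by (simp add: matrix_matrix_mult_def sum_2)

text \<open>The trace of the Cayley-Hamilton equation of \<open>A\<close> after multiplication by
  \<open>X\<close>.\<close>

lemma trace_square:
  assumes "det (A :: complex ^ 2 ^ 2) = 1"
  shows "trace (X ** (A ** A)) = trace A * trace (X ** A) - trace X"
proof -
  have "trace (X ** (A ** A)) = trace A * trace (X ** A) - det A * trace X"
    unfolding trace_2 matrix_mult_2 det_2 by (simp add: algebra_simps power2_eq_square)
  then show ?thesis using assms by simp
qed

text \<open>The same with the polarised Cayley-Hamilton equation, which expresses AB + BA through A,
  B and scalars.\<close>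

lemma trace_swap:
  fixes A B X :: "complex ^ 2 ^ 2"
  shows "trace (X ** (A ** B)) + trace (X ** (B ** A)) =
    trace A * trace (X ** B) + trace B * trace (X ** A) + (trace (A ** B) - trace A * trace B) * trace X"
  unfolding trace_2 matrix_mult_2 by (simp add: algebra_simps power2_eq_square)

text \<open>The corner entries of \<open>d X\<close> in a basis of eigenvectors of \<open>A\<close>, for the eigenvalue \<open>u\<close>;
  here \<open>d\<close> is the difference of the eigenvalues.\<close>

lemma eigenbasis_entries:
  fixes A :: "complex ^ 2 ^ 2"
  assumes "det A = 1" "u ^ 2 = trace A * u - 1"
  defines "d \<equiv> 2 * u - trace A"
  obtains L M B C :: "complex ^ 2 ^ 2 \<Rightarrow> complex" where
    "\<And>X. L X = trace (A ** X) - (trace A - u) * trace X"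
    "\<And>X. M X = d * trace X - L X"
    "\<And>X Y. d * L (X ** Y) = L X * L Y + B X * C Y"
    "\<And>X Y. d * B (X ** Y) = L X * B Y + B X * M Y"
    "\<And>X Y. d * C (X ** Y) = C X * L Y + M X * C Y"
    "\<And>X Y. d * M (X ** Y) = C X * B Y + M X * M Y"
    "\<And>X. L X * M X - B X * C X = d ^ 2 * det X"
proof -
  define L where "L X = trace (A ** X) - (trace A - u) * trace X" for X
  define M where "M X = d * trace X - L X" for X
  define a b c e where abce: "a = A $ 1 $ 1 - (trace A - u)" "b = A $ 1 $ 2" "c = A $ 2 $ 1"
    "e = A $ 2 $ 2 - (trace A - u)"
  have d: "d = a + e" by (simp add: d_def abce trace_2)
  have "a * e - b * c = det A - u * trace A + u ^ 2"
    unfolding abce det_2 trace_2 by (simp add: algebra_simps power2_eq_square)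
  then have ae: "a * e = b * c" using assms(1,2) by (simp add: algebra_simps)
  \<comment> \<open>\<open>trace A - u\<close> is the other eigenvalue, so subtracting it from
    \<open>A\<close> leaves a singular matrix. It factors as a column p times a row q, where p is an
    eigenvector for \<open>u\<close>.\<close>
  have "\<exists>p1 p2 q1 q2. a = p1 * q1 \<and> b = p1 * q2 \<and> c = p2 * q1 \<and> e = p2 * q2"
  proof (cases "a = 0")
    case False
    then show ?thesis using ae by (intro exI[of _ 1] exI[of _ "c / a"] exI[of _ a] exI[of _ b]) (auto simp: field_simps)
  next
    case True
    then have "b = 0 \<or> c = 0" using ae by simp
    then show ?thesis
    proof
      assume "b = 0"
      then show ?thesis using True by (intro exI[of _ 0] exI[of _ 1] exI[of _ c] exI[of _ e]) auto
    next
      assume "c = 0"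
      then show ?thesis using True by (intro exI[of _ b] exI[of _ e] exI[of _ 0] exI[of _ 1]) auto
    qed
  qed
  then obtain p1 p2 q1 q2 where pq: "a = p1 * q1" "b = p1 * q2" "c = p2 * q1" "e = p2 * q2" by blast
  have A: "A $ 1 $ 1 = a + (trace A - u)" "A $ 1 $ 2 = b" "A $ 2 $ 1 = c" "A $ 2 $ 2 = e + (trace A - u)"
    by (simp_all add: abce)
  have L: "L X = q1 * (X $ 1 $ 1 * p1 + X $ 1 $ 2 * p2) + q2 * (X $ 2 $ 1 * p1 + X $ 2 $ 2 * p2)" for X
    unfolding L_def trace_2[of "A ** X"] trace_2[of X] matrix_mult_2 A pq by (simp add: algebra_simps power2_eq_square)
  have M: "M X = p2 * (X $ 1 $ 1 * q2 - X $ 1 $ 2 * q1) - p1 * (X $ 2 $ 1 * q2 - X $ 2 $ 2 * q1)" for X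
    unfolding M_def L d pq trace_2[of X] by (simp add: algebra_simps power2_eq_square)
  \<comment> \<open>With the row p' = (p2, -p1) and the column q' = (q2, -q1), the four entries are
    L X = q X p, B X = q X q', C X = p' X p and M X = p' X q'. The product formulas below express
    that p q + q' p' is \<open>d\<close> times the identity.\<close>
  define B where "B X = q1 * (X $ 1 $ 1 * q2 - X $ 1 $ 2 * q1) + q2 * (X $ 2 $ 1 * q2 - X $ 2 $ 2 * q1)"
    for X :: "complex ^ 2 ^ 2"
  define C where "C X = p2 * (X $ 1 $ 1 * p1 + X $ 1 $ 2 * p2) - p1 * (X $ 2 $ 1 * p1 + X $ 2 $ 2 * p2)"
    for X :: "complex ^ 2 ^ 2"
  show thesis
  proof (rule that[of L M B C])
    fix X Y
    show "L X = trace (A ** X) - (trace A - u) * trace X" "M X = d * trace X - L X"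
      by (fact L_def, fact M_def)
    show "d * L (X ** Y) = L X * L Y + B X * C Y"
      unfolding L B_def C_def d pq matrix_mult_2 by (simp add: algebra_simps power2_eq_square)
    show "d * B (X ** Y) = L X * B Y + B X * M Y"
      unfolding L M B_def C_def d pq matrix_mult_2 by (simp add: algebra_simps power2_eq_square)
    show "d * C (X ** Y) = C X * L Y + M X * C Y"
      unfolding L M B_def C_def d pq matrix_mult_2 by (simp add: algebra_simps power2_eq_square)
    show "d * M (X ** Y) = C X * B Y + M X * M Y"
      unfolding L M B_def C_def d pq matrix_mult_2 by (simp add: algebra_simps power2_eq_square)
    show "L X * M X - B X * C X = d ^ 2 * det X"
      unfolding L M B_def C_def d pq det_2 by (simp add: algebra_simps power2_eq_square)
  qed
qed

section \<open>Trace coordinates\<close>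

text \<open>Stated for an abstract group, as the trace algebra makes no use of the manifold.\<close>

definition sl2_characters :: "'g monoid \<Rightarrow> ('g \<Rightarrow> complex) set" where
  "sl2_characters G =
     (\<lambda>\<rho>. \<lambda>\<gamma>\<in>carrier G. trace (\<rho> \<gamma>)) ` (hom G SL2C \<inter> extensional (carrier G))"

lemma char_variety_eq: "char_variety N x0 = sl2_characters (fundamental_group N x0)"
  by (simp add: char_variety_def sl2_characters_def character_def[abs_def] rep_variety_def)

context
  fixes G :: "'g monoid" (structure)
  assumes group: "group G"
begin

interpretation group G by (rule group)

text \<open>\<open>SL2C\<close> enters as a bare monoid structure, so preservation of the unit is
  derived: the image of the unit is idempotent and, having determinant one, invertible.\<close>

lemma hom_SL2C:
  assumes \<rho>: "\<rho> \<in> hom G SL2C"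
  shows "\<And>a. a \<in> carrier G \<Longrightarrow> det (\<rho> a) = 1"
    and "\<And>a b. a \<in> carrier G \<Longrightarrow> b \<in> carrier G \<Longrightarrow> \<rho> (a \<otimes> b) = \<rho> a ** \<rho> b"
    and "\<rho> \<one> = mat 1"
proof -
  show det: "det (\<rho> a) = 1" if "a \<in> carrier G" for a
    using hom_in_carrier[OF \<rho> that] by (simp add: SL2C_def)
  show mult: "\<rho> (a \<otimes> b) = \<rho> a ** \<rho> b" if "a \<in> carrier G" "b \<in> carrier G" for a b
    using hom_mult[OF \<rho> that] by (simp add: SL2C_def)
  have "invertible (\<rho> \<one>)" using det[of \<one>] by (simp add: invertible_det_nz)
  then obtain B where B: "B ** \<rho> \<one> = mat 1" by (auto simp: invertible_def)
  have "\<rho> \<one> = B ** \<rho> \<one> ** \<rho> \<one>" by (simp add: B)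
  also have "\<dots> = B ** (\<rho> \<one> ** \<rho> \<one>)" by (simp only: matrix_mul_assoc)
  also have "\<rho> \<one> ** \<rho> \<one> = \<rho> \<one>" using mult[of \<one> \<one>] by simp
  finally show "\<rho> \<one> = mat 1" by (simp add: B)
qed

lemma sl2_charactersE:
  assumes "\<tau> \<in> sl2_characters G"
  obtains \<rho> where "\<rho> \<in> hom G SL2C" "\<And>a. a \<in> carrier G \<Longrightarrow> \<tau> a = trace (\<rho> a)"
proof -
  obtain \<rho> where "\<rho> \<in> hom G SL2C" "\<tau> = (\<lambda>\<gamma>\<in>carrier G. trace (\<rho> \<gamma>))"
    using assms by (auto simp: sl2_characters_def)
  then show thesis by (intro that[of \<rho>]) auto
qed

section \<open>Trace identities of a single character\<close>

context
  fixes \<tau> assumes \<tau>: "\<tau> \<in> sl2_characters G"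
begin

lemma character_one: "\<tau> \<one> = 2"
proof -
  obtain \<rho> where \<rho>: "\<rho> \<in> hom G SL2C" "\<And>a. a \<in> carrier G \<Longrightarrow> \<tau> a = trace (\<rho> a)"
    using \<tau> by (rule sl2_charactersE) blast
  show ?thesis by (simp add: \<rho>(2) hom_SL2C(3)[OF \<rho>(1)] trace_2 mat_def)
qed

lemma character_commute: "a \<in> carrier G \<Longrightarrow> b \<in> carrier G \<Longrightarrow> \<tau> (a \<otimes> b) = \<tau> (b \<otimes> a)"
proof -
  obtain \<rho> where \<rho>: "\<rho> \<in> hom G SL2C" "\<And>a. a \<in> carrier G \<Longrightarrow> \<tau> a = trace (\<rho> a)"
    using \<tau> by (rule sl2_charactersE) blast
  assume "a \<in> carrier G" "b \<in> carrier G"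
  then show ?thesis
    by (simp add: \<rho>(2) hom_SL2C(2)[OF \<rho>(1)] trace_mul_sym[of "\<rho> a"])
qed

lemma character_square:
  assumes "a \<in> carrier G" "x \<in> carrier G"
  shows "\<tau> (x \<otimes> (a \<otimes> a)) = \<tau> a * \<tau> (x \<otimes> a) - \<tau> x"
proof -
  obtain \<rho> where \<rho>: "\<rho> \<in> hom G SL2C" "\<And>a. a \<in> carrier G \<Longrightarrow> \<tau> a = trace (\<rho> a)"
    using \<tau> by (rule sl2_charactersE) blast
  show ?thesis using assms by (simp add: \<rho>(2) hom_SL2C[OF \<rho>(1)] trace_square)
qed

text \<open>\<open>character_square\<close> at the element \<open>x \<otimes> inv a\<close>, solved
  for its trace.\<close>

lemma character_inv:
  assumes "a \<in> carrier G" "x \<in> carrier G"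
  shows "\<tau> (x \<otimes> inv a) = \<tau> a * \<tau> x - \<tau> (x \<otimes> a)"
proof -
  have "\<tau> ((x \<otimes> inv a) \<otimes> (a \<otimes> a)) = \<tau> a * \<tau> ((x \<otimes> inv a) \<otimes> a) - \<tau> (x \<otimes> inv a)"
    using assms by (intro character_square) auto
  moreover have "(x \<otimes> inv a) \<otimes> a = x" using assms by (simp add: m_assoc)
  moreover have "(x \<otimes> inv a) \<otimes> (a \<otimes> a) = x \<otimes> a"
    using assms calculation(2) by (metis inv_closed m_assoc m_closed)
  ultimately show ?thesis by simp
qed

lemma character_swap:
  assumes "a \<in> carrier G" "b \<in> carrier G" "x \<in> carrier G"
  shows "\<tau> (x \<otimes> (a \<otimes> b)) + \<tau> (x \<otimes> (b \<otimes> a)) =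
    \<tau> a * \<tau> (x \<otimes> b) + \<tau> b * \<tau> (x \<otimes> a) + (\<tau> (a \<otimes> b) - \<tau> a * \<tau> b) * \<tau> x"
proof -
  obtain \<rho> where \<rho>: "\<rho> \<in> hom G SL2C" "\<And>a. a \<in> carrier G \<Longrightarrow> \<tau> a = trace (\<rho> a)"
    using \<tau> by (rule sl2_charactersE) blast
  show ?thesis using assms by (simp add: \<rho>(2) hom_SL2C[OF \<rho>(1)] trace_swap)
qed

end

definition rational_on ::
  "('g \<Rightarrow> complex) set \<Rightarrow> (('g \<Rightarrow> complex) \<Rightarrow> complex) set \<Rightarrow> (('g \<Rightarrow> complex) \<Rightarrow> complex) \<Rightarrow> bool" where
  "rational_on X \<Phi> F \<longleftrightarrow> (\<exists>f\<in>polyfuns \<rat> \<Phi>. \<forall>x\<in>X. F x = f x)"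

lemma rational_on_add: "rational_on X \<Phi> F \<Longrightarrow> rational_on X \<Phi> F' \<Longrightarrow> rational_on X \<Phi> (\<lambda>x. F x + F' x)"
proof -
  assume "rational_on X \<Phi> F" "rational_on X \<Phi> F'"
  then obtain f f' where "f \<in> polyfuns \<rat> \<Phi>" "f' \<in> polyfuns \<rat> \<Phi>" "\<forall>x\<in>X. F x = f x" "\<forall>x\<in>X. F' x = f' x"
    unfolding rational_on_def by blast
  then show ?thesis unfolding rational_on_def by (intro bexI[of _ "\<lambda>x. f x + f' x"]) (auto intro: polyfuns.add)
qed

lemma rational_on_mult: "rational_on X \<Phi> F \<Longrightarrow> rational_on X \<Phi> F' \<Longrightarrow> rational_on X \<Phi> (\<lambda>x. F x * F' x)"
proof -
  assume "rational_on X \<Phi> F" "rational_on X \<Phi> F'"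
  then obtain f f' where "f \<in> polyfuns \<rat> \<Phi>" "f' \<in> polyfuns \<rat> \<Phi>" "\<forall>x\<in>X. F x = f x" "\<forall>x\<in>X. F' x = f' x"
    unfolding rational_on_def by blast
  then show ?thesis unfolding rational_on_def by (intro bexI[of _ "\<lambda>x. f x * f' x"]) (auto intro: polyfuns.mult)
qed

lemma rational_on_const: "c \<in> \<rat> \<Longrightarrow> rational_on X \<Phi> (\<lambda>_. c)"
  unfolding rational_on_def by (intro bexI[of _ "\<lambda>_. c"]) (auto intro: polyfuns.const)

lemma rational_on_diff: "rational_on X \<Phi> F \<Longrightarrow> rational_on X \<Phi> F' \<Longrightarrow> rational_on X \<Phi> (\<lambda>x. F x - F' x)"
  using rational_on_add[of X \<Phi> F "\<lambda>x. (- 1) * F' x"] rational_on_mult[OF rational_on_const[of "- 1"]]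
  by fastforce

lemma rational_on_coord: "\<phi> \<in> \<Phi> \<Longrightarrow> rational_on X \<Phi> \<phi>"
  unfolding rational_on_def by (blast intro: polyfuns.coord)

lemma rational_on_cong: "rational_on X \<Phi> F \<Longrightarrow> (\<And>x. x \<in> X \<Longrightarrow> F x = F' x) \<Longrightarrow> rational_on X \<Phi> F'"
  unfolding rational_on_def by fastforce

context
  fixes gs :: "'g list"
  assumes gs: "set gs \<subseteq> carrier G"
begin

text \<open>The letter \<open>(True, i)\<close> stands for the inverse of the \<open>i\<close>-th generator.\<close>

definition letter :: "bool \<times> nat \<Rightarrow> 'g" where
  "letter l = (if fst l then inv (gs ! snd l) else gs ! snd l)"

definition word :: "(bool \<times> nat) list \<Rightarrow> 'g" where
  "word w = foldr (\<otimes>) (map letter w) \<one>"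

definition letters :: "(bool \<times> nat) set" where
  "letters = {l. snd l < length gs}"

definition coord_functions :: "(('g \<Rightarrow> complex) \<Rightarrow> complex) set" where
  "coord_functions = (\<lambda>J. trace_function (foldr (\<otimes>) (map ((!) gs) (sorted_list_of_set J)) \<one>)) ` coord_indices (length gs)"

lemma letter_closed: "l \<in> letters \<Longrightarrow> letter l \<in> carrier G"
  using subsetD[OF gs nth_mem] by (auto simp: letters_def letter_def)

lemma word_closed: "set w \<subseteq> letters \<Longrightarrow> word w \<in> carrier G"
  by (induction w) (auto simp: word_def letter_closed)

lemma word_Cons: "word (l # w) = letter l \<otimes> word w"
  by (simp add: word_def)

lemma word_append: "set u \<subseteq> letters \<Longrightarrow> set v \<subseteq> letters \<Longrightarrow> word (u @ v) = word u \<otimes> word v"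
proof (induction u)
  case Nil
  then show ?case using word_closed[of v] by (simp add: word_def)
next
  case (Cons l u)
  then show ?case using word_closed[of u] word_closed[of v] letter_closed[of l]
    by (simp add: word_Cons m_assoc)
qed

lemma generate_words: "\<gamma> \<in> generate G (set gs) \<Longrightarrow> \<exists>w. set w \<subseteq> letters \<and> \<gamma> = word w"
proof (induction rule: generate.induct)
  case one
  then show ?case by (intro exI[of _ "[]"]) (simp add: word_def)
next
  case (incl h)
  then obtain i where "i < length gs" "h = gs ! i" by (auto simp: in_set_conv_nth)
  then show ?case using subsetD[OF gs nth_mem] by (intro exI[of _ "[(False, i)]"]) (auto simp: word_def letter_def letters_def)
next
  case (inv h)
  then obtain i where "i < length gs" "h = gs ! i" by (auto simp: in_set_conv_nth)
  then show ?case using subsetD[OF gs nth_mem] by (intro exI[of _ "[(True, i)]"]) (auto simp: word_def letter_def letters_def)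
next
  case (eng h1 h2)
  then obtain u v where "set u \<subseteq> letters" "h1 = word u" "set v \<subseteq> letters" "h2 = word v" by blast
  then show ?case by (intro exI[of _ "u @ v"]) (auto simp: word_append)
qed

abbreviation "rational \<equiv> rational_on (sl2_characters G) coord_functions"
abbreviation "rational_word w \<equiv> rational (\<lambda>\<tau>. \<tau> (word w))"

lemma character_word_rotate:
  assumes "\<tau> \<in> sl2_characters G" "set u \<subseteq> letters" "set v \<subseteq> letters"
  shows "\<tau> (word (u @ v)) = \<tau> (word (v @ u))"
  using character_commute[OF assms(1)] word_closed assms by (simp add: word_append)

text \<open>Modulo polynomials in the traces of shorter words, inverting a letter and exchanging two
  neighbours both change the sign of the trace, and the trace of a word with a repeated letter
  vanishes. This reduces all words to the increasing ones.\<close>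

lemma rational_word_inverse:
  assumes IH: "\<And>w. set w \<subseteq> letters \<Longrightarrow> length w \<le> length u + length v \<Longrightarrow> rational_word w"
    and l: "i < length gs" "set u \<subseteq> letters" "set v \<subseteq> letters"
    and "rational (\<lambda>\<tau>. \<tau> (gs ! i))"
    and "rational_word (u @ (False, i) # v)"
  shows "rational_word (u @ (True, i) # v)"
proof -
  have lt: "(False, i) \<in> letters" "(True, i) \<in> letters" "letter (False, i) = gs ! i"
    "letter (True, i) = inv (gs ! i)" "gs ! i \<in> carrier G"
    using l gs by (auto simp: letters_def letter_def)
  have "rational (\<lambda>\<tau>. \<tau> (gs ! i) * \<tau> (word (v @ u)) - \<tau> (word (u @ (False, i) # v)))"
    using l by (intro rational_on_diff rational_on_mult assms IH) auto
  then show ?thesis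
  proof (rule rational_on_cong)
    fix \<tau> assume \<tau>: "\<tau> \<in> sl2_characters G"
    have rot: "\<tau> (word (u @ (b, i) # v)) = \<tau> (word (v @ u) \<otimes> letter (b, i))" for b
    proof -
      have bi: "(b, i) \<in> letters" using lt by (cases b) auto
      have "\<tau> (word (u @ (b, i) # v)) = \<tau> (word ((u @ [(b, i)]) @ v))" by simp
      also have "\<dots> = \<tau> (word (v @ (u @ [(b, i)])))"
        using character_word_rotate[OF \<tau>, of "u @ [(b, i)]" v] l bi by simp
      also have "word (v @ (u @ [(b, i)])) = word (v @ u) \<otimes> letter (b, i)"
        using l bi word_append[of "v @ u" "[(b, i)]"] letter_closed[OF bi] by (simp add: word_def)
      finally show ?thesis .
    qed
    show "\<tau> (gs ! i) * \<tau> (word (v @ u)) - \<tau> (word (u @ (False, i) # v)) = \<tau> (word (u @ (True, i) # v))"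
      unfolding rot lt using character_inv[OF \<tau> lt(5)] l word_closed[of "v @ u"] by simp
  qed
qed

text \<open>Traces are invariant under rotation of a word. This brings the letters of interest to
  its end, where the trace identities apply.\<close>

lemma rational_word_adjacent:
  assumes \<tau>: "\<tau> \<in> sl2_characters G" and l: "l \<in> letters" "l' \<in> letters" "set u \<subseteq> letters" "set v \<subseteq> letters"
  shows "\<tau> (word (u @ l # l' # v)) = \<tau> (word (v @ u) \<otimes> (letter l \<otimes> letter l'))"
    "\<tau> (word (u @ l # v)) = \<tau> (word (v @ u) \<otimes> letter l)"
    "\<tau> (word (u @ v)) = \<tau> (word (v @ u))"
proof -
  have "\<tau> (word (u @ l # l' # v)) = \<tau> (word ((u @ [l, l']) @ v))" by simp
  also have "\<dots> = \<tau> (word (v @ (u @ [l, l'])))"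
    using character_word_rotate[OF \<tau>, of "u @ [l, l']" v] l by simp
  also have "word (v @ (u @ [l, l'])) = word (v @ u) \<otimes> (letter l \<otimes> letter l')"
    using l word_append[of "v @ u" "[l, l']"] letter_closed by (simp add: word_def)
  finally show "\<tau> (word (u @ l # l' # v)) = \<tau> (word (v @ u) \<otimes> (letter l \<otimes> letter l'))" .
  have "\<tau> (word (u @ l # v)) = \<tau> (word ((u @ [l]) @ v))" by simp
  also have "\<dots> = \<tau> (word (v @ (u @ [l])))"
    using character_word_rotate[OF \<tau>, of "u @ [l]" v] l by simp
  also have "word (v @ (u @ [l])) = word (v @ u) \<otimes> letter l"
    using l word_append[of "v @ u" "[l]"] letter_closed by (simp add: word_def)
  finally show "\<tau> (word (u @ l # v)) = \<tau> (word (v @ u) \<otimes> letter l)" .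
  show "\<tau> (word (u @ v)) = \<tau> (word (v @ u))" using character_word_rotate[OF \<tau>] l by simp
qed

text \<open>In \<open>character_swap\<close> every term besides the two words is a product of traces
  of shorter words, except that for empty \<open>u\<close> and \<open>v\<close> the word
  \<open>[l, l']\<close> itself has full length. That case is the cyclic symmetry of the
  trace.\<close>

lemma rational_word_swap:
  assumes IH: "\<And>w. set w \<subseteq> letters \<Longrightarrow> length w < length u + length v + 2 \<Longrightarrow> rational_word w"
    and l: "l \<in> letters" "l' \<in> letters" "set u \<subseteq> letters" "set v \<subseteq> letters"
    and h: "rational_word (u @ l # l' # v)"
  shows "rational_word (u @ l' # l # v)"
proof (cases "u = [] \<and> v = []")
  case True
  show ?thesis using h
  proof (rule rational_on_cong)
    fix \<tau> assume "\<tau> \<in> sl2_characters G"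
    from character_word_rotate[OF this, of "[l]" "[l']"]
    show "\<tau> (word (u @ l # l' # v)) = \<tau> (word (u @ l' # l # v))" using True l by simp
  qed
next
  case False
  then have len: "2 < length u + length v + 2" by (cases u; cases v) auto
  have "rational (\<lambda>\<tau>. \<tau> (word [l]) * \<tau> (word (u @ l' # v)) + \<tau> (word [l']) * \<tau> (word (u @ l # v))
      + (\<tau> (word [l, l']) - \<tau> (word [l]) * \<tau> (word [l'])) * \<tau> (word (u @ v)) - \<tau> (word (u @ l # l' # v)))"
    using l len by (intro rational_on_diff rational_on_mult rational_on_add h IH) auto
  then show ?thesis
  proof (rule rational_on_cong)
    fix \<tau> assume \<tau>: "\<tau> \<in> sl2_characters G"
    have w: "word [l] = letter l" "word [l'] = letter l'" "word [l, l'] = letter l \<otimes> letter l'"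
      using l letter_closed by (auto simp: word_def)
    show "\<tau> (word [l]) * \<tau> (word (u @ l' # v)) + \<tau> (word [l']) * \<tau> (word (u @ l # v))
      + (\<tau> (word [l, l']) - \<tau> (word [l]) * \<tau> (word [l'])) * \<tau> (word (u @ v)) - \<tau> (word (u @ l # l' # v))
      = \<tau> (word (u @ l' # l # v))"
      using character_swap[OF \<tau> letter_closed[OF l(1)] letter_closed[OF l(2)] word_closed[of "v @ u"]] l
      unfolding w rational_word_adjacent[OF \<tau> l] rational_word_adjacent[OF \<tau> l(2,1,3,4)] by (simp add: algebra_simps)
  qed
qed

lemma rational_word_repeat:
  assumes IH: "\<And>w. set w \<subseteq> letters \<Longrightarrow> length w < length u + length v + 2 \<Longrightarrow> rational_word w"
    and l: "l \<in> letters" "set u \<subseteq> letters" "set v \<subseteq> letters"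
  shows "rational_word (u @ l # l # v)"
proof -
  have "rational (\<lambda>\<tau>. \<tau> (word [l]) * \<tau> (word (u @ l # v)) - \<tau> (word (u @ v)))"
    using l by (intro rational_on_diff rational_on_mult IH) auto
  then show ?thesis
  proof (rule rational_on_cong)
    fix \<tau> assume \<tau>: "\<tau> \<in> sl2_characters G"
    have w: "word [l] = letter l" using l letter_closed by (auto simp: word_def)
    show "\<tau> (word [l]) * \<tau> (word (u @ l # v)) - \<tau> (word (u @ v)) = \<tau> (word (u @ l # l # v))"
      using character_square[OF \<tau> letter_closed[OF l(1)] word_closed[of "v @ u"]] l
      unfolding w rational_word_adjacent[OF \<tau> l(1,1,2,3)] by simp
  qed
qed

lemma rational_word_sorted_positive:
  assumes "set w \<subseteq> letters" "\<forall>l\<in>set w. \<not> fst l" "sorted (map snd w)" "distinct w"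
  shows "rational_word w"
proof (cases "w = []")
  case True
  have "rational (\<lambda>_. 2)" by (rule rational_on_const) simp
  then show ?thesis by (rule rational_on_cong) (simp add: True word_def character_one)
next
  case False
  define J where "J = set (map snd w)"
  have inj: "inj_on snd (set w)" using assms(2) by (auto intro!: inj_onI prod_eqI)
  then have "sorted_list_of_set J = map snd w"
    unfolding J_def using assms(3,4)
    by (intro sorted_list_of_set.idem_if_sorted_distinct) (auto simp: distinct_map)
  moreover have "map ((!) gs) (map snd w) = map letter w"
    using assms(2) by (auto simp: letter_def)
  ultimately have "foldr (\<otimes>) (map ((!) gs) (sorted_list_of_set J)) \<one> = word w"
    by (simp only: word_def)
  moreover have "J \<in> coord_indices (length gs)"
    using assms(1) False by (auto simp: J_def coord_indices_def letters_def)
  ultimately have "trace_function (word w) \<in> coord_functions"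
    unfolding coord_functions_def by (intro image_eqI[where x = J]) (simp_all only:)
  then have "rational (trace_function (word w))" by (rule rational_on_coord)
  then show ?thesis by (simp add: trace_function_def)
qed

text \<open>Insertion is undone by adjacent exchanges: \<open>l\<close> travels back to the front of
  \<open>v\<close> one place at a time, each exchange costing only shorter words.\<close>

lemma rational_word_insort:
  assumes IH: "\<And>w. set w \<subseteq> letters \<Longrightarrow> length w < length u + length v + 1 \<Longrightarrow> rational_word w"
    and l: "l \<in> letters" "set u \<subseteq> letters" "set v \<subseteq> letters"
    and h: "rational_word (u @ insort_key snd l v)"
  shows "rational_word (u @ l # v)"
  using assms
proof (induction v arbitrary: u)
  case (Cons a v)
  show ?case
  proof (cases "snd l \<le> snd a")
    case True
    then show ?thesis using Cons.prems by simp
  next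
    case False
    have "rational_word ((u @ [a]) @ l # v)"
      by (rule Cons.IH) (use Cons.prems False in auto)
    then have "rational_word (u @ a # l # v)" by simp
    then show ?thesis
      by (intro rational_word_swap[of u v a l]) (use Cons.prems in auto)
  qed
qed simp

lemma rational_word_sort:
  assumes IH: "\<And>w. set w \<subseteq> letters \<Longrightarrow> length w < length u + length v \<Longrightarrow> rational_word w"
    and l: "set u \<subseteq> letters" "set v \<subseteq> letters"
    and h: "rational_word (u @ sort_key snd v)"
  shows "rational_word (u @ v)"
  using assms
proof (induction v arbitrary: u)
  case (Cons a v)
  have "rational_word (u @ a # sort_key snd v)"
    by (rule rational_word_insort) (use Cons.prems in auto)
  then have "rational_word ((u @ [a]) @ v)" by (intro Cons.IH) (use Cons.prems in auto)
  then show ?case by simp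
qed simp

lemma rational_word_positive:
  assumes IH: "\<And>w. set w \<subseteq> letters \<Longrightarrow> length w < length v \<Longrightarrow> rational_word w"
    and v: "set v \<subseteq> letters" "\<forall>l\<in>set v. \<not> fst l"
  shows "rational_word v"
proof -
  let ?s = "sort_key snd v"
  have s: "set ?s \<subseteq> letters" "\<forall>l\<in>set ?s. \<not> fst l" "sorted (map snd ?s)" "length ?s = length v" using v by auto
  have "rational_word ?s"
  proof (cases "distinct ?s")
    case True
    then show ?thesis using s by (intro rational_word_sorted_positive)
  next
    case False
    have "\<exists>u l w. ?s = u @ l # l # w"
    proof -
      obtain xs l ys zs where d: "?s = xs @ [l] @ ys @ [l] @ zs" using not_distinct_decomp[OF False] by blast
      show ?thesis
      proof (cases ys)
        case Nil
        then show ?thesis using d by (intro exI[of _ xs] exI[of _ l] exI[of _ zs]) simp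
      next
        case (Cons b ys')
        \<comment> \<open>Sortedness forces the same index on everything between two equal letters,
          and letters without inverse are determined by their index; so the repetition can be taken
          adjacent.\<close>
        have "snd b = snd l" using s(3) d Cons by (auto simp: sorted_append)
        moreover have "\<not> fst b" "\<not> fst l" using s(2) d Cons by auto
        ultimately have "b = l" by (auto intro: prod_eqI)
        then show ?thesis
          using d Cons by (intro exI[of _ xs] exI[of _ l] exI[of _ "ys' @ [l] @ zs"]) simp
      qed
    qed
    then obtain u l w where d: "?s = u @ l # l # w" by blast
    have "length v = length u + length w + 2" using s(4) d by simp
    then show ?thesis unfolding d using IH s(1) d by (intro rational_word_repeat) auto
  qed
  then show ?thesis using rational_word_sort[of "[]" v] IH v by simp
qed

lemma rational_word_drop_inverses:
  assumes IH: "\<And>w. set w \<subseteq> letters \<Longrightarrow> length w < length u + length v \<Longrightarrow> rational_word w"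
    and l: "set u \<subseteq> letters" "set v \<subseteq> letters"
    and gen: "\<And>i. i < length gs \<Longrightarrow> rational (\<lambda>\<tau>. \<tau> (gs ! i))"
    and h: "rational_word (u @ map (\<lambda>l. (False, snd l)) v)"
  shows "rational_word (u @ v)"
  using IH l h
proof (induction v arbitrary: u)
  case (Cons a v)
  obtain b i where a: "a = (b, i)" by force
  have i: "i < length gs" "(False, i) \<in> letters" using Cons.prems a by (auto simp: letters_def)
  have "rational_word ((u @ [(False, i)]) @ v)" by (rule Cons.IH) (use Cons.prems a i in auto)
  then have F: "rational_word (u @ (False, i) # v)" by simp
  show ?case
  proof (cases b)
    case True
    show ?thesis unfolding a using True F
      by (simp, intro rational_word_inverse[OF _ i(1)] gen[OF i(1)]) (use Cons.prems in auto)
  next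
    case False
    then show ?thesis using F a by simp
  qed
qed simp

lemma character_word_rational: "set w \<subseteq> letters \<Longrightarrow> rational_word w"
proof (induction "length w" arbitrary: w rule: less_induct)
  case less
  have gen: "rational (\<lambda>\<tau>. \<tau> (gs ! i))" if "i < length gs" for i
  proof -
    have "rational_word [(False, i)]" by (rule rational_word_sorted_positive) (use that in \<open>auto simp: letters_def\<close>)
    moreover have "gs ! i \<in> carrier G" using gs that by auto
    ultimately show ?thesis by (simp add: word_def letter_def)
  qed
  have "rational_word (map (\<lambda>l. (False, snd l)) w)"
    by (rule rational_word_positive) (use less in \<open>auto simp: letters_def\<close>)
  then show ?case using rational_word_drop_inverses[of "[]" w] less gen by simp
qed

text \<open>Known as the theorem of Fricke and Vogt; through it the finitely many trace coordinates
  control all trace functions.\<close>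

theorem character_rational:
  assumes "\<gamma> \<in> generate G (set gs)"
  shows "rational (\<lambda>\<tau>. \<tau> \<gamma>)"
  using generate_words[OF assms] character_word_rational by blast

end

end

section \<open>The set of characters is closed\<close>

context
  fixes G :: "'g monoid" (structure)
  assumes group: "group G"
begin

interpretation group G by (rule group)

text \<open>The Zariski closure over the rationals of the set of characters within all functions on
  the group. Only rational identities are imposed, since a common zero of rational polynomials in
  the coordinates can be shown to satisfy just these.\<close>

definition rational_closure :: "('g \<Rightarrow> complex) set" where
  "rational_closure = {\<tau> \<in> extensional (carrier G).
     \<forall>q\<in>polyfuns \<rat> (trace_function ` carrier G). (\<forall>\<tau>'\<in>sl2_characters G. q \<tau>' = 0) \<longrightarrow> q \<tau> = 0}"

text \<open>Coordinates on pairs of a character and a number, the latter meant to be an eigenvalue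
  of \<rho> g.\<close>

definition eigen_coords :: "(('g \<Rightarrow> complex) \<times> complex \<Rightarrow> complex) set" where
  "eigen_coords = insert snd ((\<lambda>\<gamma> p. fst p \<gamma>) ` carrier G)"

lemma polyfuns_trace: "a \<in> carrier G \<Longrightarrow> (\<lambda>\<tau>. \<tau> a) \<in> polyfuns \<rat> (trace_function ` carrier G)"
  by (rule polyfuns.coord) (auto simp: trace_function_def[abs_def])

lemma eigen_coords_linear:
  assumes g: "g \<in> carrier G" and "q \<in> polyfuns \<rat> eigen_coords"
  shows "\<exists>\<alpha>\<in>polyfuns \<rat> (trace_function ` carrier G). \<exists>\<beta>\<in>polyfuns \<rat> (trace_function ` carrier G).
    \<forall>\<tau> u. u\<^sup>2 = \<tau> g * u - 1 \<longrightarrow> q (\<tau>, u) = \<alpha> \<tau> + u * \<beta> \<tau>"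
    (is "\<exists>\<alpha>\<in>?P. \<exists>\<beta>\<in>?P. ?ok q \<alpha> \<beta>")
  using assms(2)
proof induction
  case (const c)
  then show ?case
    by (intro bexI[of _ "\<lambda>_. c"] bexI[of _ "\<lambda>_. 0"]) (auto intro: polyfuns.const)
next
  case (coord \<phi>)
  then consider "\<phi> = snd" | \<gamma> where "\<gamma> \<in> carrier G" "\<phi> = (\<lambda>p. fst p \<gamma>)" by (auto simp: eigen_coords_def)
  then show ?case
  proof cases
    case 1
    then show ?thesis by (intro bexI[of _ "\<lambda>_. 1"] bexI[of _ "\<lambda>_. 0"]) (auto intro: polyfuns.const)
  next
    case 2
    then show ?thesis
      by (intro bexI[of _ "\<lambda>\<tau>. \<tau> \<gamma>"] bexI[of _ "\<lambda>_. 0"]) (auto intro: polyfuns.const polyfuns_trace)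
  qed
next
  case (add q r)
  then obtain \<alpha> \<beta> \<alpha>' \<beta>' where P: "\<alpha> \<in> ?P" "\<beta> \<in> ?P" "\<alpha>' \<in> ?P" "\<beta>' \<in> ?P" "?ok q \<alpha> \<beta>" "?ok r \<alpha>' \<beta>'"
    by blast
  show ?case
    by (rule bexI[of _ "\<lambda>x. \<alpha> x + \<alpha>' x"], rule bexI[of _ "\<lambda>x. \<beta> x + \<beta>' x"])
      (use P in \<open>auto intro: polyfuns.add simp: algebra_simps\<close>)
next
  case (mult q r)
  then obtain \<alpha> \<beta> \<alpha>' \<beta>' where P: "\<alpha> \<in> ?P" "\<beta> \<in> ?P" "\<alpha>' \<in> ?P" "\<beta>' \<in> ?P" "?ok q \<alpha> \<beta>" "?ok r \<alpha>' \<beta>'"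
    by blast
  show ?case
  \<comment> \<open>Multiplying out and replacing \<open>u\<^sup>2\<close> by
    \<open>\<tau> g * u - 1\<close> produces these two coefficients.\<close>
  proof (rule bexI[of _ "\<lambda>x. \<alpha> x * \<alpha>' x - \<beta> x * \<beta>' x"],
      rule bexI[of _ "\<lambda>x. \<alpha> x * \<beta>' x + \<beta> x * \<alpha>' x + \<beta> x * (\<beta>' x * x g)"])
    show "(\<lambda>x. \<alpha> x * \<beta>' x + \<beta> x * \<alpha>' x + \<beta> x * (\<beta>' x * x g)) \<in> ?P"
      by (intro polyfuns.add polyfuns.mult P polyfuns_trace g)
    show "(\<lambda>x. \<alpha> x * \<alpha>' x - \<beta> x * \<beta>' x) \<in> ?P"
      by (intro polyfuns_diff polyfuns.mult P) auto
    show "\<forall>\<tau> u. u\<^sup>2 = \<tau> g * u - 1 \<longrightarrow> q (\<tau>, u) * r (\<tau>, u) = \<alpha> \<tau> * \<alpha>' \<tau> - \<beta> \<tau> * \<beta>' \<tau> +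
        u * (\<alpha> \<tau> * \<beta>' \<tau> + \<beta> \<tau> * \<alpha>' \<tau> + \<beta> \<tau> * (\<beta>' \<tau> * \<tau> g))"
    proof (intro allI impI)
      fix \<tau> and u :: complex assume u: "u\<^sup>2 = \<tau> g * u - 1"
      have "q (\<tau>, u) * r (\<tau>, u) = \<alpha> \<tau> * \<alpha>' \<tau> + u * (\<alpha> \<tau> * \<beta>' \<tau> + \<beta> \<tau> * \<alpha>' \<tau>) + u\<^sup>2 * (\<beta> \<tau> * \<beta>' \<tau>)"
        using P(5,6) u by (simp add: algebra_simps power2_eq_square)
      then show "q (\<tau>, u) * r (\<tau>, u) = \<alpha> \<tau> * \<alpha>' \<tau> - \<beta> \<tau> * \<beta>' \<tau> +
        u * (\<alpha> \<tau> * \<beta>' \<tau> + \<beta> \<tau> * \<alpha>' \<tau> + \<beta> \<tau> * (\<beta>' \<tau> * \<tau> g))"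
        unfolding u by (simp add: algebra_simps)
    qed
  qed
qed

lemma quadratic_roots:
  obtains u :: complex where "u\<^sup>2 = t * u - 1" "(2 * u - t)\<^sup>2 = t\<^sup>2 - 4"
    "(t - u)\<^sup>2 = t * (t - u) - 1"
proof -
  define u where "u = (t + csqrt (t\<^sup>2 - 4)) / 2"
  have "2 * u - t = csqrt (t\<^sup>2 - 4)" by (simp add: u_def field_simps)
  then have s: "(2 * u - t)\<^sup>2 = t\<^sup>2 - 4" by simp
  then have "4 * (u\<^sup>2 - (t * u - 1)) = 0" by (simp add: algebra_simps power2_eq_square)
  then have "u\<^sup>2 - (t * u - 1) = 0" by (metis mult_eq_0_iff zero_neq_numeral)
  then have u: "u\<^sup>2 = t * u - 1" by simp
  moreover have "(t - u)\<^sup>2 = t * (t - u) - 1" using u by (simp add: algebra_simps power2_eq_square)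
  ultimately show thesis using that s by blast
qed

lemma character_identity_closure:
  assumes "q \<in> polyfuns \<rat> (trace_function ` carrier G)" "\<And>\<tau>'. \<tau>' \<in> sl2_characters G \<Longrightarrow> q \<tau>' = 0"
    "\<tau> \<in> rational_closure"
  shows "q \<tau> = 0"
  using assms by (auto simp: rational_closure_def)

text \<open>An identity in traces and an eigenvalue \<open>u\<close> of \<open>\<rho> g\<close> carries over to the closure: modulo
  the equation of \<open>u\<close> it reads \<open>\<alpha> + u \<beta> = 0\<close>, and as it holds for both eigenvalues,
  \<open>\<alpha>\<close> and \<open>\<beta>\<close> vanish where these are distinct.\<close>

lemma rational_closure_eigen:
  assumes g: "g \<in> carrier G" and q: "q \<in> polyfuns \<rat> eigen_coords"
    and van: "\<And>\<tau> u. \<tau> \<in> sl2_characters G \<Longrightarrow> u\<^sup>2 = \<tau> g * u - 1 \<Longrightarrow> q (\<tau>, u) = 0"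
    and \<tau>: "\<tau> \<in> rational_closure" "(\<tau> g)\<^sup>2 \<noteq> 4" "u\<^sup>2 = \<tau> g * u - 1"
  shows "q (\<tau>, u) = 0"
proof -
  let ?P = "polyfuns \<rat> (trace_function ` carrier G)"
  obtain \<alpha> \<beta> where ab: "\<alpha> \<in> ?P" "\<beta> \<in> ?P"
    "\<And>\<tau> u. u\<^sup>2 = \<tau> g * u - 1 \<Longrightarrow> q (\<tau>, u) = \<alpha> \<tau> + u * \<beta> \<tau>"
    using eigen_coords_linear[OF g q] by blast
  \<comment> \<open>Where the two eigenvalues coincide, \<alpha> and \<beta> need not vanish. The
    discriminant as a factor absorbs this: the products vanish at every character and so at \<tau>,
    where the factor is nonzero.\<close>
  have zero: "((\<tau>' g) * (\<tau>' g) - 4) * \<alpha> \<tau>' = 0 \<and> ((\<tau>' g) * (\<tau>' g) - 4) * \<beta> \<tau>' = 0"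
    if \<tau>': "\<tau>' \<in> sl2_characters G" for \<tau>'
  proof (cases "(\<tau>' g)\<^sup>2 - 4 = 0")
    case False
    obtain v where v: "v\<^sup>2 = \<tau>' g * v - 1" "(2 * v - \<tau>' g)\<^sup>2 = (\<tau>' g)\<^sup>2 - 4"
      "(\<tau>' g - v)\<^sup>2 = \<tau>' g * (\<tau>' g - v) - 1" using quadratic_roots[of "\<tau>' g"] by blast
    have "2 * v - \<tau>' g \<noteq> 0" using v(2) False by auto
    moreover have 1: "\<alpha> \<tau>' + v * \<beta> \<tau>' = 0" "\<alpha> \<tau>' + (\<tau>' g - v) * \<beta> \<tau>' = 0"
      using van[OF \<tau>' v(1)] van[OF \<tau>' v(3)] ab(3)[where \<tau> = \<tau>' and u = v] ab(3)[where \<tau> = \<tau>' and u = "\<tau>' g - v"] v(1,3) by auto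
    moreover have "(2 * v - \<tau>' g) * \<beta> \<tau>' = (\<alpha> \<tau>' + v * \<beta> \<tau>') - (\<alpha> \<tau>' + (\<tau>' g - v) * \<beta> \<tau>')"
      by (simp add: algebra_simps)
    ultimately have "\<beta> \<tau>' = 0" by simp
    then show ?thesis using 1 by simp
  qed (simp add: power2_eq_square)
  have closed: "(\<tau> g * \<tau> g - 4) * f \<tau> = 0"
    if f: "f \<in> ?P" and fz: "\<And>\<tau>'. \<tau>' \<in> sl2_characters G \<Longrightarrow> (\<tau>' g * \<tau>' g - 4) * f \<tau>' = 0" for f
  proof (rule character_identity_closure[where q = "\<lambda>x. (x g * x g - 4) * f x"])
    show "(\<lambda>x. (x g * x g - 4) * f x) \<in> ?P"
      by (intro polyfuns.mult polyfuns_diff polyfuns_trace g polyfuns.const f) auto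
  qed (use fz \<tau>(1) in auto)
  have "(\<tau> g * \<tau> g - 4) * \<alpha> \<tau> = 0" by (rule closed[OF ab(1)]) (use zero in blast)
  moreover have "(\<tau> g * \<tau> g - 4) * \<beta> \<tau> = 0" by (rule closed[OF ab(2)]) (use zero in blast)
  ultimately have "\<alpha> \<tau> = 0" "\<beta> \<tau> = 0" using \<tau>(2) by (auto simp: power2_eq_square)
  then show ?thesis using ab(3)[where \<tau> = \<tau> and u = u] \<tau>(3) by simp
qed

lemma sl2_charactersI:
  fixes \<rho> :: "'g \<Rightarrow> complex ^ 2 ^ 2"
  assumes "\<tau> \<in> extensional (carrier G)" "\<And>a. a \<in> carrier G \<Longrightarrow> det (\<rho> a) = 1"
    "\<And>a b. a \<in> carrier G \<Longrightarrow> b \<in> carrier G \<Longrightarrow> \<rho> (a \<otimes> b) = \<rho> a ** \<rho> b"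
    "\<And>a. a \<in> carrier G \<Longrightarrow> trace (\<rho> a) = \<tau> a"
  shows "\<tau> \<in> sl2_characters G"
  unfolding sl2_characters_def
proof (rule image_eqI)
  show "restrict \<rho> (carrier G) \<in> hom G SL2C \<inter> extensional (carrier G)"
    using assms by (auto simp: hom_def SL2C_def)
  show "\<tau> = (\<lambda>\<gamma>\<in>carrier G. trace (restrict \<rho> (carrier G) \<gamma>))"
    using assms by (auto simp: extensional_def restrict_def)
qed

text \<open>All values are 2 or -2. The identity for the trace of b a a then leaves a single sign
  for the trace of a b, so half of \<tau> is a homomorphism to {1, -1}, which scalar matrices
  realise.\<close>

lemma closure_unipotent:
  assumes \<tau>: "\<tau> \<in> rational_closure" and 4: "\<And>g. g \<in> carrier G \<Longrightarrow> (\<tau> g)\<^sup>2 = 4"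
  shows "\<tau> \<in> sl2_characters G"
proof -
  have pm: "\<tau> g = 2 \<or> \<tau> g = - 2" if "g \<in> carrier G" for g
  proof -
    have "(\<tau> g)\<^sup>2 = 2\<^sup>2" using 4[OF that] by simp
    then show ?thesis by (simp only: power2_eq_iff)
  qed
  have mult: "\<tau> (a \<otimes> b) = \<tau> a * \<tau> b / 2" if ab: "a \<in> carrier G" "b \<in> carrier G" for a b
  proof -
    have "\<tau> (b \<otimes> (a \<otimes> a)) - (\<tau> a * \<tau> (b \<otimes> a) - \<tau> b) = 0"
      by (rule character_identity_closure[OF _ _ \<tau>])
        (use ab in \<open>auto intro!: polyfuns_diff polyfuns.mult polyfuns_trace simp: character_square[OF group]\<close>)
    moreover have "\<tau> (b \<otimes> a) - \<tau> (a \<otimes> b) = 0"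
      by (rule character_identity_closure[OF _ _ \<tau>])
        (use ab in \<open>auto intro!: polyfuns_diff polyfuns_trace simp: character_commute[OF group, of _ a b]\<close>)
    ultimately show ?thesis
      using pm[OF ab(1)] pm[OF ab(2)] pm[of "a \<otimes> b"] pm[of "b \<otimes> (a \<otimes> a)"] ab by auto
  qed
  show ?thesis
  proof (rule sl2_charactersI[where \<rho> = "\<lambda>a. mat (\<tau> a / 2)"])
    show "\<tau> \<in> extensional (carrier G)" using \<tau> by (simp add: rational_closure_def)
    fix a assume a: "a \<in> carrier G"
    show "det (mat (\<tau> a / 2) :: complex ^ 2 ^ 2) = 1" using 4[OF a] by (simp add: det_2 mat_def power2_eq_square)
    show "trace (mat (\<tau> a / 2) :: complex ^ 2 ^ 2) = \<tau> a" by (simp add: trace_2 mat_def)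
    fix b assume b: "b \<in> carrier G"
    show "(mat (\<tau> (a \<otimes> b) / 2) :: complex ^ 2 ^ 2) = mat (\<tau> a / 2) ** mat (\<tau> b / 2)"
      by (simp add: vec_eq_iff forall_2 matrix_mult_2) (simp add: mat_def mult[OF a b])
  qed
qed

text \<open>In an eigenbasis of \<rho> g the diagonal entries \<open>L\<close> and \<open>M\<close>,
  scaled by the difference \<open>d\<close> of the eigenvalues, are functions of the traces and
  \<open>u\<close>. Off-diagonal entries change with the scaling of the basis, but the product
  \<open>F a b\<close> of the upper one at \<open>a\<close> and the lower one at \<open>b\<close>
  does not. Identities among \<open>L\<close>, \<open>M\<close> and \<open>F\<close> hold for
  characters, hence in the closure, and there they suffice to write down a representation with trace
  \<tau>.\<close>

lemma closure_split:
  assumes \<tau>: "\<tau> \<in> rational_closure" and g: "g \<in> carrier G" "(\<tau> g)\<^sup>2 \<noteq> 4"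
  shows "\<tau> \<in> sl2_characters G"
proof -
  define Dp :: "('g \<Rightarrow> complex) \<times> complex \<Rightarrow> complex" where "Dp p = 2 * snd p - fst p g" for p
  define Lp where "Lp a p = fst p (g \<otimes> a) - (fst p g - snd p) * fst p a" for a and p :: "('g \<Rightarrow> complex) \<times> complex"
  define Mp where "Mp a p = Dp p * fst p a - Lp a p" for a p
  \<comment> \<open>The product formula of the upper left entry, solved for its off-diagonal term,
    so that only traces and the eigenvalue occur.\<close>
  define Fp where "Fp a b p = Dp p * Lp (a \<otimes> b) p - Lp a p * Lp b p" for a b p
  note defs = Dp_def Lp_def Mp_def Fp_def
  let ?P = "polyfuns \<rat> eigen_coords"
  have P: "(\<lambda>p. fst p a) \<in> ?P" if "a \<in> carrier G" for a
    using that by (intro polyfuns.coord) (auto simp: eigen_coords_def)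
  have "snd \<in> ?P" by (rule polyfuns.coord) (auto simp: eigen_coords_def)
  then have P_D: "Dp \<in> ?P" unfolding Dp_def
    by (intro polyfuns_diff polyfuns.mult polyfuns.const P g) auto
  have P_L: "Lp a \<in> ?P" if "a \<in> carrier G" for a
    unfolding Lp_def using \<open>snd \<in> ?P\<close> that g(1)
    by (intro polyfuns_diff polyfuns.mult P m_closed) auto
  have P_M: "Mp a \<in> ?P" if "a \<in> carrier G" for a
    unfolding Mp_def using P_D P_L that by (intro polyfuns_diff polyfuns.mult P) auto
  have P_F: "Fp a b \<in> ?P" if "a \<in> carrier G" "b \<in> carrier G" for a b
    unfolding Fp_def using P_D P_L that by (intro polyfuns_diff polyfuns.mult) auto
  \<comment> \<open>What the matrices have to supply at a point \<open>p\<close>: off-diagonal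
    entries \<open>B\<close> and \<open>C\<close> with the product and determinant formulas. The
    identities below follow from this predicate alone.\<close>
  define split where "split p B C \<longleftrightarrow> (\<forall>a\<in>carrier G. Lp a p * Mp a p - B a * C a = (Dp p)\<^sup>2 \<and>
      (\<forall>b\<in>carrier G. Fp a b p = B a * C b \<and>
        Dp p * B (a \<otimes> b) = Lp a p * B b + B a * Mp b p \<and>
        Dp p * C (a \<otimes> b) = C a * Lp b p + Mp a p * C b \<and>
        Dp p * Mp (a \<otimes> b) p = C a * B b + Mp a p * Mp b p))" for p B C
  have entries: "\<exists>B C. split (\<tau>', v) B C" if \<tau>': "\<tau>' \<in> sl2_characters G" "v\<^sup>2 = \<tau>' g * v - 1" for \<tau>' v
  proof -
    obtain \<rho> where \<rho>: "\<rho> \<in> hom G SL2C" "\<And>a. a \<in> carrier G \<Longrightarrow> \<tau>' a = trace (\<rho> a)"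
      using sl2_charactersE[OF group \<tau>'(1)] by blast
    note hom = hom_SL2C[OF group \<rho>(1)]
    have v: "v\<^sup>2 = trace (\<rho> g) * v - 1" using \<tau>'(2) \<rho>(2)[OF g(1)] by simp
    obtain L M B C :: "complex ^ 2 ^ 2 \<Rightarrow> complex" where
      LM: "\<And>X. L X = trace (\<rho> g ** X) - (trace (\<rho> g) - v) * trace X"
        "\<And>X. M X = (2 * v - trace (\<rho> g)) * trace X - L X"
      and BC: "\<And>X Y. (2 * v - trace (\<rho> g)) * L (X ** Y) = L X * L Y + B X * C Y"
        "\<And>X Y. (2 * v - trace (\<rho> g)) * B (X ** Y) = L X * B Y + B X * M Y"
        "\<And>X Y. (2 * v - trace (\<rho> g)) * C (X ** Y) = C X * L Y + M X * C Y"
        "\<And>X Y. (2 * v - trace (\<rho> g)) * M (X ** Y) = C X * B Y + M X * M Y"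
        "\<And>X. L X * M X - B X * C X = (2 * v - trace (\<rho> g))\<^sup>2 * det X"
      by (rule eigenbasis_entries[OF hom(1)[OF g(1)] v]) (rule that)
    have D: "Dp (\<tau>', v) = 2 * v - trace (\<rho> g)" by (simp add: Dp_def \<rho>(2) g(1))
    have L: "Lp a (\<tau>', v) = L (\<rho> a)" if "a \<in> carrier G" for a
      using that g(1) by (simp add: Lp_def \<rho>(2) hom(2) LM(1))
    have M: "Mp a (\<tau>', v) = M (\<rho> a)" if "a \<in> carrier G" for a
      using that by (simp add: Mp_def L D \<rho>(2) LM(2))
    have "split (\<tau>', v) (\<lambda>a. B (\<rho> a)) (\<lambda>a. C (\<rho> a))"
      unfolding split_def using BC by (simp add: Fp_def L M D hom)
    then show ?thesis by blast
  qed
  obtain u where u: "u\<^sup>2 = \<tau> g * u - 1" "(2 * u - \<tau> g)\<^sup>2 = (\<tau> g)\<^sup>2 - 4"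
    using quadratic_roots[of "\<tau> g"] by blast
  define d L M F where "d = Dp (\<tau>, u)" and "L = (\<lambda>a. Lp a (\<tau>, u))" and "M = (\<lambda>a. Mp a (\<tau>, u))"
    and "F = (\<lambda>a b. Fp a b (\<tau>, u))"
  have d0: "d \<noteq> 0" using u(2) g(2) by (auto simp: d_def Dp_def)
  have closure: "q (\<tau>, u) = 0" if "q \<in> ?P" "\<And>p B C. split p B C \<Longrightarrow> q p = 0" for q
    by (rule rational_closure_eigen[OF g(1) that(1) _ \<tau> g(2) u(1)]) (use entries that(2) in blast)
  have F_swap: "F a b * F a' b' = F a b' * F a' b"
    if c: "a \<in> carrier G" "b \<in> carrier G" "a' \<in> carrier G" "b' \<in> carrier G" for a b a' b'
  proof -
    have "(\<lambda>p. Fp a b p * Fp a' b' p - Fp a b' p * Fp a' b p) \<in> ?P"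
      by (intro polyfuns_diff polyfuns.mult P_F c) auto
    from closure[OF this] show ?thesis using c by (simp add: split_def F_def)
  qed
  have F_left: "d * F (a \<otimes> b) e = L a * F b e + F a e * M b"
    if c: "a \<in> carrier G" "b \<in> carrier G" "e \<in> carrier G" for a b e
  proof -
    have "(\<lambda>p. Dp p * Fp (a \<otimes> b) e p - (Lp a p * Fp b e p + Fp a e p * Mp b p)) (\<tau>, u) = 0"
    proof (rule closure)
      show "(\<lambda>p. Dp p * Fp (a \<otimes> b) e p - (Lp a p * Fp b e p + Fp a e p * Mp b p)) \<in> ?P"
        by (intro polyfuns_diff polyfuns.add polyfuns.mult P_F P_D P_L P_M c m_closed) auto
      fix p B C assume s: "split p B C"
      have "Dp p * Fp (a \<otimes> b) e p = (Dp p * B (a \<otimes> b)) * C e" using s c by (simp add: split_def)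
      also have "\<dots> = Lp a p * Fp b e p + Fp a e p * Mp b p"
        using s c by (simp add: split_def algebra_simps)
      finally show "Dp p * Fp (a \<otimes> b) e p - (Lp a p * Fp b e p + Fp a e p * Mp b p) = 0" by simp
    qed
    then show ?thesis by (simp add: F_def L_def M_def d_def)
  qed
  have F_right: "d * F e (a \<otimes> b) = F e a * L b + M a * F e b"
    if c: "a \<in> carrier G" "b \<in> carrier G" "e \<in> carrier G" for a b e
  proof -
    have "(\<lambda>p. Dp p * Fp e (a \<otimes> b) p - (Fp e a p * Lp b p + Mp a p * Fp e b p)) (\<tau>, u) = 0"
    proof (rule closure)
      show "(\<lambda>p. Dp p * Fp e (a \<otimes> b) p - (Fp e a p * Lp b p + Mp a p * Fp e b p)) \<in> ?P"
        by (intro polyfuns_diff polyfuns.add polyfuns.mult P_F P_D P_L P_M c m_closed) auto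
      fix p B C assume s: "split p B C"
      have "Dp p * Fp e (a \<otimes> b) p = B e * (Dp p * C (a \<otimes> b))" using s c by (simp add: split_def)
      also have "\<dots> = Fp e a p * Lp b p + Mp a p * Fp e b p"
        using s c by (simp add: split_def algebra_simps)
      finally show "Dp p * Fp e (a \<otimes> b) p - (Fp e a p * Lp b p + Mp a p * Fp e b p) = 0" by simp
    qed
    then show ?thesis by (simp add: F_def L_def M_def d_def)
  qed
  have M_mult: "d * M (a \<otimes> b) = F b a + M a * M b" if c: "a \<in> carrier G" "b \<in> carrier G" for a b
  proof -
    have "(\<lambda>p. Dp p * Mp (a \<otimes> b) p - (Fp b a p + Mp a p * Mp b p)) \<in> ?P"
      by (intro polyfuns_diff polyfuns.add polyfuns.mult P_F P_D P_M c m_closed) auto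
    from closure[OF this] show ?thesis using c by (simp add: split_def F_def M_def d_def)
  qed
  have det: "L a * M a - F a a = d\<^sup>2" if c: "a \<in> carrier G" for a
  proof -
    have "(\<lambda>p. Lp a p * Mp a p - Fp a a p - Dp p * Dp p) \<in> ?P"
      by (intro polyfuns_diff polyfuns.mult P_F P_D P_L P_M c) auto
    from closure[OF this] show ?thesis
      using c by (simp add: split_def F_def L_def M_def d_def power2_eq_square)
  qed
  have "\<exists>B C. (\<forall>a\<in>carrier G. \<forall>b\<in>carrier G. F a b = B a * C b) \<and>
      (\<forall>a\<in>carrier G. \<forall>b\<in>carrier G. d * B (a \<otimes> b) = L a * B b + B a * M b) \<and>
      (\<forall>a\<in>carrier G. \<forall>b\<in>carrier G. d * C (a \<otimes> b) = C a * L b + M a * C b)"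
  proof (cases "\<forall>a\<in>carrier G. \<forall>b\<in>carrier G. F a b = 0")
    \<comment> \<open>With all off-diagonal products zero, a diagonal representation has the
      required trace.\<close>
    case True
    then show ?thesis by (intro exI[of _ "\<lambda>_. 0"]) simp
  next
    case False
    then obtain a0 b0 where ab0: "a0 \<in> carrier G" "b0 \<in> carrier G" "F a0 b0 \<noteq> 0" by blast
    show ?thesis
    \<comment> \<open>\<open>F_swap\<close> says that \<open>F\<close> has rank one. A nonzero value
      splits it into factors; the free scaling of the eigenbasis is fixed by giving \<open>B\<close>
      the value 1 at \<open>a0\<close>.\<close>
    proof (rule exI[of _ "\<lambda>a. F a b0 / F a0 b0"], rule exI[of _ "\<lambda>b. F a0 b"], intro conjI ballI)
      fix a b assume ab: "a \<in> carrier G" "b \<in> carrier G"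
      show "F a b = F a b0 / F a0 b0 * F a0 b"
        using F_swap[of a b a0 b0] ab ab0 by (simp add: field_simps)
      show "d * (F (a \<otimes> b) b0 / F a0 b0) = L a * (F b b0 / F a0 b0) + F a b0 / F a0 b0 * M b"
        using F_left[OF ab ab0(2)] ab0(3) by (simp add: field_simps)
      show "d * F a0 (a \<otimes> b) = F a0 a * L b + M a * F a0 b"
        using F_right[OF ab ab0(1)] .
    qed
  qed
  then obtain B C where BC: "\<And>a b. a \<in> carrier G \<Longrightarrow> b \<in> carrier G \<Longrightarrow> F a b = B a * C b"
    "\<And>a b. a \<in> carrier G \<Longrightarrow> b \<in> carrier G \<Longrightarrow> d * B (a \<otimes> b) = L a * B b + B a * M b"
    "\<And>a b. a \<in> carrier G \<Longrightarrow> b \<in> carrier G \<Longrightarrow> d * C (a \<otimes> b) = C a * L b + M a * C b" by blast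
  define \<rho> :: "'g \<Rightarrow> complex ^ 2 ^ 2" where
    "\<rho> a = (\<chi> i j. (if i = 1 then if j = 1 then L a else B a else if j = 1 then C a else M a) / d)" for a
  have \<rho>: "\<rho> a $ 1 $ 1 = L a / d" "\<rho> a $ 1 $ 2 = B a / d" "\<rho> a $ 2 $ 1 = C a / d" "\<rho> a $ 2 $ 2 = M a / d" for a
    by (simp_all add: \<rho>_def)
  have quot: "x / d = y / d * (z / d) + y' / d * (z' / d)" if "d * x = y * z + y' * z'" for x y z y' z'
    using d0 that by (simp add: field_simps)
  show ?thesis
  proof (rule sl2_charactersI[where \<rho> = \<rho>])
    show "\<tau> \<in> extensional (carrier G)" using \<tau> by (simp add: rational_closure_def)
    fix a assume a: "a \<in> carrier G"
    show "det (\<rho> a) = 1"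
      using det[OF a] BC(1)[OF a a] d0 by (simp add: det_2 \<rho> field_simps power2_eq_square)
    have "L a + M a = d * \<tau> a" by (simp add: M_def Mp_def L_def d_def)
    then show "trace (\<rho> a) = \<tau> a" using d0 by (simp add: trace_2 \<rho> field_simps)
    fix b assume b: "b \<in> carrier G"
    have "d * L (a \<otimes> b) = L a * L b + B a * C b"
      using BC(1)[OF a b] by (simp add: F_def Fp_def L_def d_def algebra_simps)
    moreover have "d * M (a \<otimes> b) = C a * B b + M a * M b"
      using M_mult[OF a b] BC(1)[OF b a] by simp
    ultimately show "\<rho> (a \<otimes> b) = \<rho> a ** \<rho> b"
      using BC(2,3)[OF a b] by (simp add: vec_eq_iff forall_2 matrix_mult_2 \<rho> quot)
  qed
qed

theorem rational_closure_subset: "rational_closure \<subseteq> sl2_characters G"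
  using closure_unipotent closure_split by blast

end

section \<open>Transport along field automorphisms\<close>

text \<open>For bi-unique and bi-total \<open>R\<close> this is an isomorphism of rings, written as
  a relation to serve transfer. The operations are related on the whole types, so that definitions
  that reach beyond the carrier transfer too.\<close>

definition ring_rel :: "('f \<Rightarrow> 'g \<Rightarrow> bool) \<Rightarrow> 'f ring \<Rightarrow> 'g ring \<Rightarrow> bool" where
  "ring_rel R K K' \<longleftrightarrow> rel_set R (carrier K) (carrier K') \<and>
     rel_fun R (rel_fun R R) (mult K) (mult K') \<and> R (one K) (one K') \<and>
     R (zero K) (zero K') \<and> rel_fun R (rel_fun R R) (add K) (add K')"

context
  includes lifting_syntax
begin

lemma ring_rel_transfer [transfer_rule]:
  "(ring_rel R ===> rel_set R) carrier carrier"
  "(ring_rel R ===> R ===> R ===> R) mult mult"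
  "(ring_rel R ===> R) one one"
  "(ring_rel R ===> R) zero zero"
  "(ring_rel R ===> R ===> R ===> R) add add"
  by (auto simp: ring_rel_def rel_fun_def)

section \<open>Parametricity of valuations and Bass-Serre trees\<close>

context
  fixes R :: "'f \<Rightarrow> 'g \<Rightarrow> bool"
  assumes [transfer_rule]: "bi_unique R" "bi_total R"
begin

lemma nonzero_transfer [transfer_rule]: "(ring_rel R ===> rel_set R) nonzero nonzero"
  unfolding nonzero_def by transfer_prover

lemma discrete_valuation_transfer [transfer_rule]:
  "(ring_rel R ===> (R ===> (=)) ===> (=)) discrete_valuation discrete_valuation"
  unfolding discrete_valuation_def extensional_def by transfer_prover

lemma regular_at_transfer [transfer_rule]:
  "(ring_rel R ===> (R ===> (=)) ===> R ===> (=)) regular_at regular_at"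
  unfolding regular_at_def by transfer_prover

lemma vscale_transfer [transfer_rule]:
  "(ring_rel R ===> R ===> rel_prod R R ===> rel_prod R R) vscale vscale"
  unfolding vscale_def by transfer_prover

lemma vadd_transfer [transfer_rule]:
  "(ring_rel R ===> rel_prod R R ===> rel_prod R R ===> rel_prod R R) vadd vadd"
  unfolding vadd_def by transfer_prover

lemma matrix_apply_transfer [transfer_rule]:
  "(ring_rel R ===> ((=) ===> (=) ===> R) ===> rel_prod R R ===> rel_prod R R) matrix_apply matrix_apply"
  unfolding matrix_apply_def by transfer_prover

lemma valuation_ring_transfer [transfer_rule]:
  "(ring_rel R ===> (R ===> (=)) ===> rel_set R) valuation_ring valuation_ring"
  unfolding valuation_ring_def by transfer_prover

lemma lattices_transfer [transfer_rule]:
  "(ring_rel R ===> (R ===> (=)) ===> rel_set (rel_set (rel_prod R R))) lattices lattices"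
  unfolding lattices_def mem_Times_iff by transfer_prover

lemma homothety_class_transfer [transfer_rule]:
  "(ring_rel R ===> rel_set (rel_prod R R) ===> rel_set (rel_set (rel_prod R R))) homothety_class homothety_class"
  unfolding homothety_class_def by transfer_prover

lemma tree_vertices_transfer [transfer_rule]:
  "(ring_rel R ===> (R ===> (=)) ===> rel_set (rel_set (rel_set (rel_prod R R)))) tree_vertices tree_vertices"
  unfolding tree_vertices_def by transfer_prover

lemma tree_adjacent_transfer [transfer_rule]:
  "(ring_rel R ===> (R ===> (=)) ===> rel_set (rel_set (rel_prod R R)) ===> rel_set (rel_set (rel_prod R R)) ===> (=))
     tree_adjacent tree_adjacent"
  unfolding tree_adjacent_def by transfer_prover

lemma tree_action_transfer [transfer_rule]:
  "(ring_rel R ===> ((=) ===> (=) ===> R) ===> rel_set (rel_set (rel_prod R R)) ===> rel_set (rel_set (rel_prod R R)))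
     tree_action tree_action"
  unfolding tree_action_def by transfer_prover

end

text \<open>\<open>polyfuns\<close> is an inductive set, so its transfer rule rests on induction.
  One direction is proved here; the other one follows by applying it to the converse
  relations.\<close>

lemma polyfuns_related:
  assumes C: "(C ===> C ===> C) (+) (+)" "(C ===> C ===> C) (*) (*)"
    and K: "rel_set C K K'" and \<Phi>: "rel_set (A ===> C) \<Phi> \<Phi>'" and "f \<in> polyfuns K \<Phi>"
  shows "\<exists>f'\<in>polyfuns K' \<Phi>'. (A ===> C) f f'"
  using assms(5)
proof induction
  case (const c)
  then obtain c' where "c' \<in> K'" "C c c'" using K by (auto simp: rel_set_def)
  then show ?case by (intro bexI[of _ "\<lambda>_. c'"]) (auto intro: polyfuns.const)
next
  case (coord \<phi>)
  then obtain \<phi>' where "\<phi>' \<in> \<Phi>'" "(A ===> C) \<phi> \<phi>'" using \<Phi> unfolding rel_set_def by blast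
  then show ?case by (blast intro: polyfuns.coord)
next
  case (add f g)
  then obtain f' g' where *: "f' \<in> polyfuns K' \<Phi>'" "(A ===> C) f f'" "g' \<in> polyfuns K' \<Phi>'" "(A ===> C) g g'"
    by blast
  then show ?case using C(1)
    by (intro bexI[of _ "\<lambda>x. f' x + g' x"]) (auto intro!: polyfuns.add simp: rel_fun_def)
next
  case (mult f g)
  then obtain f' g' where *: "f' \<in> polyfuns K' \<Phi>'" "(A ===> C) f f'" "g' \<in> polyfuns K' \<Phi>'" "(A ===> C) g g'"
    by blast
  then show ?case using C(2)
    by (intro bexI[of _ "\<lambda>x. f' x * g' x"]) (auto intro!: polyfuns.mult simp: rel_fun_def)
qed

lemma rel_fun_conversep: "(A\<inverse>\<inverse> ===> B\<inverse>\<inverse>) = (A ===> B)\<inverse>\<inverse>"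
  by (auto simp: fun_eq_iff rel_fun_def)

abbreviation fraction_rel where
  "fraction_rel A C \<equiv> rel_set (rel_prod (A ===> C) (A ===> C))"

section \<open>Parametricity of algebraic sets, function fields and ideal points\<close>

context
  fixes C :: "complex \<Rightarrow> complex \<Rightarrow> bool" and A :: "'p \<Rightarrow> 'q \<Rightarrow> bool"
  assumes C [transfer_rule]: "bi_unique C" "bi_total C" "C 0 0" "C 1 1"
    "(C ===> C ===> C) (+) (+)" "(C ===> C ===> C) (*) (*)"
    and A [transfer_rule]: "bi_unique A" "bi_total A"
begin

lemma polyfuns_transfer [transfer_rule]:
  "(rel_set C ===> rel_set (A ===> C) ===> rel_set (A ===> C)) polyfuns polyfuns"
proof (intro rel_funI rel_setI)
  fix K K' \<Phi> \<Phi>' f assume *: "rel_set C K K'" "rel_set (A ===> C) \<Phi> \<Phi>'" "f \<in> polyfuns K \<Phi>"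
  show "\<exists>f'\<in>polyfuns K' \<Phi>'. (A ===> C) f f'" by (rule polyfuns_related[OF C(5,6) *])
next
  fix K K' \<Phi> \<Phi>' f assume *: "rel_set C K K'" "rel_set (A ===> C) \<Phi> \<Phi>'" "f \<in> polyfuns K' \<Phi>'"
  have "\<exists>f'\<in>polyfuns K \<Phi>. (A\<inverse>\<inverse> ===> C\<inverse>\<inverse>) f f'"
    by (rule polyfuns_related[OF _ _ _ _ *(3)])
      (use C(5,6) *(1,2) in \<open>simp_all add: rel_fun_conversep\<close>)
  then show "\<exists>f'\<in>polyfuns K \<Phi>. (A ===> C) f' f" by (simp add: rel_fun_conversep)
qed

lemma zero_set_transfer [transfer_rule]:
  "(rel_set A ===> rel_set (A ===> C) ===> rel_set A) zero_set zero_set"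
  unfolding zero_set_def by transfer_prover

lemma algebraic_subset_transfer [transfer_rule]:
  "(rel_set A ===> rel_set (A ===> C) ===> rel_set A ===> (=)) algebraic_subset algebraic_subset"
  unfolding algebraic_subset_def by transfer_prover

lemma irreducible_subset_transfer [transfer_rule]:
  "(rel_set A ===> rel_set (A ===> C) ===> rel_set A ===> (=)) irreducible_subset irreducible_subset"
  unfolding irreducible_subset_def by transfer_prover

lemma irreducible_components_transfer [transfer_rule]:
  "(rel_set A ===> rel_set (A ===> C) ===> rel_set (rel_set A)) irreducible_components irreducible_components"
  unfolding irreducible_components_def by transfer_prover

lemma irreducible_curve_transfer [transfer_rule]:
  "(rel_set A ===> rel_set (A ===> C) ===> rel_set A ===> (=)) irreducible_curve irreducible_curve"
  unfolding irreducible_curve_def by transfer_prover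

lemma fraction_transfer [transfer_rule]:
  "(rel_set (A ===> C) ===> rel_set A ===> (A ===> C) ===> (A ===> C) ===> fraction_rel A C) fraction fraction"
  unfolding fraction_def by transfer_prover

lemma function_field_transfer [transfer_rule]:
  "(rel_set (A ===> C) ===> rel_set A ===> ring_rel (fraction_rel A C)) function_field function_field"
proof (intro rel_funI)
  fix \<Phi> \<Phi>' Z Z' assume [transfer_rule]: "rel_set (A ===> C) \<Phi> \<Phi>'" "rel_set A Z Z'"
  show "ring_rel (fraction_rel A C) (function_field \<Phi> Z) (function_field \<Phi>' Z')"
    unfolding ring_rel_def function_field_def partial_object.simps monoid.simps ring.simps
  proof (intro conjI, goal_cases)
    case 1 show ?case by transfer_prover
  next
    case 2 show ?case by transfer_prover
  next
    case 3 show ?case by transfer_prover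
  next
    case 4 show ?case by transfer_prover
  next
    case 5 show ?case by transfer_prover
  qed
qed

lemma smooth_model_transfer [transfer_rule]:
  "(rel_set (A ===> C) ===> rel_set A ===> rel_set (fraction_rel A C ===> (=))) smooth_model smooth_model"
  unfolding smooth_model_def by transfer_prover

lemma ideal_points_transfer [transfer_rule]:
  "(rel_set (A ===> C) ===> rel_set A ===> rel_set (fraction_rel A C ===> (=))) ideal_points ideal_points"
  unfolding ideal_points_def by transfer_prover

lemma regular_at_fraction_related:
  assumes [transfer_rule]: "rel_set (A ===> C) \<Phi> \<Phi>'" "rel_set A Z Z'" "(fraction_rel A C ===> (=)) v v'" "(A ===> C) f f'"
  shows "regular_at (function_field \<Phi> Z) v (fraction \<Phi> Z f (\<lambda>_. 1)) \<longleftrightarrow>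
    regular_at (function_field \<Phi>' Z') v' (fraction \<Phi>' Z' f' (\<lambda>_. 1))"
  by transfer_prover

lemma valuation_fraction_related:
  assumes [transfer_rule]: "rel_set (A ===> C) \<Phi> \<Phi>'" "rel_set A Z Z'" "(fraction_rel A C ===> (=)) v v'" "(A ===> C) f f'"
    "(A ===> C) g g'"
  shows "v (fraction \<Phi> Z f g) = v' (fraction \<Phi>' Z' f' g')"
  by transfer_prover

lemma not_vanishing_related:
  assumes [transfer_rule]: "rel_set A Z Z'" "(A ===> C) f f'"
  shows "(\<exists>z\<in>Z. f z \<noteq> 0) \<longleftrightarrow> (\<exists>z\<in>Z'. f' z \<noteq> 0)"
  by transfer_prover

end

text \<open>A bijection of vertices relabels barycentric coordinates and nothing else. The new map
  meets the midpoints of edges at the same points of the universal cover, so the very same surface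
  is dual to the action on the isomorphic tree.\<close>

lemma dual_surface_transport:
  fixes R :: "'v \<Rightarrow> 'w \<Rightarrow> bool"
  assumes R: "bi_unique R" "bi_total R"
    and V: "rel_set R V V'" and E: "(R ===> R ===> (=)) E E'"
    and act: "\<And>\<gamma>. \<gamma> \<in> carrier (fundamental_group N x0) \<Longrightarrow> (R ===> R) (act \<gamma>) (act' \<gamma>)"
    and dual: "dual_surface N x0 V E act S"
  shows "dual_surface N x0 V' E' act' S"
proof -
  obtain \<psi> where \<psi>: "\<And>w. R (\<psi> w) w" using R(2) unfolding bi_total_def by metis
  have \<psi>_eq: "\<psi> w = u \<longleftrightarrow> R u w" for u w using \<psi> R(1) unfolding bi_unique_def by metis
  have surj: "\<exists>w. \<psi> w = u" for u using R(2) \<psi>_eq unfolding bi_total_def by metis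
  have inj: "\<psi> w = \<psi> w' \<longleftrightarrow> w = w'" for w w' using \<psi> R(1) unfolding bi_unique_def by metis
  have E\<psi>: "E' w w' = E (\<psi> w) (\<psi> w')" for w w' using E \<psi> unfolding rel_fun_def by metis
  have V\<psi>: "w \<in> V' \<Longrightarrow> \<psi> w \<in> V" for w using V \<psi>_eq unfolding rel_set_def by metis
  have act\<psi>: "\<psi> (act' \<gamma> w) = act \<gamma> (\<psi> w)" if "\<gamma> \<in> carrier (fundamental_group N x0)" for \<gamma> w
    using rel_funD[OF act[OF that] \<psi>[of w]] \<psi>_eq by metis
  define T where "T = universal_cover_topology N x0"
  define \<S> where "\<S> = {x \<in> universal_cover N x0. cover_projection x \<in> S}"
  have "\<exists>f. continuous_map T (realization E) f \<and>
        (\<forall>\<gamma>\<in>carrier (fundamental_group N x0). \<forall>x\<in>universal_cover N x0. \<forall>u\<in>V.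
           f (class_join N \<gamma> x) (act \<gamma> u) = f x u) \<and>
        \<S> = {x \<in> universal_cover N x0. \<exists>u. f x u = 1/2} \<and>
        (\<forall>x\<in>\<S>. \<exists>U \<epsilon> h u w. openin T U \<and> x \<in> U \<and> 0 < \<epsilon> \<and> E u w \<and>
           homeomorphic_map (prod_topology (subtopology T (U \<inter> \<S>)) (top_of_set {-\<epsilon><..<\<epsilon>}))
             (subtopology T U) h \<and>
           (\<forall>y\<in>U \<inter> \<S>. h (y, 0) = y \<and>
              (\<forall>t\<in>{-\<epsilon><..<\<epsilon>}. f (h (y, t)) u = 1/2 + t \<and> f (h (y, t)) w = 1/2 - t)))"
    (is "\<exists>f. ?P1 f \<and> ?P2 f \<and> ?P3 f \<and> ?P4 f")
    using dual unfolding dual_surface_def Let_def T_def \<S>_def .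
  then obtain f where f: "?P1 f" "?P2 f" "?P3 f" "?P4 f" by (elim exE conjE) (rule that)
  \<comment> \<open>Continuity is inherited coordinate by coordinate, as the realization carries the
    topology of pointwise convergence.\<close>
  define f' where "f' x w = f x (\<psi> w)" for x w
  have "continuous_map T (realization E') f'"
    unfolding realization_def continuous_map_in_subtopology
  proof
    have c: "continuous_map T (powertop_real UNIV) f" and m: "f ` topspace T \<subseteq>
      {b. \<exists>u w. E u w \<and> (\<forall>x. x \<noteq> u \<and> x \<noteq> w \<longrightarrow> b x = 0) \<and> 0 \<le> b u \<and> 0 \<le> b w \<and> b u + b w = 1}"
      using f(1) unfolding realization_def continuous_map_in_subtopology by auto
    show "continuous_map T (powertop_real UNIV) f'"
      using c unfolding f'_def continuous_map_componentwise_UNIV by simp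
    show "f' \<in> topspace T \<rightarrow>
      {b. \<exists>u w. E' u w \<and> (\<forall>x. x \<noteq> u \<and> x \<noteq> w \<longrightarrow> b x = 0) \<and> 0 \<le> b u \<and> 0 \<le> b w \<and> b u + b w = 1}"
    proof
      fix x assume "x \<in> topspace T"
      then obtain u w where uw: "E u w" "\<And>y. y \<noteq> u \<and> y \<noteq> w \<Longrightarrow> f x y = 0" "0 \<le> f x u" "0 \<le> f x w" "f x u + f x w = 1"
        using m by blast
      obtain u' w' where uw': "\<psi> u' = u" "\<psi> w' = w" using surj by blast
      have "f' x y = 0" if "y \<noteq> u' \<and> y \<noteq> w'" for y
        unfolding f'_def using that uw(2)[of "\<psi> y"] uw' inj by metis
      then show "f' x \<in> {b. \<exists>u w. E' u w \<and> (\<forall>x. x \<noteq> u \<and> x \<noteq> w \<longrightarrow> b x = 0) \<and> 0 \<le> b u \<and> 0 \<le> b w \<and> b u + b w = 1}"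
        using uw uw' by (intro CollectI exI[of _ u'] exI[of _ w']) (auto simp: f'_def E\<psi>)
    qed
  qed
  moreover have "\<forall>\<gamma>\<in>carrier (fundamental_group N x0). \<forall>x\<in>universal_cover N x0. \<forall>u\<in>V'.
    f' (class_join N \<gamma> x) (act' \<gamma> u) = f' x u"
  proof (intro ballI)
    fix \<gamma> x u assume *: "\<gamma> \<in> carrier (fundamental_group N x0)" "x \<in> universal_cover N x0" "u \<in> V'"
    show "f' (class_join N \<gamma> x) (act' \<gamma> u) = f' x u"
      using bspec[OF bspec[OF bspec[OF f(2) *(1)] *(2)] V\<psi>[OF *(3)]] act\<psi>[OF *(1)]
      by (simp add: f'_def)
  qed
  moreover have "\<S> = {x \<in> universal_cover N x0. \<exists>u. f' x u = 1/2}"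
  proof -
    have "(\<exists>u. f x u = 1/2) \<longleftrightarrow> (\<exists>u. f' x u = 1/2)" for x unfolding f'_def using surj by metis
    then show ?thesis using f(3) by simp
  qed
  moreover have "\<forall>x\<in>\<S>. \<exists>U \<epsilon> h u w. openin T U \<and> x \<in> U \<and> 0 < \<epsilon> \<and> E' u w \<and>
           homeomorphic_map (prod_topology (subtopology T (U \<inter> \<S>)) (top_of_set {-\<epsilon><..<\<epsilon>}))
             (subtopology T U) h \<and>
           (\<forall>y\<in>U \<inter> \<S>. h (y, 0) = y \<and>
              (\<forall>t\<in>{-\<epsilon><..<\<epsilon>}. f' (h (y, t)) u = 1/2 + t \<and> f' (h (y, t)) w = 1/2 - t))"
  proof
    fix x assume "x \<in> \<S>"
    from bspec[OF f(4) this] obtain U \<epsilon> h u w where *: "openin T U" "x \<in> U" "0 < \<epsilon>" "E u w"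
      "homeomorphic_map (prod_topology (subtopology T (U \<inter> \<S>)) (top_of_set {-\<epsilon><..<\<epsilon>})) (subtopology T U) h"
      "\<forall>y\<in>U \<inter> \<S>. h (y, 0) = y \<and> (\<forall>t\<in>{-\<epsilon><..<\<epsilon>}. f (h (y, t)) u = 1/2 + t \<and> f (h (y, t)) w = 1/2 - t)"
      by blast
    obtain u' w' where uw': "\<psi> u' = u" "\<psi> w' = w" using surj by blast
    have "E' u' w'" using *(4) uw' by (simp add: E\<psi>)
    moreover have "\<forall>y\<in>U \<inter> \<S>. h (y, 0) = y \<and> (\<forall>t\<in>{-\<epsilon><..<\<epsilon>}. f' (h (y, t)) u' = 1/2 + t \<and> f' (h (y, t)) w' = 1/2 - t)"
      unfolding f'_def uw' by (rule *(6))
    ultimately show "\<exists>U \<epsilon> h u w. openin T U \<and> x \<in> U \<and> 0 < \<epsilon> \<and> E' u w \<and>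
           homeomorphic_map (prod_topology (subtopology T (U \<inter> \<S>)) (top_of_set {-\<epsilon><..<\<epsilon>}))
             (subtopology T U) h \<and>
           (\<forall>y\<in>U \<inter> \<S>. h (y, 0) = y \<and>
              (\<forall>t\<in>{-\<epsilon><..<\<epsilon>}. f' (h (y, t)) u = 1/2 + t \<and> f' (h (y, t)) w = 1/2 - t))"
      using *(1-3,5) by (intro exI[of _ U] exI conjI)
  qed
  ultimately show ?thesis
    unfolding dual_surface_def Let_def T_def[symmetric] \<S>_def[symmetric]
    by (intro exI[of _ f'] conjI)
qed

end

text \<open>The action of \<open>\<sigma>\<close> on characters and representations leaves the values outside the group
  alone: there they are \<open>undefined\<close>, which \<open>\<sigma>\<close> need not fix.\<close>

definition map_on :: "'g set \<Rightarrow> ('b \<Rightarrow> 'b) \<Rightarrow> ('g \<Rightarrow> 'b) \<Rightarrow> 'g \<Rightarrow> 'b" where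
  "map_on S m f = (\<lambda>\<gamma>. if \<gamma> \<in> S then m (f \<gamma>) else f \<gamma>)"

lemma bij_map_on:
  assumes "bij m" shows "bij (map_on S m)"
proof (rule o_bij)
  show "map_on S (inv_into UNIV m) \<circ> map_on S m = id" "map_on S m \<circ> map_on S (inv_into UNIV m) = id"
    using assms by (auto simp: map_on_def fun_eq_iff bij_is_inj bij_is_surj surj_f_inv_f)
qed

definition matrix_aut :: "(complex \<Rightarrow> complex) \<Rightarrow> complex ^ 2 ^ 2 \<Rightarrow> complex ^ 2 ^ 2" where
  "matrix_aut \<sigma> M = (\<chi> i j. \<sigma> (M $ i $ j))"

lemma bij_matrix_aut:
  assumes "bij \<sigma>" shows "bij (matrix_aut \<sigma>)"
proof (rule o_bij)
  show "matrix_aut (inv_into UNIV \<sigma>) \<circ> matrix_aut \<sigma> = id" "matrix_aut \<sigma> \<circ> matrix_aut (inv_into UNIV \<sigma>) = id"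
    using assms by (auto simp: matrix_aut_def fun_eq_iff vec_eq_iff bij_is_inj bij_is_surj surj_f_inv_f)
qed

lemma field_aut_inv:
  assumes "field_aut \<sigma>" shows "field_aut (inv_into UNIV \<sigma>)"
proof -
  have b: "bij \<sigma>" using assms by (rule field_aut_bij)
  then have s: "\<sigma> (inv_into UNIV \<sigma> a) = a" "inv_into UNIV \<sigma> (\<sigma> a) = a" for a
    by (simp_all add: bij_is_inj bij_is_surj surj_f_inv_f)
  have "inv_into UNIV \<sigma> (a + b) = inv_into UNIV \<sigma> a + inv_into UNIV \<sigma> b" "inv_into UNIV \<sigma> (a * b) = inv_into UNIV \<sigma> a * inv_into UNIV \<sigma> b" for a b
    using field_aut_add[OF assms, of "inv_into UNIV \<sigma> a" "inv_into UNIV \<sigma> b"] field_aut_mult[OF assms, of "inv_into UNIV \<sigma> a" "inv_into UNIV \<sigma> b"] s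
    by metis+
  then show ?thesis using b by (simp add: field_aut_def bij_imp_bij_inv)
qed

context
  fixes \<sigma> :: "complex \<Rightarrow> complex"
  assumes \<sigma>: "field_aut \<sigma>"
begin

lemma det_matrix_aut: "det (matrix_aut \<sigma> M) = \<sigma> (det M)"
  by (simp add: matrix_aut_def det_2 field_aut_mult[OF \<sigma>] field_aut_diff[OF \<sigma>])

lemma trace_matrix_aut: "trace (matrix_aut \<sigma> M) = \<sigma> (trace M)"
  by (simp add: matrix_aut_def trace_2 field_aut_add[OF \<sigma>])

lemma mult_matrix_aut: "matrix_aut \<sigma> (M ** M') = matrix_aut \<sigma> M ** matrix_aut \<sigma> M'"
  by (simp add: matrix_aut_def vec_eq_iff matrix_mult_2 field_aut_mult[OF \<sigma>] field_aut_add[OF \<sigma>])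

end

lemma rel_set_graph: "rel_set (\<lambda>x y. y = s x) X (s ` X)"
  by (auto simp: rel_set_def)

lemma rel_set_graph_iff: "rel_set (\<lambda>x y. y = s x) X Y \<longleftrightarrow> Y = s ` X"
  by (auto simp: rel_set_def)

lemma rel_set_same: "(\<And>x. x \<in> X \<Longrightarrow> R x x) \<Longrightarrow> rel_set R X X"
  by (auto simp: rel_set_def)

lemma bi_unique_graph: "bij s \<Longrightarrow> bi_unique (\<lambda>x y. y = s x)"
  by (auto simp: bi_unique_def bij_is_inj inj_eq)

lemma bi_total_graph: "bij s \<Longrightarrow> bi_total (\<lambda>x y. y = s x)"
  by (auto simp: bi_total_def) (meson bij_pointE)

context
  fixes N :: "'a::topological_space set" and x0 :: 'a
  assumes x0: "x0 \<in> N"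
begin

abbreviation "loop_classes \<equiv> carrier (fundamental_group N x0)"
abbreviation "char_aut \<sigma> \<equiv> map_on loop_classes \<sigma> :: ((real \<Rightarrow> 'a) set \<Rightarrow> complex) \<Rightarrow> _"
abbreviation "rep_aut \<sigma> \<equiv> map_on loop_classes (matrix_aut \<sigma>) :: ((real \<Rightarrow> 'a) set \<Rightarrow> complex ^ 2 ^ 2) \<Rightarrow> _"

text \<open>Determinant one and multiplicativity are polynomial conditions with integer
  coefficients, which \<sigma> preserves.\<close>

lemma rep_aut_rep_variety:
  assumes \<sigma>: "field_aut \<sigma>" and \<rho>: "\<rho> \<in> rep_variety N x0"
  shows "rep_aut \<sigma> \<rho> \<in> rep_variety N x0"
proof -
  have h: "\<rho> a \<in> carrier SL2C" "\<rho> (a \<otimes>\<^bsub>fundamental_group N x0\<^esub> b) = \<rho> a \<otimes>\<^bsub>SL2C\<^esub> \<rho> b"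
    if "a \<in> loop_classes" "b \<in> loop_classes" for a b
    using \<rho> that by (auto simp: rep_variety_def hom_def)
  have "rep_aut \<sigma> \<rho> \<in> hom (fundamental_group N x0) SL2C"
  proof (rule homI)
    fix a assume "a \<in> loop_classes"
    then show "rep_aut \<sigma> \<rho> a \<in> carrier SL2C"
      using h(1) by (simp add: map_on_def SL2C_def det_matrix_aut[OF \<sigma>] field_aut_1[OF \<sigma>])
    fix b assume "b \<in> loop_classes"
    have "a \<otimes>\<^bsub>fundamental_group N x0\<^esub> b \<in> loop_classes"
      using \<open>a \<in> loop_classes\<close> \<open>b \<in> loop_classes\<close> group_fundamental_group[OF x0]
      by (simp add: group.is_monoid monoid.m_closed)
    then show "rep_aut \<sigma> \<rho> (a \<otimes>\<^bsub>fundamental_group N x0\<^esub> b) = rep_aut \<sigma> \<rho> a \<otimes>\<^bsub>SL2C\<^esub> rep_aut \<sigma> \<rho> b"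
      using h \<open>a \<in> loop_classes\<close> \<open>b \<in> loop_classes\<close> by (simp add: map_on_def SL2C_def mult_matrix_aut[OF \<sigma>])
  qed
  then show ?thesis using \<rho> by (auto simp: rep_variety_def extensional_def map_on_def)
qed

lemma character_rep_aut: "field_aut \<sigma> \<Longrightarrow> character N x0 (rep_aut \<sigma> \<rho>) = char_aut \<sigma> (character N x0 \<rho>)"
  by (auto simp: character_def map_on_def trace_matrix_aut fun_eq_iff)

lemma map_on_inv:
  assumes "bij m" shows "map_on S m (map_on S (inv_into UNIV m) f) = f"
  using assms by (auto simp: map_on_def bij_is_surj surj_f_inv_f)

lemma inv_matrix_aut:
  assumes "bij \<sigma>" shows "inv_into UNIV (matrix_aut \<sigma>) = matrix_aut (inv_into UNIV \<sigma>)"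
proof (rule inv_unique_comp)
  show "matrix_aut \<sigma> \<circ> matrix_aut (inv_into UNIV \<sigma>) = id" "matrix_aut (inv_into UNIV \<sigma>) \<circ> matrix_aut \<sigma> = id"
    using assms by (auto simp: matrix_aut_def fun_eq_iff vec_eq_iff bij_is_inj bij_is_surj surj_f_inv_f)
qed

lemma rep_aut_image:
  assumes \<sigma>: "field_aut \<sigma>"
  shows "rep_aut \<sigma> ` rep_variety N x0 = rep_variety N x0"
proof
  show "rep_aut \<sigma> ` rep_variety N x0 \<subseteq> rep_variety N x0" using rep_aut_rep_variety[OF \<sigma>] by auto
  show "rep_variety N x0 \<subseteq> rep_aut \<sigma> ` rep_variety N x0"
  proof
    fix \<rho> assume \<rho>: "\<rho> \<in> rep_variety N x0"
    have "\<rho> = rep_aut \<sigma> (rep_aut (inv_into UNIV \<sigma>) \<rho>)"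
      using map_on_inv[OF bij_matrix_aut, of \<sigma> loop_classes \<rho>] inv_matrix_aut[of \<sigma>] field_aut_bij[OF \<sigma>] by simp
    then show "\<rho> \<in> rep_aut \<sigma> ` rep_variety N x0"
      using rep_aut_rep_variety[OF field_aut_inv[OF \<sigma>] \<rho>] by blast
  qed
qed

lemma char_aut_image:
  assumes \<sigma>: "field_aut \<sigma>"
  shows "char_aut \<sigma> ` char_variety N x0 = char_variety N x0"
proof -
  have "char_aut \<sigma> ` char_variety N x0 = character N x0 ` (rep_aut \<sigma> ` rep_variety N x0)"
    unfolding char_variety_def image_image character_rep_aut[OF \<sigma>] ..
  then show ?thesis unfolding rep_aut_image[OF \<sigma>] by (simp add: char_variety_def)
qed

section \<open>Transport of curves, ideal points and detection\<close>

context
  includes lifting_syntax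
  fixes \<sigma> assumes \<sigma>: "field_aut \<sigma>"
begin

text \<open>The graphs of the action of \<sigma> on scalars, characters and representations, along
  which everything is transferred.\<close>

definition "eqC = (\<lambda>a b. b = \<sigma> a)"
definition "eqX = (\<lambda>x y. y = char_aut \<sigma> x)"
definition "eqR = (\<lambda>x y. y = rep_aut \<sigma> x)"

lemma eqC: "bi_unique eqC" "bi_total eqC" "eqC 0 0" "eqC 1 1"
    "(eqC ===> eqC ===> eqC) (+) (+)" "(eqC ===> eqC ===> eqC) (*) (*)"
  unfolding eqC_def using field_aut_bij[OF \<sigma>]
  by (auto simp: bi_unique_graph bi_total_graph field_aut_0[OF \<sigma>] field_aut_1[OF \<sigma>]
      field_aut_add[OF \<sigma>] field_aut_mult[OF \<sigma>] rel_fun_def)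

lemma eqX: "bi_unique eqX" "bi_total eqX"
  unfolding eqX_def
  by (rule bi_unique_graph[OF bij_map_on[OF field_aut_bij[OF \<sigma>]]],
      rule bi_total_graph[OF bij_map_on[OF field_aut_bij[OF \<sigma>]]])

lemma eqR: "bi_unique eqR" "bi_total eqR"
  unfolding eqR_def
  by (rule bi_unique_graph[OF bij_map_on[OF bij_matrix_aut[OF field_aut_bij[OF \<sigma>]]]],
      rule bi_total_graph[OF bij_map_on[OF bij_matrix_aut[OF field_aut_bij[OF \<sigma>]]]])

lemma rel_char_variety: "rel_set eqX (char_variety N x0) (char_variety N x0)"
  unfolding eqX_def rel_set_graph_iff using char_aut_image[OF \<sigma>] by simp

lemma rel_rep_variety: "rel_set eqR (rep_variety N x0) (rep_variety N x0)"
  unfolding eqR_def rel_set_graph_iff using rep_aut_image[OF \<sigma>] by simp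

text \<open>Evaluation at a loop class commutes with \<sigma>, so each coordinate is related to
  itself. Here it enters that the coordinates are rational.\<close>

lemma rel_trace_function: "\<gamma> \<in> loop_classes \<Longrightarrow> (eqX ===> eqC) (trace_function \<gamma>) (trace_function \<gamma>)"
  by (auto simp: rel_fun_def eqX_def eqC_def trace_function_def map_on_def)

lemma rel_entry: "\<gamma> \<in> loop_classes \<Longrightarrow> (eqR ===> eqC) (\<lambda>\<rho>. \<rho> \<gamma> $ i $ j) (\<lambda>\<rho>. \<rho> \<gamma> $ i $ j)"
  by (auto simp: rel_fun_def eqR_def eqC_def map_on_def matrix_aut_def)

lemma rel_one: "(eqR ===> eqC) (\<lambda>_. 1) (\<lambda>_. 1)"
  using eqC(4) by (simp add: rel_fun_def)

lemma rel_char_coords: "rel_set (eqX ===> eqC) (char_coords N x0) (char_coords N x0)"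
  by (rule rel_set_same) (auto simp: char_coords_def rel_trace_function)

lemma rel_rep_coords: "rel_set (eqR ===> eqC) (rep_coords N x0) (rep_coords N x0)"
  by (rule rel_set_same) (auto simp: rep_coords_def rel_entry)

lemma rel_character: "(eqR ===> eqX) (character N x0) (character N x0)"
  using character_rep_aut[OF \<sigma>] by (auto simp: rel_fun_def eqR_def eqX_def)

lemma rel_X: "rel_set eqX Z (char_aut \<sigma> ` Z)"
  unfolding eqX_def by (rule rel_set_graph)

lemma rel_R: "rel_set eqR Z (rep_aut \<sigma> ` Z)"
  unfolding eqR_def by (rule rel_set_graph)

lemmas X_transfer =
  irreducible_curve_transfer[OF eqC eqX, THEN rel_funD, THEN rel_funD, THEN rel_funD, OF rel_char_variety rel_char_coords rel_X]
  irreducible_components_transfer[OF eqC eqX, THEN rel_funD, THEN rel_funD, OF rel_char_variety rel_char_coords]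
  ideal_points_transfer[OF eqC eqX, THEN rel_funD, THEN rel_funD, OF rel_char_coords rel_X]
  polyfuns_transfer[OF eqC eqX, THEN rel_funD, THEN rel_funD, OF UNIV_transfer[OF eqC(2)] rel_char_coords]

text \<open>An algebraic set \<open>Y\<close> containing the moved image is the image under \<sigma>
  of its preimage, which is algebraic by transfer.\<close>

lemma maps_dominantly_aut:
  assumes "maps_dominantly N x0 D Z"
  shows "maps_dominantly N x0 (rep_aut \<sigma> ` D) (char_aut \<sigma> ` Z)"
  unfolding maps_dominantly_def
proof (intro conjI allI impI)
  have im: "character N x0 ` rep_aut \<sigma> ` D = char_aut \<sigma> ` character N x0 ` D"
    unfolding image_image character_rep_aut[OF \<sigma>] ..
  show "character N x0 ` rep_aut \<sigma> ` D \<subseteq> char_aut \<sigma> ` Z"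
    unfolding im using assms by (auto simp: maps_dominantly_def)
  fix Y assume Y: "algebraic_subset (char_variety N x0) (char_coords N x0) Y \<and> character N x0 ` rep_aut \<sigma> ` D \<subseteq> Y"
  define Y0 where "Y0 = char_aut \<sigma> -` Y"
  have s: "surj (char_aut \<sigma>)" using bij_map_on[OF field_aut_bij[OF \<sigma>]] bij_is_surj by blast
  then have Y_eq: "Y = char_aut \<sigma> ` Y0" by (simp add: Y0_def surj_image_vimage_eq)
  then have "rel_set eqX Y0 Y" using rel_X by simp
  from algebraic_subset_transfer[OF eqC eqX, THEN rel_funD, THEN rel_funD, THEN rel_funD,
      OF rel_char_variety rel_char_coords this]
  have "algebraic_subset (char_variety N x0) (char_coords N x0) Y0" using Y by simp
  moreover have "character N x0 ` D \<subseteq> Y0" using Y unfolding im Y0_def by auto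
  ultimately have "Z \<subseteq> Y0" using assms by (simp add: maps_dominantly_def)
  then show "char_aut \<sigma> ` Z \<subseteq> Y" unfolding Y_eq by (rule image_mono)
qed

text \<open>The ramification index \<open>e\<close> is unchanged: the functions on the moved curve
  come from the original one, and corresponding fractions have equal valuations.\<close>

lemma extends_valuation_aut:
  assumes ext: "extends_valuation N x0 Z v D w"
    and v: "(fraction_rel eqX eqC ===> (=)) v v'" and w: "(fraction_rel eqR eqC ===> (=)) w w'"
  shows "extends_valuation N x0 (char_aut \<sigma> ` Z) v' (rep_aut \<sigma> ` D) w'"
proof -
  obtain e :: int where e: "e > 0" "\<And>f g. f \<in> polyfuns UNIV (char_coords N x0) \<Longrightarrow> g \<in> polyfuns UNIV (char_coords N x0) \<Longrightarrow>
      \<exists>z\<in>Z. f z \<noteq> 0 \<Longrightarrow> \<exists>z\<in>Z. g z \<noteq> 0 \<Longrightarrow>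
      w (fraction (rep_coords N x0) D (f \<circ> character N x0) (g \<circ> character N x0)) =
          e * v (fraction (char_coords N x0) Z f g)"
    using ext unfolding extends_valuation_def by blast
  have "w' (fraction (rep_coords N x0) (rep_aut \<sigma> ` D) (f \<circ> character N x0) (g \<circ> character N x0)) =
          e * v' (fraction (char_coords N x0) (char_aut \<sigma> ` Z) f g)"
    if fg: "f \<in> polyfuns UNIV (char_coords N x0)" "g \<in> polyfuns UNIV (char_coords N x0)"
      "\<exists>z\<in>char_aut \<sigma> ` Z. f z \<noteq> 0" "\<exists>z\<in>char_aut \<sigma> ` Z. g z \<noteq> 0" for f g
  proof -
    obtain f0 g0 where f0: "f0 \<in> polyfuns UNIV (char_coords N x0)" "(eqX ===> eqC) f0 f"
      and g0: "g0 \<in> polyfuns UNIV (char_coords N x0)" "(eqX ===> eqC) g0 g"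
      using rel_setD2[OF X_transfer(4) fg(1)] rel_setD2[OF X_transfer(4) fg(2)] by blast
    have nz: "\<exists>z\<in>Z. f0 z \<noteq> 0" "\<exists>z\<in>Z. g0 z \<noteq> 0"
      using not_vanishing_related[OF eqC eqX rel_X f0(2)] not_vanishing_related[OF eqC eqX rel_X g0(2)] fg(3,4)
      by simp_all
    have comp: "(eqR ===> eqC) (h0 \<circ> character N x0) (h \<circ> character N x0)" if "(eqX ===> eqC) h0 h" for h0 h
      using that rel_character by (auto simp: rel_fun_def)
    show ?thesis
      using e(2)[OF f0(1) g0(1) nz]
        valuation_fraction_related[OF eqC eqX rel_char_coords rel_X v f0(2) g0(2)]
        valuation_fraction_related[OF eqC eqR rel_rep_coords rel_R w comp[OF f0(2)] comp[OF g0(2)]]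
      by simp
  qed
  then show ?thesis using e(1) unfolding extends_valuation_def by blast
qed

text \<open>\<sigma> moves the curve \<open>D\<close> of representations and the valuation
  \<open>w\<close> on it. The function fields become isomorphic, with corresponding tautological
  matrix entries; this induces an equivariant isomorphism of trees, under which \<open>S\<close>
  stays dual.\<close>

lemma associated_surface_aut:
  assumes ass: "associated_surface N x0 Z v S" and v: "(fraction_rel eqX eqC ===> (=)) v v'"
  shows "associated_surface N x0 (char_aut \<sigma> ` Z) v' S"
proof -
  obtain D w where S: "essential_surface N S" and D: "irreducible_curve (rep_variety N x0) (rep_coords N x0) D"
    "maps_dominantly N x0 D Z" "w \<in> smooth_model (rep_coords N x0) D" "extends_valuation N x0 Z v D w"
    and dual: "dual_surface N x0 (tree_vertices (function_field (rep_coords N x0) D) w)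
      (tree_adjacent (function_field (rep_coords N x0) D) w)
      (\<lambda>\<gamma>. tree_action (function_field (rep_coords N x0) D) (tautological_rep N x0 D \<gamma>)) S"
    using ass unfolding associated_surface_def Let_def by blast
  let ?FR = "fraction_rel eqR eqC" and ?D = "rep_aut \<sigma> ` D"
  let ?L = "rel_set (rel_set (rel_prod ?FR ?FR))"
  have FR: "bi_unique ?FR" "bi_total ?FR"
    by (intro bi_unique_rel_set bi_total_rel_set prod.bi_unique_rel prod.bi_total_rel
        bi_unique_fun bi_total_fun eqC eqR)+
  have L: "bi_unique ?L" "bi_total ?L"
    by (intro bi_unique_rel_set bi_total_rel_set prod.bi_unique_rel prod.bi_total_rel FR)+
  note coords = rel_rep_coords rel_R[of D]
  have F: "ring_rel ?FR (function_field (rep_coords N x0) D) (function_field (rep_coords N x0) ?D)"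
    by (rule function_field_transfer[OF eqC eqR, THEN rel_funD, THEN rel_funD, OF coords])
  obtain w' where w': "w' \<in> smooth_model (rep_coords N x0) ?D" "(?FR ===> (=)) w w'"
    using rel_setD1[OF smooth_model_transfer[OF eqC eqR, THEN rel_funD, THEN rel_funD, OF coords] D(3)] by blast
  have taut: "((=) ===> (=) ===> ?FR) (tautological_rep N x0 D \<gamma>) (tautological_rep N x0 ?D \<gamma>)"
    if \<gamma>: "\<gamma> \<in> loop_classes" for \<gamma>
    unfolding tautological_rep_def
    by (intro rel_funI, clarify)
      (rule fraction_transfer[OF eqC eqR, THEN rel_funD, THEN rel_funD, THEN rel_funD, THEN rel_funD,
        OF coords rel_entry[OF \<gamma>] rel_one])
  have "dual_surface N x0 (tree_vertices (function_field (rep_coords N x0) ?D) w')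
      (tree_adjacent (function_field (rep_coords N x0) ?D) w')
      (\<lambda>\<gamma>. tree_action (function_field (rep_coords N x0) ?D) (tautological_rep N x0 ?D \<gamma>)) S"
  proof (rule dual_surface_transport[OF L _ _ _ dual])
    show "rel_set ?L (tree_vertices (function_field (rep_coords N x0) D) w) (tree_vertices (function_field (rep_coords N x0) ?D) w')"
      by (rule tree_vertices_transfer[OF FR, THEN rel_funD, THEN rel_funD, OF F w'(2)])
    show "(rel_set (rel_set (rel_prod ?FR ?FR)) ===> rel_set (rel_set (rel_prod ?FR ?FR)) ===> (=))
      (tree_adjacent (function_field (rep_coords N x0) D) w) (tree_adjacent (function_field (rep_coords N x0) ?D) w')"
      by (rule tree_adjacent_transfer[OF FR, THEN rel_funD, THEN rel_funD, OF F w'(2)])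
    fix \<gamma> assume "\<gamma> \<in> loop_classes"
    from tree_action_transfer[OF FR, THEN rel_funD, THEN rel_funD, OF F taut[OF this]]
    show "(rel_set (rel_set (rel_prod ?FR ?FR)) ===> rel_set (rel_set (rel_prod ?FR ?FR)))
      (tree_action (function_field (rep_coords N x0) D) (tautological_rep N x0 D \<gamma>))
      (tree_action (function_field (rep_coords N x0) ?D) (tautological_rep N x0 ?D \<gamma>))" .
  qed
  moreover have "irreducible_curve (rep_variety N x0) (rep_coords N x0) ?D"
    using irreducible_curve_transfer[OF eqC eqR, THEN rel_funD, THEN rel_funD, THEN rel_funD,
        OF rel_rep_variety coords] D(1) by simp
  ultimately show ?thesis
    using S maps_dominantly_aut[OF D(2)] w'(1) extends_valuation_aut[OF D(4) v w'(2)]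
    unfolding associated_surface_def Let_def by blast
qed

lemma ideal_point_aut:
  assumes "irreducible_curve (char_variety N x0) (char_coords N x0) Z" "v \<in> ideal_points (char_coords N x0) Z"
  obtains v' where "irreducible_curve (char_variety N x0) (char_coords N x0) (char_aut \<sigma> ` Z)"
    "v' \<in> ideal_points (char_coords N x0) (char_aut \<sigma> ` Z)" "(fraction_rel eqX eqC ===> (=)) v v'"
proof -
  obtain v' where "v' \<in> ideal_points (char_coords N x0) (char_aut \<sigma> ` Z)" "(fraction_rel eqX eqC ===> (=)) v v'"
    using rel_setD1[OF X_transfer(3) assms(2)] by (elim bexE)
  moreover have "irreducible_curve (char_variety N x0) (char_coords N x0) (char_aut \<sigma> ` Z)"
    using X_transfer(1)[of Z] assms(1) by simp
  ultimately show thesis using that by metis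
qed

lemma detects_closed_surface_aut:
  assumes "detects_closed_surface N x0 Z"
  shows "detects_closed_surface N x0 (char_aut \<sigma> ` Z)"
proof -
  obtain Y v where Y: "irreducible_curve (char_variety N x0) (char_coords N x0) Y" "Y \<subseteq> Z"
    "v \<in> ideal_points (char_coords N x0) Y" and reg:
    "\<And>\<gamma>. \<gamma> \<in> peripheral N x0 \<Longrightarrow> regular_at (function_field (char_coords N x0) Y) v
           (fraction (char_coords N x0) Y (trace_function \<gamma>) (\<lambda>_. 1))"
    using assms unfolding detects_closed_surface_def by blast
  obtain v' where v': "irreducible_curve (char_variety N x0) (char_coords N x0) (char_aut \<sigma> ` Y)"
    "v' \<in> ideal_points (char_coords N x0) (char_aut \<sigma> ` Y)" "(fraction_rel eqX eqC ===> (=)) v v'"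
    by (rule ideal_point_aut[OF Y(1,3)])
  have "regular_at (function_field (char_coords N x0) (char_aut \<sigma> ` Y)) v'
           (fraction (char_coords N x0) (char_aut \<sigma> ` Y) (trace_function \<gamma>) (\<lambda>_. 1))"
    if "\<gamma> \<in> peripheral N x0" for \<gamma>
  proof -
    have "\<gamma> \<in> loop_classes" using that by (auto simp: peripheral_def)
    from regular_at_fraction_related[OF eqC eqX rel_char_coords rel_X v'(3) rel_trace_function[OF this]]
    show ?thesis using reg[OF that] by simp
  qed
  then show ?thesis
    using v'(1,2) image_mono[OF Y(2)] unfolding detects_closed_surface_def
    by (intro exI[of _ "char_aut \<sigma> ` Y"] exI[of _ v'] conjI ballI)
qed

lemma detects_slope_aut:
  assumes "detects_slope N x0 Z \<alpha>"
  shows "detects_slope N x0 (char_aut \<sigma> ` Z) \<alpha>"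
proof -
  obtain Y v S where Y: "irreducible_curve (char_variety N x0) (char_coords N x0) Y" "Y \<subseteq> Z"
    "v \<in> ideal_points (char_coords N x0) Y"
    and S: "associated_surface N x0 Y v S" "S \<inter> bdry N \<noteq> {}" "components (S \<inter> bdry N) \<subseteq> \<alpha>"
    using assms unfolding detects_slope_def by blast
  obtain v' where v': "irreducible_curve (char_variety N x0) (char_coords N x0) (char_aut \<sigma> ` Y)"
    "v' \<in> ideal_points (char_coords N x0) (char_aut \<sigma> ` Y)" "(fraction_rel eqX eqC ===> (=)) v v'"
    by (rule ideal_point_aut[OF Y(1,3)])
  show ?thesis
    using v'(1,2) image_mono[OF Y(2)] associated_surface_aut[OF S(1) v'(3)] S(2,3)
    unfolding detects_slope_def
    by (intro exI[of _ "char_aut \<sigma> ` Y"] exI[of _ v'] exI[of _ S] conjI)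
qed

lemma irreducible_component_aut:
  assumes "Z \<in> irreducible_components (char_variety N x0) (char_coords N x0)"
  shows "char_aut \<sigma> ` Z \<in> irreducible_components (char_variety N x0) (char_coords N x0)"
  using rel_setD1[OF X_transfer(2) assms] by (auto simp: eqX_def rel_set_graph_iff)

end

lemma char_aut_inv:
  assumes "field_aut \<sigma>"
  shows "char_aut \<sigma> (char_aut (inv_into UNIV \<sigma>) x) = x" "char_aut (inv_into UNIV \<sigma>) (char_aut \<sigma> x) = x"
  using field_aut_bij[OF assms] by (auto simp: map_on_def bij_is_inj bij_is_surj surj_f_inv_f)

text \<open>Detection is transported in one direction only; the equivalences result from using the
  inverse automorphism as well.\<close>

lemma same_detection_union_aut:
  assumes \<sigma>: "field_aut \<sigma>"
  shows "char_aut \<sigma> ` same_detection_union N x0 Y \<subseteq> same_detection_union N x0 Y"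
proof
  fix x assume "x \<in> char_aut \<sigma> ` same_detection_union N x0 Y"
  then obtain Z where Z: "Z \<in> irreducible_components (char_variety N x0) (char_coords N x0)"
    "detects_closed_surface N x0 Z \<longleftrightarrow> detects_closed_surface N x0 Y"
    "\<forall>\<alpha>\<in>slopes N. detects_slope N x0 Z \<alpha> \<longleftrightarrow> detects_slope N x0 Y \<alpha>"
    and x: "x \<in> char_aut \<sigma> ` Z" unfolding same_detection_union_def by blast
  have cancel: "char_aut (inv_into UNIV \<sigma>) ` char_aut \<sigma> ` Z = Z"
    by (simp add: image_image char_aut_inv[OF \<sigma>])
  have "detects_closed_surface N x0 (char_aut \<sigma> ` Z) \<longleftrightarrow> detects_closed_surface N x0 Z"
    using detects_closed_surface_aut[OF \<sigma>, of Z]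
      detects_closed_surface_aut[OF field_aut_inv[OF \<sigma>], of "char_aut \<sigma> ` Z"] cancel by auto
  moreover have "detects_slope N x0 (char_aut \<sigma> ` Z) \<alpha> \<longleftrightarrow> detects_slope N x0 Z \<alpha>" for \<alpha>
    using detects_slope_aut[OF \<sigma>, of Z \<alpha>]
      detects_slope_aut[OF field_aut_inv[OF \<sigma>], of "char_aut \<sigma> ` Z" \<alpha>] cancel by auto
  ultimately show "x \<in> same_detection_union N x0 Y"
    using Z(2,3) x irreducible_component_aut[OF \<sigma> Z(1)] unfolding same_detection_union_def by blast
qed

end

section \<open>Rationality in trace coordinates\<close>

context
  fixes G :: "'g monoid" and gs :: "'g list"
  assumes group: "group G" and gs: "set gs \<subseteq> carrier G" and gen: "generate G (set gs) = carrier G"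
begin

abbreviation "tc \<equiv> trace_coords G gs"
abbreviation "cfuns \<equiv> {\<lambda>z :: nat set \<Rightarrow> complex. z J |J. J \<in> coord_indices (length gs)}"
abbreviation "gen_product J \<equiv> foldr (mult G) (map ((!) gs) (sorted_list_of_set J)) (one G)"

lemma gen_product_closed: "J \<in> coord_indices (length gs) \<Longrightarrow> gen_product J \<in> carrier G"
proof -
  interpret group G by (rule group)
  assume "J \<in> coord_indices (length gs)"
  then have "finite J" "J \<subseteq> {..<length gs}" by (auto simp: coord_indices_def intro: finite_subset)
  then have "set (sorted_list_of_set J) \<subseteq> {..<length gs}" by simp
  then show ?thesis
  proof (induction "sorted_list_of_set J" arbitrary: J)
    case Nil
    then show ?case by simp
  next
    case (Cons a l)
    have "foldr (mult G) (map ((!) gs) l) (one G) \<in> carrier G" if "set l \<subseteq> {..<length gs}" for l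
      using that gs by (induction l) (auto intro!: m_closed simp: subset_iff)
    then show ?case using Cons.prems by blast
  qed
qed

lemma trace_coords_app: "J \<in> coord_indices (length gs) \<Longrightarrow> tc x J = x (gen_product J)"
  by (simp add: trace_coords_def)

lemma finite_coord_functions: "finite (coord_functions G gs)"
  by (simp add: coord_functions_def[OF group gs] coord_indices_def)

lemma coord_functions_subset: "coord_functions G gs \<subseteq> trace_function ` carrier G"
  using gen_product_closed by (auto simp: coord_functions_def[OF group gs])

lemma trace_function_coord:
  assumes "\<gamma> \<in> carrier G"
  shows "\<exists>f\<in>polyfuns \<rat> (coord_functions G gs). \<forall>x\<in>sl2_characters G. trace_function \<gamma> x = f x"
  using character_rational[OF group gs, of \<gamma>] assms gen by (auto simp: rational_on_def[OF group] trace_function_def)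

lemma trace_function_trace_coords:
  assumes "\<gamma> \<in> carrier G"
  shows "\<exists>p\<in>polyfuns \<rat> cfuns. \<forall>x\<in>sl2_characters G. x \<gamma> = p (tc x)"
proof -
  obtain f where f: "f \<in> polyfuns \<rat> (coord_functions G gs)" "\<forall>x\<in>sl2_characters G. trace_function \<gamma> x = f x"
    using trace_function_coord[OF assms] by blast
  have "\<exists>p\<in>polyfuns \<rat> cfuns. \<forall>x\<in>sl2_characters G. f (id x) = p (tc x)"
  proof (rule polyfuns_pullback[OF f(1)])
    fix \<phi> assume "\<phi> \<in> coord_functions G gs"
    then obtain J where J: "J \<in> coord_indices (length gs)" "\<phi> = trace_function (gen_product J)"
      by (auto simp: coord_functions_def[OF group gs])
    then show "\<exists>\<psi>\<in>polyfuns \<rat> cfuns. \<forall>x\<in>sl2_characters G. \<phi> (id x) = \<psi> (tc x)"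
      by (intro bexI[of _ "\<lambda>z. z J"] polyfuns.coord) (auto simp: trace_function_def trace_coords_app)
  qed
  then show ?thesis using f(2) by (simp add: trace_function_def)
qed

text \<open>Makes the basis theorem applicable: there may be infinitely many trace functions, but on
  characters each is a polynomial in the finitely many \<open>coord_functions\<close>.\<close>

lemma algebraic_subset_coords:
  "algebraic_subset (sl2_characters G) (trace_function ` carrier G) =
   algebraic_subset (sl2_characters G) (coord_functions G gs)"
proof (rule ext, rule iffI)
  fix Z
  show "algebraic_subset (sl2_characters G) (coord_functions G gs) Z"
    if "algebraic_subset (sl2_characters G) (trace_function ` carrier G) Z"
    using that
  proof (rule polyfuns_eq_cong[rotated])
    fix f :: "('g \<Rightarrow> complex) \<Rightarrow> complex" assume "f \<in> polyfuns UNIV (trace_function ` carrier G)"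
    then have "\<exists>g\<in>polyfuns UNIV (coord_functions G gs). \<forall>x\<in>sl2_characters G. f (id x) = g (id x)"
    proof (rule polyfuns_pullback)
      fix \<phi> :: "('g \<Rightarrow> complex) \<Rightarrow> complex" assume "\<phi> \<in> trace_function ` carrier G"
      then obtain f where "f \<in> polyfuns \<rat> (coord_functions G gs)" "\<forall>x\<in>sl2_characters G. \<phi> x = f x"
        using trace_function_coord by blast
      then show "\<exists>\<psi>\<in>polyfuns UNIV (coord_functions G gs). \<forall>x\<in>sl2_characters G. \<phi> (id x) = \<psi> (id x)"
        using polyfuns_mono[of f \<rat> "coord_functions G gs" UNIV "coord_functions G gs"]
        by (auto intro: polyfuns.coord)
    qed
    then show "\<exists>g\<in>polyfuns UNIV (coord_functions G gs). \<forall>x\<in>sl2_characters G. f x = g x" by simp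
  qed
  show "algebraic_subset (sl2_characters G) (trace_function ` carrier G) Z"
    if "algebraic_subset (sl2_characters G) (coord_functions G gs) Z"
    using that
  proof (rule polyfuns_eq_cong[rotated])
    fix f :: "('g \<Rightarrow> complex) \<Rightarrow> complex" assume "f \<in> polyfuns UNIV (coord_functions G gs)"
    then have "f \<in> polyfuns UNIV (trace_function ` carrier G)"
      by (rule polyfuns_mono) (use coord_functions_subset in \<open>auto intro: polyfuns.coord\<close>)
    then show "\<exists>g\<in>polyfuns UNIV (trace_function ` carrier G). \<forall>x\<in>sl2_characters G. f x = g x" by blast
  qed
qed

lemma algebraic_union_of_components:
  assumes "\<C> \<subseteq> irreducible_components (sl2_characters G) (trace_function ` carrier G)"
  shows "algebraic_subset (sl2_characters G) (trace_function ` carrier G) (\<Union> \<C>)"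
proof (rule algebraic_subset_Union)
  have "irreducible_components (sl2_characters G) (trace_function ` carrier G) =
      irreducible_components (sl2_characters G) (coord_functions G gs)"
    by (simp add: irreducible_components_def irreducible_subset_def algebraic_subset_coords)
  then show "finite \<C>"
    using finite_irreducible_components[OF noetherian_polyfuns[OF finite_coord_functions]] assms
    by (metis finite_subset)
  show "algebraic_subset (sl2_characters G) (trace_function ` carrier G) Z" if "Z \<in> \<C>" for Z
    using that assms by (auto simp: irreducible_components_def irreducible_subset_def)
qed

text \<open>\<open>P\<close> consists of all rational relations on the image. At a common zero
  \<open>z\<close> of \<open>P\<close>, the trace polynomials \<open>p\<close> define a function
  \<open>inv_tc z\<close> on the group. It satisfies the rational identities of characters and so is
  a character; its coordinates are \<open>z\<close>; and by descent it lies in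
  \<open>Z\<close>.\<close>

lemma trace_coords_image_rational:
  assumes Z: "algebraic_subset (sl2_characters G) (trace_function ` carrier G) Z"
    and s: "\<And>\<sigma>. field_aut \<sigma> \<Longrightarrow> Z \<subseteq> s \<sigma> ` Z"
      "\<And>\<sigma> \<gamma> x. field_aut \<sigma> \<Longrightarrow> \<gamma> \<in> carrier G \<Longrightarrow> x \<in> Z \<Longrightarrow> s \<sigma> x \<gamma> = \<sigma> (x \<gamma>)"
  shows "\<exists>P\<subseteq>polyfuns \<rat> cfuns. tc ` Z = zero_set (coord_indices (length gs) \<rightarrow>\<^sub>E UNIV) P"
proof -
  let ?X = "sl2_characters G" and ?T = "trace_function ` carrier G"
  define P where "P = {q \<in> polyfuns \<rat> cfuns. \<forall>x\<in>Z. q (tc x) = 0}"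
  have ZX: "Z \<subseteq> ?X" using Z by (auto simp: algebraic_subset_def zero_set_def)
  have "\<forall>\<gamma>\<in>carrier G. \<exists>p. p \<in> polyfuns \<rat> cfuns \<and> (\<forall>x\<in>?X. x \<gamma> = p (tc x))"
    using trace_function_trace_coords by blast
  from bchoice[OF this] obtain p where
    "\<forall>\<gamma>\<in>carrier G. p \<gamma> \<in> polyfuns \<rat> cfuns \<and> (\<forall>x\<in>?X. x \<gamma> = p \<gamma> (tc x))" ..
  then have p: "\<And>\<gamma>. \<gamma> \<in> carrier G \<Longrightarrow> p \<gamma> \<in> polyfuns \<rat> cfuns"
    "\<And>\<gamma> x. \<gamma> \<in> carrier G \<Longrightarrow> x \<in> ?X \<Longrightarrow> x \<gamma> = p \<gamma> (tc x)" by blast+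
  define inv_tc where "inv_tc z = (\<lambda>\<gamma>\<in>carrier G. p \<gamma> z)" for z
  have inv_tc: "inv_tc (tc x) = x" if "x \<in> ?X" for x
  proof
    fix \<gamma>
    have "x \<in> extensional (carrier G)" using that by (auto simp: sl2_characters_def)
    then show "inv_tc (tc x) \<gamma> = x \<gamma>" using p(2)[OF _ that, of \<gamma>] by (auto simp: inv_tc_def extensional_def)
  qed
  have pull: "\<exists>g\<in>polyfuns \<rat> cfuns. \<forall>z. q (inv_tc z) = g z" if "q \<in> polyfuns \<rat> ?T" for q
  proof -
    have "\<exists>g\<in>polyfuns \<rat> cfuns. \<forall>z\<in>UNIV. q (inv_tc z) = g (id z)"
    proof (rule polyfuns_pullback[OF that])
      fix \<phi> :: "('g \<Rightarrow> complex) \<Rightarrow> complex" assume "\<phi> \<in> ?T"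
      then obtain \<gamma> where "\<gamma> \<in> carrier G" "\<phi> = trace_function \<gamma>" by blast
      then show "\<exists>\<psi>\<in>polyfuns \<rat> cfuns. \<forall>z\<in>UNIV. \<phi> (inv_tc z) = \<psi> (id z)"
        using p(1) by (intro bexI[of _ "p \<gamma>"]) (auto simp: trace_function_def inv_tc_def)
    qed
    then show ?thesis by simp
  qed
  have "z \<in> tc ` Z" if z: "z \<in> coord_indices (length gs) \<rightarrow>\<^sub>E UNIV" "\<And>q. q \<in> P \<Longrightarrow> q z = 0" for z
  proof -
    have vanish: "q (inv_tc z) = 0" if q: "q \<in> polyfuns \<rat> ?T" "\<And>x. x \<in> Z \<Longrightarrow> q x = 0" for q
    proof -
      obtain g where g: "g \<in> polyfuns \<rat> cfuns" "\<And>z. q (inv_tc z) = g z" using pull[OF q(1)] by blast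
      have "g (tc x) = 0" if "x \<in> Z" for x
        using g(2)[of "tc x"] inv_tc[of x] q(2)[OF that] ZX that by auto
      then have "g \<in> P" using g(1) by (simp add: P_def)
      then show ?thesis using z(2) g(2) by simp
    qed
    \<comment> \<open>Identities valid for all characters hold on \<open>Z\<close> in particular, so
      they are among the relations that \<open>z\<close> satisfies.\<close>
    have "inv_tc z \<in> rational_closure G"
      unfolding rational_closure_def[OF group]
      using vanish ZX by (auto simp: inv_tc_def)
    then have X: "inv_tc z \<in> ?X" using rational_closure_subset[OF group] by blast
    have tcz: "tc (inv_tc z) = z"
    proof
      fix J
      show "tc (inv_tc z) J = z J"
      proof (cases "J \<in> coord_indices (length gs)")
        case True
        note J = gen_product_closed[OF True]
        \<comment> \<open>The trace of an increasing product of generators is itself a coordinate,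
          so this difference vanishes on the image of \<open>Z\<close> and belongs to
          \<open>P\<close>.\<close>
        have "(\<lambda>z. p (gen_product J) z - z J) \<in> polyfuns \<rat> cfuns"
          by (intro polyfuns_diff p(1)[OF J] polyfuns.coord) (use True in auto)
        moreover have "p (gen_product J) (tc x) - tc x J = 0" if "x \<in> Z" for x
          using p(2)[OF J, of x] ZX that by (auto simp: trace_coords_app[OF True])
        ultimately have "(\<lambda>z. p (gen_product J) z - z J) \<in> P" by (simp add: P_def)
        from z(2)[OF this] show ?thesis using J by (simp add: trace_coords_app[OF True] inv_tc_def)
      next
        case False
        then show ?thesis using z(1) by (auto simp: trace_coords_def PiE_def extensional_def)
      qed
    qed
    \<comment> \<open>A complex equation of \<open>Z\<close> that failed here would yield a rational
      one that fails, against \<open>vanish\<close>.\<close>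
    have "inv_tc z \<in> Z"
    proof (rule ccontr)
      assume "inv_tc z \<notin> Z"
      then obtain f where f: "f \<in> polyfuns UNIV ?T" "\<And>x. x \<in> Z \<Longrightarrow> f x = 0" "f (inv_tc z) \<noteq> 0"
        using Z X by (auto simp: algebraic_subset_def zero_set_def)
      have s_coord: "\<phi> (s \<sigma> x) = \<sigma> (\<phi> x)" if "field_aut \<sigma>" "\<phi> \<in> ?T" "x \<in> Z" for \<sigma> \<phi> x
        using that s(2) by (auto simp: trace_function_def)
      have "\<exists>q\<in>polyfuns \<rat> ?T. (\<forall>x\<in>Z. q x = 0) \<and> q (inv_tc z) \<noteq> 0"
        by (rule rational_polyfun_separating[where f = f and z = "inv_tc z" and s = s and Z = Z and \<Phi> = ?T])
          (fact s(1), fact s_coord, fact f(1), fact f(2), fact f(3), blast)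
      then show False using vanish by blast
    qed
    then show ?thesis using tcz by (metis imageI)
  qed
  moreover have "tc x \<in> coord_indices (length gs) \<rightarrow>\<^sub>E UNIV" for x by (auto simp: trace_coords_def)
  ultimately have "tc ` Z = zero_set (coord_indices (length gs) \<rightarrow>\<^sub>E UNIV) P"
    by (auto simp: zero_set_def P_def)
  then show ?thesis by (intro exI[of _ P]) (auto simp: P_def)
qed

end

theorem proposition1p1:
  fixes N :: "'a::t2_space set" and x0 :: 'a and X :: "((real \<Rightarrow> 'a) set \<Rightarrow> complex) set"
  assumes "knot_manifold N" and "x0 \<in> N"
    and "X \<in> irreducible_components (char_variety N x0) (char_coords N x0)"
  shows "defined_over_Q N x0 (same_detection_union N x0 X)"
  unfolding defined_over_Q_def
proof (intro allI impI, elim conjE)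
  let ?G = "fundamental_group N x0" and ?Z = "same_detection_union N x0 X"
  fix gs assume gs: "set gs \<subseteq> carrier ?G" "generate ?G (set gs) = carrier ?G"
  have grp: "group ?G" using assms(2) by (rule group_fundamental_group)
  show "\<exists>P\<subseteq>polyfuns \<rat> {\<lambda>z. z J |J. J \<in> coord_indices (length gs)}.
         trace_coords ?G gs ` ?Z = zero_set (coord_indices (length gs) \<rightarrow>\<^sub>E UNIV) P"
  proof (rule trace_coords_image_rational[OF grp gs, where s = "map_on (carrier ?G)"])
    show "algebraic_subset (sl2_characters ?G) (trace_function ` carrier ?G) ?Z"
      unfolding same_detection_union_def
      by (rule algebraic_union_of_components[OF grp gs]) (auto simp: char_variety_eq char_coords_def)
    fix \<sigma> assume \<sigma>: "field_aut \<sigma>"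
    \<comment> \<open>Stability under the inverse automorphism gives the inclusion in this
      direction.\<close>
    show "?Z \<subseteq> map_on (carrier ?G) \<sigma> ` ?Z"
    proof
      fix x assume "x \<in> ?Z"
      then have "map_on (carrier ?G) (inv_into UNIV \<sigma>) x \<in> ?Z"
        using same_detection_union_aut[OF assms(2) field_aut_inv[OF \<sigma>]] by blast
      then show "x \<in> map_on (carrier ?G) \<sigma> ` ?Z"
        using char_aut_inv(1)[OF assms(2) \<sigma>, of x] by (metis imageI)
    qed
  qed (auto simp: map_on_def)
qed

end
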